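(* In the setting described in the context, suppose the treatments are assigned by pairwise sequential randomization (PSR), under which $\sum_{i=1}^n(2T_i-1)$ is bounded and $\sum_{i=1}^n(2T_i-1)\bm{x}_i=\bm{O}_P(1)$. Let $\lambda_2=1/\sigma_w$. 1. If $\mu_1-\mu_2=0$, then $$S\overset{d}{\rightarrow}N\left(0,\frac{\sigma_\epsilon^2}{\sigma_\epsilon^2+\sum_{j=1}^q\beta_{p+j}^2\mathrm{Var}(X_{p+j})}\right).$$ 2. If $\mu_1-\mu_2=\delta/\sqrt{n}$ for a fixed $\delta\neq0$, then $$S\overset{d}{\rightarrow}N\left(\frac12\lambda_2\delta,\frac{\sigma_\epsilon^2}{\sigma_\epsilon^2+\sum_{j=1}^q\beta_{p+j}^2\mathrm{Var}(X_{p+j})}\right).$$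
   Context: Setting. Fix integers $p,q\ge 0$. For each $n$ there are $n$ units; $T_i\in\{0,1\}$ is the treatment assignment of unit $i$ ($T_i=1$ for treatment 1, $T_i=0$ for treatment 2), possibly depending on $n$, and $\bm{x}_i=(x_{i,1},\dots,x_{i,p+q})^t$ is its covariate vector. The vectors $\bm{x}_i$ are i.i.d. over $i$; $x_{i,j}$ is distributed as $X_j$, the covariates $X_1,\dots,X_{p+q}$ are independent of each other, with $\mathbb{E}X_j=0$ and $0<\mathrm{Var}(X_j)<\infty$. The outcomes follow the true linear model $$Y_i=\mu_1T_i+\mu_2(1-T_i)+\sum_{j=1}^{p+q}\beta_jx_{i,j}+\epsilon_i,$$ where $\epsilon_1,\dots,\epsilon_n$ are i.i.d. with mean $0$ and variance $\sigma_\epsilon^2\in(0,\infty)$, independent of the covariates. The randomization uses only covariate information and external randomness: $(T_1,\dots,T_n)$ and all covariates are jointly independent of $(\epsilon_1,\dots,\epsilon_n)$. PSR. Units are assigned sequentially in pairs, one unit of each pair to each treatment (so $|\sum_{i=1}^n(2T_i-1)|\le1$). For each new pair, one computes the Mahalanobis distance between the covariate means of the two groups that would result from each of the two possible within-pair assignments, and a biased coin assigns the option with the smaller resulting distance with a fixed probability larger than $1/2$ (probability $1/2$ in case of a tie). The only property of PSR on covariate balance that is used is the known result (from the work introducing PSR) that $\sum_{i=1}^n(2T_i-1)\bm{x}_i=\bm{O}_P(1)$; it is taken as given. Working model. Only the first $p$ covariates are included: $\mathbb{E}[Y_i]=\mu_1T_i+\mu_2(1-T_i)+\sum_{j=1}^p\beta_jx_{i,j}$.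 Write $\bm{Y}=(Y_1,\dots,Y_n)^t$, $\bm{T}=(T_1,\dots,T_n)^t$, $\mathbf{X}_{\mathrm{in}}=(x_{i,j})_{1\le i\le n,1\le j\le p}$, $\bm{\beta}_{\mathrm{in}}=(\beta_1,\dots,\beta_p)^t$, $\bm{1}_n$ the vector of $n$ ones, $\mathbf{G}=[\bm{T};\bm{1}_n-\bm{T};\mathbf{X}_{\mathrm{in}}]$ (an $n\times(p+2)$ matrix, columns juxtaposed), and $\bm{\theta}=(\mu_1,\mu_2,\bm{\beta}_{\mathrm{in}}^t)^t$. The OLS estimator is $\hat{\bm{\theta}}=(\mathbf{G}^t\mathbf{G})^{-1}\mathbf{G}^t\bm{Y}$ (defined arbitrarily when $\mathbf{G}^t\mathbf{G}$ is singular). Test statistic for the treatment effect ($H_0:\mu_1-\mu_2=0$): $$S=\frac{\bm{L}^t\hat{\bm{\theta}}}{\sqrt{\hat\sigma_w^2\,\bm{L}^t(\mathbf{G}^t\mathbf{G})^{-1}\bm{L}}},\qquad \bm{L}=(1,-1,0,\dots,0)^t\in\mathbb{R}^{p+2},\qquad \hat\sigma_w^2=\frac{\Vert\bm{Y}-\mathbf{G}\hat{\bm{\theta}}\Vert^2}{n-p-2}.$$ Also $\sigma_w^2=\sigma_\epsilon^2+\sum_{j=1}^q\beta_{p+j}^2\mathrm{Var}(X_{p+j})$. *)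

theory Defs
  imports
    "HOL-Probability.Probability"
    "Jordan_Normal_Form.Gauss_Jordan_Elimination"
begin

(* Units and covariates are numbered from 0: units {..<n}, covariates {..<d} with d = p + q, the
   included covariates being {..<p} and the omitted ones p, ..., p + q - 1. *)

section \<open>Regression on data\<close>

(* The library's inverse, totalised: a singular matrix is sent to 0. This fixes the arbitrary value
   of the least squares estimator for a singular Gram matrix. *)
definition mat_inv :: "real mat \<Rightarrow> real mat" where
  "mat_inv A = (case mat_inverse A of
       Some B \<Rightarrow> B
     | None \<Rightarrow> 0\<^sub>m (dim_row A) (dim_row A))"

definition outcome ::
  "real \<Rightarrow> real \<Rightarrow> nat \<Rightarrow> (nat \<Rightarrow> real) \<Rightarrow> (nat \<Rightarrow> real) \<Rightarrow> (nat \<Rightarrow> nat \<Rightarrow> real) \<Rightarrow>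
   (nat \<Rightarrow> real) \<Rightarrow> nat \<Rightarrow> real" where
  "outcome mu1 mu2 d beta t x e i =
     mu1 * t i + mu2 * (1 - t i) + (\<Sum>j<d. beta j * x i j) + e i"

definition design_mat :: "nat \<Rightarrow> nat \<Rightarrow> (nat \<Rightarrow> real) \<Rightarrow> (nat \<Rightarrow> nat \<Rightarrow> real) \<Rightarrow> real mat" where
  "design_mat n p t x = mat n (p + 2) (\<lambda>(i, j).
     if j = 0 then t i else if j = 1 then 1 - t i else x i (j - 2))"

definition ols_estimator ::
  "nat \<Rightarrow> nat \<Rightarrow> (nat \<Rightarrow> real) \<Rightarrow> (nat \<Rightarrow> nat \<Rightarrow> real) \<Rightarrow> (nat \<Rightarrow> real) \<Rightarrow> real vec" where
  "ols_estimator n p t x y =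
     (let G = design_mat n p t x in mat_inv (G\<^sup>T * G) *\<^sub>v (G\<^sup>T *\<^sub>v vec n y))"

definition resid_var ::
  "nat \<Rightarrow> nat \<Rightarrow> (nat \<Rightarrow> real) \<Rightarrow> (nat \<Rightarrow> nat \<Rightarrow> real) \<Rightarrow> (nat \<Rightarrow> real) \<Rightarrow> real" where
  "resid_var n p t x y =
     (let r = vec n y - design_mat n p t x *\<^sub>v ols_estimator n p t x y
      in scalar_prod r r / (real n - real p - 2))"

definition contrast :: "nat \<Rightarrow> real vec" where
  "contrast p = vec (p + 2) (\<lambda>j. if j = 0 then 1 else if j = 1 then - 1 else 0)"

definition test_stat ::
  "nat \<Rightarrow> nat \<Rightarrow> (nat \<Rightarrow> real) \<Rightarrow> (nat \<Rightarrow> nat \<Rightarrow> real) \<Rightarrow> (nat \<Rightarrow> real) \<Rightarrow> real" where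
  "test_stat n p t x y =
     (let G = design_mat n p t x; L = contrast p in
        scalar_prod L (ols_estimator n p t x y) /
        sqrt (resid_var n p t x y * scalar_prod L (mat_inv (G\<^sup>T * G) *\<^sub>v L)))"

section \<open>Probabilistic notions\<close>

definition bounded_in_prob :: "'w measure \<Rightarrow> (nat \<Rightarrow> 'w \<Rightarrow> real) \<Rightarrow> bool" where
  "bounded_in_prob M Z \<longleftrightarrow>
     (\<forall>e>0. \<exists>K. \<forall>\<^sub>F n in sequentially. measure M {\<omega> \<in> space M. \<bar>Z n \<omega>\<bar> > K} < e)"

(* Independence of two random elements; unlike indep_var, it allows distinct value types. *)
definition indep_elements ::
  "'w measure \<Rightarrow> 'a measure \<Rightarrow> ('w \<Rightarrow> 'a) \<Rightarrow> 'b measure \<Rightarrow> ('w \<Rightarrow> 'b) \<Rightarrow> bool" where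
  "indep_elements M A f B g \<longleftrightarrow>
     f \<in> measurable M A \<and> g \<in> measurable M B \<and>
     prob_space.indep_set M (sets (vimage_algebra (space M) f A))
       (sets (vimage_algebra (space M) g B))"

(* Normal law parametrised by its variance v > 0. *)
definition normal_law :: "real \<Rightarrow> real \<Rightarrow> real measure" where
  "normal_law m v = density lborel (\<lambda>z. ennreal (normal_density m (sqrt v) z))"

abbreviation cov_vec :: "nat \<Rightarrow> (nat \<Rightarrow> 'w \<Rightarrow> real) \<Rightarrow> 'w \<Rightarrow> nat \<Rightarrow> real" where
  "cov_vec d v \<equiv> \<lambda>\<omega>. \<lambda>j\<in>{..<d}. v j \<omega>"

abbreviation vec_space :: "nat \<Rightarrow> (nat \<Rightarrow> real) measure" where
  "vec_space d \<equiv> PiM {..<d} (\<lambda>_. borel)"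

abbreviation cov_array ::
  "nat \<Rightarrow> nat \<Rightarrow> (nat \<Rightarrow> nat \<Rightarrow> 'w \<Rightarrow> real) \<Rightarrow> 'w \<Rightarrow> nat \<times> nat \<Rightarrow> real" where
  "cov_array n d x \<equiv> \<lambda>\<omega>. \<lambda>(i, j)\<in>{..<n} \<times> {..<d}. x i j \<omega>"

abbreviation array_space :: "nat \<Rightarrow> nat \<Rightarrow> (nat \<times> nat \<Rightarrow> real) measure" where
  "array_space n d \<equiv> PiM ({..<n} \<times> {..<d}) (\<lambda>_. borel)"

section \<open>Pairwise sequential randomization\<close>

definition group_mean ::
  "nat \<Rightarrow> nat \<Rightarrow> (nat \<Rightarrow> real) \<Rightarrow> (nat \<Rightarrow> nat \<Rightarrow> real) \<Rightarrow> real vec" where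
  "group_mean d m w x = vec d (\<lambda>j. (\<Sum>i<m. w i * x i j) / (\<Sum>i<m. w i))"

definition mahalanobis :: "real mat \<Rightarrow> real vec \<Rightarrow> real vec \<Rightarrow> real" where
  "mahalanobis C u v = sqrt (scalar_prod (u - v) (mat_inv C *\<^sub>v (u - v)))"

definition imbalance ::
  "nat \<Rightarrow> nat \<Rightarrow> real mat \<Rightarrow> (nat \<Rightarrow> real) \<Rightarrow> (nat \<Rightarrow> nat \<Rightarrow> real) \<Rightarrow> real" where
  "imbalance d m C t x =
     mahalanobis C (group_mean d m t x) (group_mean d m (\<lambda>i. 1 - t i) x)"

(* Probability that, in the pair of units 2k and 2k + 1, the first one receives treatment 1. *)
definition psr_prob ::
  "real \<Rightarrow> nat \<Rightarrow> nat \<Rightarrow> real mat \<Rightarrow> (nat \<Rightarrow> real) \<Rightarrow> (nat \<Rightarrow> nat \<Rightarrow> real) \<Rightarrow> real" where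
  "psr_prob r d k C t x =
     (let D1 = imbalance d (2 * k + 2) C (t(2 * k := 1, 2 * k + 1 := 0)) x;
          D2 = imbalance d (2 * k + 2) C (t(2 * k := 0, 2 * k + 1 := 1)) x
      in if D1 < D2 then r else if D2 < D1 then 1 - r else 1 / 2)"

(* The information before the k-th pair is assigned: the covariates of the n units and the
   assignments of the first k pairs. *)
definition psr_history ::
  "'w measure \<Rightarrow> nat \<Rightarrow> nat \<Rightarrow> nat \<Rightarrow> (nat \<Rightarrow> nat \<Rightarrow> 'w \<Rightarrow> real) \<Rightarrow> (nat \<Rightarrow> 'w \<Rightarrow> real) \<Rightarrow>
   'w measure" where
  "psr_history M n d k x T = vimage_algebra (space M)
     (\<lambda>\<omega>. (cov_vec (2 * k) T \<omega>, cov_array n d x \<omega>)) (vec_space (2 * k) \<Otimes>\<^sub>M array_space n d)"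

(* C k is the covariance matrix that standardises the Mahalanobis distance at the k-th pair. It may
   be any symmetric positive semidefinite matrix computed from the covariates, so the population
   and the sample covariance matrix are both allowed; distances are taken to be 0 (hence tied)
   while it is singular. A last unpaired unit (n odd) may be assigned in any way. *)
definition PSR ::
  "'w measure \<Rightarrow> real \<Rightarrow> nat \<Rightarrow> nat \<Rightarrow> (nat \<Rightarrow> 'w \<Rightarrow> real mat) \<Rightarrow> (nat \<Rightarrow> nat \<Rightarrow> 'w \<Rightarrow> real) \<Rightarrow>
   (nat \<Rightarrow> 'w \<Rightarrow> real) \<Rightarrow> bool" where
  "PSR M r n d C x T \<longleftrightarrow>
     (\<forall>i<n. T i \<in> borel_measurable M \<and> (\<forall>\<omega>\<in>space M. T i \<omega> \<in> {0, 1})) \<and>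
     (\<forall>k. 2 * k + 1 < n \<longrightarrow>
        (\<forall>\<omega>\<in>space M. T (2 * k + 1) \<omega> = 1 - T (2 * k) \<omega>) \<and>
        (\<forall>\<omega>\<in>space M. C k \<omega> \<in> carrier_mat d d \<and> (C k \<omega>)\<^sup>T = C k \<omega> \<and>
           (\<forall>v\<in>carrier_vec d. scalar_prod v (C k \<omega> *\<^sub>v v) \<ge> 0)) \<and>
        (\<forall>a<d. \<forall>b<d. (\<lambda>\<omega>. C k \<omega> $$ (a, b)) \<in>
           borel_measurable (vimage_algebra (space M) (cov_array n d x) (array_space n d))) \<and>
        (AE \<omega> in M. real_cond_exp M (psr_history M n d k x T) (T (2 * k)) \<omega> =
           psr_prob r d k (C k \<omega>) (\<lambda>i. T i \<omega>) (\<lambda>i j. x i j \<omega>)))"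

lemma PSR_balanced:
  assumes "PSR M r n d C x T" and "\<omega> \<in> space M"
  shows "\<bar>\<Sum>i<n. 2 * T i \<omega> - 1\<bar> \<le> 1"
proof -
  have even: "(\<Sum>i<2 * m. 2 * T i \<omega> - 1) = 0" if "2 * m \<le> n" for m
    using that
  proof (induction m)
    case (Suc m)
    have "T (2 * m + 1) \<omega> = 1 - T (2 * m) \<omega>"
      using assms Suc.prems unfolding PSR_def by auto
    then show ?case using Suc by simp
  qed simp
  show ?thesis
  proof (cases "even n")
    case True
    then show ?thesis using even[of "n div 2"] by simp
  next
    case False
    then obtain m where n: "n = Suc (2 * m)" by (auto elim: oddE)
    have "T (2 * m) \<omega> \<in> {0, 1}"
      using assms n unfolding PSR_def by auto
    then show ?thesis using even[of m] n by auto
  qed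
qed

end

(* On the event that the Gram matrix G^t G is nonsingular, which has probability tending to 1, the
   coefficients of the working model cancel: with the errors z = (omitted covariates) + eps and the
   score g = G^t z, the statistic S is a function of n (G^t G)^{-1}, g / sqrt n and |z|^2 / n.
   Balance and the weak law make G^t G / n converge to diag(1/2, 1/2, Var X_1, ..., Var X_p), so with
   D_i = 2 T_i - 1 the numerator is asymptotically sqrt n (mu1 - mu2) + 2 sum_i D_i z_i / sqrt n and
   the denominator tends to 2 sigma_w. In sum_i D_i z_i the omitted covariates contribute O_P(1) by
   balance, which vanishes after division by sqrt n: they inflate the variance estimate but not the
   numerator. What is left is sum_i D_i eps_i / sqrt n, with signs D independent of eps; its
   characteristic function converges to that of N(0, sigma_eps^2) uniformly over the signs. *)

theory Submission
  imports Defs "HOL-Real_Asymp.Real_Asymp" "Jordan_Normal_Form.Determinant"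
begin

section \<open>Convergence in probability\<close>

text \<open>Two obstacles shape the proof. The assignments change with n, so the leading sum of D_i
  eps_i is not a partial sum of one sequence. The signs take finitely many values, so conditioning
  on them is a finite sum. And only second moments are assumed. Squares of covariates and errors
  have merely a first moment, and their averages need a weak law proved by truncation. Products of
  distinct covariates, or of a covariate and an error, are square integrable by independence, so
  Chebyshev's inequality bounds their sums divided by sqrt n. No joint limit law is required. The
  components of the score are only shown to be bounded in probability: their weights in the
  numerator converge, the limiting weights are nonzero on the two treatment components only, and
  what these two share cancels in their difference. The factor 1/2 in the drift comes from L^t
  diag(2, 2, ...) L = 4: its root 2 divides sqrt n (mu1 - mu2), which enters with coefficient 1, but
  cancels against the coefficient 2 of the noise.\<close>

definition conv_prob :: "'w measure \<Rightarrow> (nat \<Rightarrow> 'w \<Rightarrow> real) \<Rightarrow> real \<Rightarrow> bool" where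
  "conv_prob M Z c \<longleftrightarrow>
     (\<forall>n. Z n \<in> borel_measurable M) \<and>
     (\<forall>e>0. (\<lambda>n. measure M {\<omega> \<in> space M. \<bar>Z n \<omega> - c\<bar> > e}) \<longlonglongrightarrow> 0)"

lemma conv_prob_measurable: "conv_prob M Z c \<Longrightarrow> Z n \<in> borel_measurable M"
  by (simp add: conv_prob_def)

lemma conv_probD:
  "conv_prob M Z c \<Longrightarrow> e > 0 \<Longrightarrow> (\<lambda>n. measure M {\<omega> \<in> space M. \<bar>Z n \<omega> - c\<bar> > e}) \<longlonglongrightarrow> 0"
  by (simp add: conv_prob_def)

context prob_space
begin

lemma conv_prob_dominated:
  assumes [measurable]: "\<And>n. Z n \<in> borel_measurable M"
    and "\<And>e. e > 0 \<Longrightarrow> \<exists>u. u \<longlonglongrightarrow> 0 \<and>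
           (\<forall>\<^sub>F n in sequentially. prob {\<omega> \<in> space M. \<bar>Z n \<omega> - c\<bar> > e} \<le> u n)"
  shows "conv_prob M Z c"
  unfolding conv_prob_def
proof (intro conjI allI impI)
  fix e :: real assume "e > 0"
  then obtain u where u: "u \<longlonglongrightarrow> 0"
      "\<forall>\<^sub>F n in sequentially. prob {\<omega> \<in> space M. \<bar>Z n \<omega> - c\<bar> > e} \<le> u n"
    using assms(2) by blast
  show "(\<lambda>n. prob {\<omega> \<in> space M. \<bar>Z n \<omega> - c\<bar> > e}) \<longlonglongrightarrow> 0"
    by (rule tendsto_sandwich[OF _ u(2) tendsto_const u(1)]) simp
qed simp

text \<open>Continuous mapping for a pair. Continuity is asked only at the limit point, so that
  division by a sequence with nonzero limit is covered; measurability of the composition is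
  therefore a separate premise.\<close>

lemma conv_prob_isCont2:
  assumes X: "conv_prob M X a" and Y: "conv_prob M Y b"
    and f: "isCont (\<lambda>z. f (fst z) (snd z)) (a, b)"
    and [measurable]: "\<And>n. (\<lambda>\<omega>. f (X n \<omega>) (Y n \<omega>)) \<in> borel_measurable M"
  shows "conv_prob M (\<lambda>n \<omega>. f (X n \<omega>) (Y n \<omega>)) (f a b)"
proof (rule conv_prob_dominated)
  fix e :: real assume e: "e > 0"
  have [measurable]: "X n \<in> borel_measurable M" "Y n \<in> borel_measurable M" for n
    using X Y by (auto intro: conv_prob_measurable)
  obtain d where d: "d > 0" "\<And>z. dist z (a, b) < d \<Longrightarrow> dist (f (fst z) (snd z)) (f a b) < e"
    using f e unfolding continuous_at_eps_delta by (auto simp: dist_commute)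
  \<comment> \<open>Thirds rather than halves: off both events the distance is at most 2d/3, hence
    strictly below d.\<close>
  define u where "u n = prob {\<omega> \<in> space M. \<bar>X n \<omega> - a\<bar> > d / 3} +
      prob {\<omega> \<in> space M. \<bar>Y n \<omega> - b\<bar> > d / 3}" for n
  have "u \<longlonglongrightarrow> 0 + 0"
    unfolding u_def using d(1) by (intro tendsto_add conv_probD[OF X] conv_probD[OF Y]) auto
  moreover have "prob {\<omega> \<in> space M. \<bar>f (X n \<omega>) (Y n \<omega>) - f a b\<bar> > e} \<le> u n" for n
  proof -
    have "{\<omega> \<in> space M. \<bar>f (X n \<omega>) (Y n \<omega>) - f a b\<bar> > e} \<subseteq>
        {\<omega> \<in> space M. \<bar>X n \<omega> - a\<bar> > d / 3} \<union> {\<omega> \<in> space M. \<bar>Y n \<omega> - b\<bar> > d / 3}"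
    proof (rule ccontr)
      assume "\<not> ?thesis"
      then obtain \<omega> where w: "\<bar>X n \<omega> - a\<bar> \<le> d / 3" "\<bar>Y n \<omega> - b\<bar> \<le> d / 3"
          "\<bar>f (X n \<omega>) (Y n \<omega>) - f a b\<bar> > e" by (auto simp: subset_iff not_less)
      have "dist (X n \<omega>, Y n \<omega>) (a, b) \<le> \<bar>X n \<omega> - a\<bar> + \<bar>Y n \<omega> - b\<bar>"
        unfolding dist_prod_def fst_conv snd_conv dist_real_def
        using sqrt_sum_squares_le_sum_abs by (metis abs_abs)
      also have "\<dots> < d" using w d(1) by linarith
      finally show False using d(2)[of "(X n \<omega>, Y n \<omega>)"] w(3) by (simp add: dist_real_def)
    qed
    then show ?thesis
      unfolding u_def by (intro order_trans[OF finite_measure_mono measure_Un_le]) auto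
  qed
  ultimately show "\<exists>u. u \<longlonglongrightarrow> 0 \<and> (\<forall>\<^sub>F n in sequentially.
      prob {\<omega> \<in> space M. \<bar>f (X n \<omega>) (Y n \<omega>) - f a b\<bar> > e} \<le> u n)"
    by (intro exI[of _ u]) auto
qed simp

lemma conv_prob_tendsto: "c \<longlonglongrightarrow> l \<Longrightarrow> conv_prob M (\<lambda>n \<omega>. c n) l"
proof (rule conv_prob_dominated)
  fix e :: real assume "c \<longlonglongrightarrow> l" "e > 0"
  then have "\<forall>\<^sub>F n in sequentially. \<bar>c n - l\<bar> < e"
    using tendstoD by (fastforce simp: dist_real_def)
  then have "\<forall>\<^sub>F n in sequentially. prob {\<omega> \<in> space M. \<bar>c n - l\<bar> > e} \<le> 0"
    by eventually_elim auto
  then show "\<exists>u. u \<longlonglongrightarrow> 0 \<and>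
      (\<forall>\<^sub>F n in sequentially. prob {\<omega> \<in> space M. \<bar>c n - l\<bar> > e} \<le> u n)"
    by (intro exI[of _ "\<lambda>_. 0"]) auto
qed simp

lemma conv_prob_const: "conv_prob M (\<lambda>n \<omega>. c) c"
  by (rule conv_prob_tendsto) simp

lemma conv_prob_add:
  "conv_prob M X a \<Longrightarrow> conv_prob M Y b \<Longrightarrow> conv_prob M (\<lambda>n \<omega>. X n \<omega> + Y n \<omega>) (a + b)"
  by (rule conv_prob_isCont2)
     (auto intro!: continuous_intros borel_measurable_add dest: conv_prob_measurable)

lemma conv_prob_diff:
  "conv_prob M X a \<Longrightarrow> conv_prob M Y b \<Longrightarrow> conv_prob M (\<lambda>n \<omega>. X n \<omega> - Y n \<omega>) (a - b)"
  by (rule conv_prob_isCont2)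
     (auto intro!: continuous_intros borel_measurable_diff dest: conv_prob_measurable)

lemma conv_prob_mult:
  "conv_prob M X a \<Longrightarrow> conv_prob M Y b \<Longrightarrow> conv_prob M (\<lambda>n \<omega>. X n \<omega> * Y n \<omega>) (a * b)"
  by (rule conv_prob_isCont2)
     (auto intro!: continuous_intros borel_measurable_times dest: conv_prob_measurable)

lemma conv_prob_cmult: "conv_prob M X a \<Longrightarrow> conv_prob M (\<lambda>n \<omega>. c * X n \<omega>) (c * a)"
  by (rule conv_prob_mult[OF conv_prob_const])

lemma conv_prob_divide:
  "conv_prob M X a \<Longrightarrow> conv_prob M Y b \<Longrightarrow> b \<noteq> 0 \<Longrightarrow>
    conv_prob M (\<lambda>n \<omega>. X n \<omega> / Y n \<omega>) (a / b)"
  by (rule conv_prob_isCont2)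
     (auto intro!: continuous_intros borel_measurable_divide dest: conv_prob_measurable)

lemma conv_prob_sqrt:
  assumes "conv_prob M X a"
  shows "conv_prob M (\<lambda>n \<omega>. sqrt (X n \<omega>)) (sqrt a)"
proof -
  have [measurable]: "X n \<in> borel_measurable M" for n
    using assms by (rule conv_prob_measurable)
  show ?thesis
  proof (rule conv_prob_isCont2[OF assms conv_prob_const[of 0], of "\<lambda>x _. sqrt x"])
    show "isCont (\<lambda>z. sqrt (fst z)) (a, 0::real)"
      by (intro continuous_intros)
  qed simp
qed

lemma conv_prob_sum:
  "(\<And>i. i \<in> I \<Longrightarrow> conv_prob M (X i) (a i)) \<Longrightarrow>
    conv_prob M (\<lambda>n \<omega>. \<Sum>i\<in>I. X i n \<omega>) (\<Sum>i\<in>I. a i)"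
  by (induction I rule: infinite_finite_induct) (auto intro!: conv_prob_const conv_prob_add)

lemma conv_prob_prod:
  "(\<And>i. i \<in> I \<Longrightarrow> conv_prob M (X i) (a i)) \<Longrightarrow>
    conv_prob M (\<lambda>n \<omega>. \<Prod>i\<in>I. X i n \<omega>) (\<Prod>i\<in>I. a i)"
  by (induction I rule: infinite_finite_induct) (auto intro!: conv_prob_const conv_prob_mult)

text \<open>Lets the closed formula for the statistic, valid only for n > 0 and off the event of a
  singular Gram matrix, replace the statistic itself.\<close>

lemma conv_prob_cong_in_prob:
  assumes X: "conv_prob M X c"
    and Y [measurable]: "\<And>n. Y n \<in> borel_measurable M"
    and A [measurable]: "\<And>n. A n \<in> sets M"
    and le: "(\<lambda>n. prob (A n)) \<longlonglongrightarrow> 0"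
    and eq: "\<forall>\<^sub>F n in sequentially. \<forall>\<omega>\<in>space M - A n. X n \<omega> = Y n \<omega>"
  shows "conv_prob M Y c"
proof (rule conv_prob_dominated)
  fix e :: real assume e: "e > 0"
  have [measurable]: "X n \<in> borel_measurable M" for n
    using X by (rule conv_prob_measurable)
  define u where "u n = prob {\<omega> \<in> space M. \<bar>X n \<omega> - c\<bar> > e} + prob (A n)" for n
  have "u \<longlonglongrightarrow> 0 + 0"
    unfolding u_def by (intro tendsto_add le conv_probD[OF X] e)
  moreover have "\<forall>\<^sub>F n in sequentially. prob {\<omega> \<in> space M. \<bar>Y n \<omega> - c\<bar> > e} \<le> u n"
    using eq
  proof eventually_elim
    case (elim n)
    have "{\<omega> \<in> space M. \<bar>Y n \<omega> - c\<bar> > e} \<subseteq> {\<omega> \<in> space M. \<bar>X n \<omega> - c\<bar> > e} \<union> A n"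
      using elim by auto
    then show ?case
      unfolding u_def by (intro order_trans[OF finite_measure_mono measure_Un_le]) auto
  qed
  ultimately show "\<exists>u. u \<longlonglongrightarrow> 0 \<and>
      (\<forall>\<^sub>F n in sequentially. prob {\<omega> \<in> space M. \<bar>Y n \<omega> - c\<bar> > e} \<le> u n)"
    by (intro exI[of _ u]) auto
qed simp

section \<open>Boundedness in probability\<close>

lemma bounded_in_prob_add:
  assumes [measurable]: "\<And>n. X n \<in> borel_measurable M" "\<And>n. Y n \<in> borel_measurable M"
    and X: "bounded_in_prob M X" and Y: "bounded_in_prob M Y"
  shows "bounded_in_prob M (\<lambda>n \<omega>. X n \<omega> + Y n \<omega>)"
  unfolding bounded_in_prob_def
proof (intro allI impI)
  fix e :: real assume "e > 0"
  then have e: "e / 2 > 0" by simp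
  obtain K L where
    K: "\<forall>\<^sub>F n in sequentially. prob {\<omega> \<in> space M. \<bar>X n \<omega>\<bar> > K} < e / 2" and
    L: "\<forall>\<^sub>F n in sequentially. prob {\<omega> \<in> space M. \<bar>Y n \<omega>\<bar> > L} < e / 2"
    using X Y e unfolding bounded_in_prob_def by meson
  show "\<exists>K. \<forall>\<^sub>F n in sequentially. prob {\<omega> \<in> space M. \<bar>X n \<omega> + Y n \<omega>\<bar> > K} < e"
  proof (intro exI)
    show "\<forall>\<^sub>F n in sequentially. prob {\<omega> \<in> space M. \<bar>X n \<omega> + Y n \<omega>\<bar> > K + L} < e"
      using K L
    proof eventually_elim
      case (elim n)
      have "{\<omega> \<in> space M. \<bar>X n \<omega> + Y n \<omega>\<bar> > K + L} \<subseteq>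
          {\<omega> \<in> space M. \<bar>X n \<omega>\<bar> > K} \<union> {\<omega> \<in> space M. \<bar>Y n \<omega>\<bar> > L}"
        by auto
      then have "prob {\<omega> \<in> space M. \<bar>X n \<omega> + Y n \<omega>\<bar> > K + L} \<le>
          prob {\<omega> \<in> space M. \<bar>X n \<omega>\<bar> > K} + prob {\<omega> \<in> space M. \<bar>Y n \<omega>\<bar> > L}"
        by (intro order_trans[OF finite_measure_mono measure_Un_le]) auto
      then show ?case using elim by simp
    qed
  qed
qed

lemma bounded_in_prob_mono:
  assumes [measurable]: "\<And>n. Y n \<in> borel_measurable M"
    and Y: "bounded_in_prob M Y" and le: "\<And>n \<omega>. \<omega> \<in> space M \<Longrightarrow> \<bar>X n \<omega>\<bar> \<le> \<bar>Y n \<omega>\<bar>"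
  shows "bounded_in_prob M X"
  unfolding bounded_in_prob_def
proof (intro allI impI)
  fix e :: real assume "e > 0"
  then obtain K where K: "\<forall>\<^sub>F n in sequentially. prob {\<omega> \<in> space M. \<bar>Y n \<omega>\<bar> > K} < e"
    using Y unfolding bounded_in_prob_def by meson
  have "prob {\<omega> \<in> space M. \<bar>X n \<omega>\<bar> > K} \<le> prob {\<omega> \<in> space M. \<bar>Y n \<omega>\<bar> > K}" for n
    by (intro finite_measure_mono) (auto dest: le[of _ n])
  with K show "\<exists>K. \<forall>\<^sub>F n in sequentially. prob {\<omega> \<in> space M. \<bar>X n \<omega>\<bar> > K} < e"
    by (intro exI[of _ K], elim eventually_mono) (meson order.strict_trans1)
qed

lemma bounded_in_prob_cmult:
  assumes X: "bounded_in_prob M X"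
  shows "bounded_in_prob M (\<lambda>n \<omega>. c * X n \<omega>)"
  unfolding bounded_in_prob_def
proof (intro allI impI)
  fix e :: real assume e: "e > 0"
  then obtain K where K: "\<forall>\<^sub>F n in sequentially. prob {\<omega> \<in> space M. \<bar>X n \<omega>\<bar> > K} < e"
    using X unfolding bounded_in_prob_def by meson
  show "\<exists>K. \<forall>\<^sub>F n in sequentially. prob {\<omega> \<in> space M. \<bar>c * X n \<omega>\<bar> > K} < e"
  proof (cases "c = 0")
    case True
    then show ?thesis using e by (intro exI[of _ 0]) simp
  next
    case False
    then have "\<bar>c * X n \<omega>\<bar> > \<bar>c\<bar> * K \<longleftrightarrow> \<bar>X n \<omega>\<bar> > K" for n \<omega>
      by (simp add: abs_mult)
    then show ?thesis using K by (intro exI[of _ "\<bar>c\<bar> * K"]) simp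
  qed
qed

lemma bounded_in_prob_sum:
  assumes "finite I" "\<And>i n. i \<in> I \<Longrightarrow> X i n \<in> borel_measurable M"
    and "\<And>i. i \<in> I \<Longrightarrow> bounded_in_prob M (X i)"
  shows "bounded_in_prob M (\<lambda>n \<omega>. \<Sum>i\<in>I. X i n \<omega>)"
  using assms
proof (induction I rule: finite_induct)
  case empty
  show ?case unfolding bounded_in_prob_def by (auto intro!: exI[of _ 0])
next
  case (insert i I)
  then show ?case by (auto intro!: bounded_in_prob_add)
qed

text \<open>The rule O_P(1) o_P(1) = o_P(1): if |X| is at most K and |Y| at most e/K, then |XY| is
  at most e.\<close>

lemma conv_prob_bounded_mult_zero:
  assumes [measurable]: "\<And>n. X n \<in> borel_measurable M"
    and X: "bounded_in_prob M X" and Y: "conv_prob M Y 0"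
  shows "conv_prob M (\<lambda>n \<omega>. X n \<omega> * Y n \<omega>) 0"
proof -
  have [measurable]: "Y n \<in> borel_measurable M" for n
    using Y by (rule conv_prob_measurable)
  show ?thesis
    unfolding conv_prob_def
  proof (intro conjI allI impI)
    fix e :: real assume e: "e > 0"
    show "(\<lambda>n. prob {\<omega> \<in> space M. \<bar>X n \<omega> * Y n \<omega> - 0\<bar> > e}) \<longlonglongrightarrow> 0"
    proof (rule order_tendstoI)
      fix a :: real assume "a < 0"
      then show "\<forall>\<^sub>F n in sequentially. a < prob {\<omega> \<in> space M. \<bar>X n \<omega> * Y n \<omega> - 0\<bar> > e}"
        by (auto intro!: always_eventually simp: less_le_trans)
    next
      fix a :: real assume "0 < a"
      then have a: "a / 2 > 0" by simp
      obtain K' where K': "\<forall>\<^sub>F n in sequentially. prob {\<omega> \<in> space M. \<bar>X n \<omega>\<bar> > K'} < a / 2"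
        using X a unfolding bounded_in_prob_def by meson
      \<comment> \<open>The bound K' may be 0 or negative; \<open>K\<close> has to be positive for
        the threshold e/K.\<close>
      define K where "K = max K' 1"
      have K: "K > 0" "K \<ge> K'" by (auto simp: K_def)
      have "\<forall>\<^sub>F n in sequentially. prob {\<omega> \<in> space M. \<bar>Y n \<omega> - 0\<bar> > e / K} < a / 2"
        using conv_probD[OF Y, of "e / K"] e K a by (intro order_tendstoD(2)) auto
      with K' show "\<forall>\<^sub>F n in sequentially. prob {\<omega> \<in> space M. \<bar>X n \<omega> * Y n \<omega> - 0\<bar> > e} < a"
      proof eventually_elim
        case (elim n)
        have "{\<omega> \<in> space M. \<bar>X n \<omega> * Y n \<omega> - 0\<bar> > e} \<subseteq>
            {\<omega> \<in> space M. \<bar>X n \<omega>\<bar> > K'} \<union> {\<omega> \<in> space M. \<bar>Y n \<omega> - 0\<bar> > e / K}"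
        proof (rule ccontr)
          assume "\<not> ?thesis"
          then obtain \<omega> where w: "\<bar>X n \<omega>\<bar> \<le> K'" "\<bar>Y n \<omega>\<bar> \<le> e / K" "\<bar>X n \<omega> * Y n \<omega>\<bar> > e"
            by (auto simp: subset_iff not_less)
          have "\<bar>X n \<omega>\<bar> * \<bar>Y n \<omega>\<bar> \<le> K * (e / K)"
            using w K by (intro mult_mono) auto
          then show False using w K by (simp add: abs_mult)
        qed
        then have "prob {\<omega> \<in> space M. \<bar>X n \<omega> * Y n \<omega> - 0\<bar> > e} \<le>
            prob {\<omega> \<in> space M. \<bar>X n \<omega>\<bar> > K'} + prob {\<omega> \<in> space M. \<bar>Y n \<omega> - 0\<bar> > e / K}"
          by (intro order_trans[OF finite_measure_mono measure_Un_le]) auto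
        then show ?case using elim by simp
      qed
    qed
  qed simp
qed

lemma conv_prob_bounded_div_sqrt:
  assumes "\<And>n. X n \<in> borel_measurable M" "bounded_in_prob M X"
  shows "conv_prob M (\<lambda>n \<omega>. X n \<omega> / sqrt (real n)) 0"
proof -
  have "(\<lambda>n. 1 / sqrt (real n)) \<longlonglongrightarrow> 0"
    by real_asymp
  from conv_prob_bounded_mult_zero[OF assms conv_prob_tendsto[OF this]]
  show ?thesis by simp
qed

lemma conv_prob_imp_bounded:
  assumes X: "conv_prob M X c"
  shows "bounded_in_prob M X"
  unfolding bounded_in_prob_def
proof (intro allI impI)
  fix e :: real assume e: "e > 0"
  have [measurable]: "X n \<in> borel_measurable M" for n
    using X by (rule conv_prob_measurable)
  have "\<forall>\<^sub>F n in sequentially. prob {\<omega> \<in> space M. \<bar>X n \<omega> - c\<bar> > 1} < e"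
    using conv_probD[OF X, of 1] e by (intro order_tendstoD(2)) auto
  moreover have "prob {\<omega> \<in> space M. \<bar>X n \<omega>\<bar> > \<bar>c\<bar> + 1} \<le> prob {\<omega> \<in> space M. \<bar>X n \<omega> - c\<bar> > 1}" for n
    by (intro finite_measure_mono) auto
  ultimately show "\<exists>K. \<forall>\<^sub>F n in sequentially. prob {\<omega> \<in> space M. \<bar>X n \<omega>\<bar> > K} < e"
    by (intro exI[of _ "\<bar>c\<bar> + 1"], elim eventually_mono) (meson order.strict_trans1)
qed

section \<open>Chebyshev bounds from second moments\<close>

lemma prob_abs_gt_le_second_moment:
  assumes [measurable]: "X \<in> borel_measurable M"
    and "integrable M (\<lambda>\<omega>. (X \<omega>)\<^sup>2)" "expectation (\<lambda>\<omega>. (X \<omega>)\<^sup>2) \<le> B" "K > 0"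
  shows "prob {\<omega> \<in> space M. \<bar>X \<omega>\<bar> > K} \<le> B / K\<^sup>2"
proof -
  have "prob {\<omega> \<in> space M. \<bar>X \<omega>\<bar> > K} \<le> prob {\<omega> \<in> space M. (X \<omega>)\<^sup>2 \<ge> K\<^sup>2}"
    using assms(4) by (intro finite_measure_mono) (auto simp: abs_le_square_iff[symmetric])
  also have "\<dots> \<le> expectation (\<lambda>\<omega>. (X \<omega>)\<^sup>2) / K\<^sup>2"
    using assms by (intro integral_Markov_inequality_measure[where A = "{}"]) auto
  also have "\<dots> \<le> B / K\<^sup>2"
    using assms by (intro divide_right_mono) auto
  finally show ?thesis .
qed

lemma bounded_in_prob_second_moment:
  assumes [measurable]: "\<And>n. X n \<in> borel_measurable M"
    and int: "\<And>n. integrable M (\<lambda>\<omega>. (X n \<omega>)\<^sup>2)"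
    and le: "\<And>n. expectation (\<lambda>\<omega>. (X n \<omega>)\<^sup>2) \<le> B"
  shows "bounded_in_prob M X"
  unfolding bounded_in_prob_def
proof (intro allI impI)
  fix e :: real assume e: "e > 0"
  have B: "B \<ge> 0" using le[of 0] by (rule order_trans[rotated]) simp
  \<comment> \<open>Makes the Chebyshev bound equal to e B / (B + 1), which is strictly below e; the
    added 1 covers B = 0.\<close>
  define K where "K = sqrt ((B + 1) / e)"
  have K: "K > 0" "K\<^sup>2 = (B + 1) / e"
    using B e by (auto simp: K_def)
  have "prob {\<omega> \<in> space M. \<bar>X n \<omega>\<bar> > K} < e" for n
  proof -
    have "prob {\<omega> \<in> space M. \<bar>X n \<omega>\<bar> > K} \<le> B / K\<^sup>2"
      by (rule prob_abs_gt_le_second_moment[OF _ int le K(1)]) simp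
    also have "\<dots> = (B / (B + 1)) * e"
      using e B by (simp add: K)
    also have "\<dots> < 1 * e"
      using e B by (intro mult_strict_right_mono) auto
    finally show ?thesis by simp
  qed
  then show "\<exists>K. \<forall>\<^sub>F n in sequentially. prob {\<omega> \<in> space M. \<bar>X n \<omega>\<bar> > K} < e"
    by (intro exI[of _ K] always_eventually allI)
qed

end

section \<open>Slutsky's theorem through characteristic functions\<close>

lemma cmod_iexp_diff_le: "cmod (iexp a - iexp b) \<le> \<bar>a - b\<bar>"
proof -
  have "iexp a - iexp b = iexp b * (iexp (a - b) - 1)"
    by (simp add: algebra_simps exp_add[symmetric])
  also have "cmod \<dots> = cmod (iexp (a - b) - 1)"
    by (simp add: norm_mult)
  also have "\<dots> \<le> \<bar>a - b\<bar>"
    using iexp_approx1[of "a - b" 0] by simp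
  finally show ?thesis .
qed

lemma cmod_iexp_diff_le_2: "cmod (iexp a - iexp b) \<le> 2"
  using norm_triangle_ineq4[of "iexp a" "iexp b"] by simp

context prob_space
begin

lemma char_distr_eq:
  "X \<in> borel_measurable M \<Longrightarrow> char (distr M borel X) t = expectation (\<lambda>\<omega>. iexp (t * X \<omega>))"
  by (simp add: char_def integral_distr)

lemma integrable_iexp_rv:
  "X \<in> borel_measurable M \<Longrightarrow> integrable M (\<lambda>\<omega>. iexp (X \<omega>))"
  by (rule integrable_iexp) auto

text \<open>Split the expectation at the event |X - Y| > d: off it \<open>iexp\<close> is
  1-Lipschitz, on it the integrand is at most 2.\<close>

lemma char_diff_le:
  assumes [measurable]: "X \<in> borel_measurable M" "Y \<in> borel_measurable M" and d: "d \<ge> 0"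
  shows "cmod (char (distr M borel X) t - char (distr M borel Y) t) \<le>
    \<bar>t\<bar> * d + 2 * prob {\<omega> \<in> space M. \<bar>X \<omega> - Y \<omega>\<bar> > d}"
proof -
  let ?A = "{\<omega> \<in> space M. \<bar>X \<omega> - Y \<omega>\<bar> > d}"
  have "char (distr M borel X) t - char (distr M borel Y) t =
      expectation (\<lambda>\<omega>. iexp (t * X \<omega>) - iexp (t * Y \<omega>))"
    unfolding char_distr_eq[OF assms(1)] char_distr_eq[OF assms(2)]
    by (intro Bochner_Integration.integral_diff[symmetric] integrable_iexp_rv) measurable
  also have "cmod \<dots> \<le> expectation (\<lambda>\<omega>. cmod (iexp (t * X \<omega>) - iexp (t * Y \<omega>)))"
    by (rule integral_norm_bound)
  also have "\<dots> \<le> expectation (\<lambda>\<omega>. \<bar>t\<bar> * d + 2 * indicator ?A \<omega>)"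
  proof (rule integral_mono)
    show "integrable M (\<lambda>\<omega>. cmod (iexp (t * X \<omega>) - iexp (t * Y \<omega>)))"
      by (intro integrable_norm Bochner_Integration.integrable_diff integrable_iexp_rv) auto
    show "integrable M (\<lambda>\<omega>. \<bar>t\<bar> * d + 2 * indicator ?A \<omega>)"
      by (intro Bochner_Integration.integrable_add integrable_const integrable_mult_right
          integrable_real_indicator) (auto simp: emeasure_eq_measure)
    fix \<omega> assume "\<omega> \<in> space M"
    show "cmod (iexp (t * X \<omega>) - iexp (t * Y \<omega>)) \<le> \<bar>t\<bar> * d + 2 * indicator ?A \<omega>"
    proof (cases "\<omega> \<in> ?A")
      case True
      then show ?thesis
        using cmod_iexp_diff_le_2[of "t * X \<omega>" "t * Y \<omega>"] d
        by (simp add: add_increasing)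
    next
      case False
      have "cmod (iexp (t * X \<omega>) - iexp (t * Y \<omega>)) \<le> \<bar>t * X \<omega> - t * Y \<omega>\<bar>"
        by (rule cmod_iexp_diff_le)
      also have "\<dots> = \<bar>t\<bar> * \<bar>X \<omega> - Y \<omega>\<bar>"
        by (simp add: abs_mult[symmetric] algebra_simps)
      also have "\<dots> \<le> \<bar>t\<bar> * d"
        using False \<open>\<omega> \<in> space M\<close> by (intro mult_left_mono) auto
      finally show ?thesis using False by simp
    qed
  qed
  also have "\<dots> = \<bar>t\<bar> * d + 2 * prob ?A"
    by (subst Bochner_Integration.integral_add)
       (auto simp: prob_space emeasure_eq_measure intro!: integrable_real_indicator)
  finally show ?thesis .
qed

text \<open>Slutsky's theorem for a single frequency t: an error tending to 0 in probability does
  not change the limit of the characteristic functions.\<close>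

lemma char_tendsto_conv_prob_diff:
  assumes [measurable]: "\<And>n. X n \<in> borel_measurable M" "\<And>n. Y n \<in> borel_measurable M"
    and Y: "(\<lambda>n. char (distr M borel (Y n)) t) \<longlonglongrightarrow> c"
    and diff: "conv_prob M (\<lambda>n \<omega>. X n \<omega> - Y n \<omega>) 0"
  shows "(\<lambda>n. char (distr M borel (X n)) t) \<longlonglongrightarrow> c"
proof (rule Lim_transform[OF Y], rule tendstoI)
  fix e :: real assume e: "e > 0"
  \<comment> \<open>Half of e goes to the Lipschitz part and half to twice the tail probability,
    hence e/4 below; the added 1 covers t = 0.\<close>
  define d where "d = e / (2 * (\<bar>t\<bar> + 1))"
  have d: "d > 0" "\<bar>t\<bar> * d < e / 2"
    using e by (auto simp: d_def field_simps add_pos_nonneg intro!: add_nonneg_pos)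
  have "\<forall>\<^sub>F n in sequentially. prob {\<omega> \<in> space M. \<bar>X n \<omega> - Y n \<omega> - 0\<bar> > d} < e / 4"
    using conv_probD[OF diff d(1)] e by (intro order_tendstoD(2)) auto
  then show "\<forall>\<^sub>F n in sequentially.
      dist (char (distr M borel (X n)) t - char (distr M borel (Y n)) t) 0 < e"
  proof eventually_elim
    case (elim n)
    have "cmod (char (distr M borel (X n)) t - char (distr M borel (Y n)) t) \<le>
        \<bar>t\<bar> * d + 2 * prob {\<omega> \<in> space M. \<bar>X n \<omega> - Y n \<omega>\<bar> > d}"
      using d by (intro char_diff_le) auto
    then show ?case using elim d(2) by simp
  qed
qed

end

text \<open>The law is the image of the standard normal law under the map x to m + sqrt v * x, so
  both facts are inherited from the standard normal.\<close>

lemma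
  assumes v: "v > 0"
  shows real_distribution_normal_law: "real_distribution (normal_law m v)"
    and char_normal_law: "char (normal_law m v) t = iexp (t * m) * exp (- (t\<^sup>2 * v) / 2)"
proof -
  interpret N: real_distribution std_normal_distribution
    by (rule real_dist_normal_dist)
  have "distributed std_normal_distribution lborel (\<lambda>x. x) (normal_density 0 1)"
    by (auto simp: distributed_def distr_id2)
  then have "distributed std_normal_distribution lborel (\<lambda>x. m + sqrt v * x)
      (normal_density (m + sqrt v * 0) (\<bar>sqrt v\<bar> * 1))"
    using v by (intro N.normal_density_affine) auto
  then have eq: "normal_law m v = distr std_normal_distribution lborel (\<lambda>x. m + sqrt v * x)"
    using v by (simp add: distributed_def normal_law_def)
  then have eq: "normal_law m v = distr std_normal_distribution borel (\<lambda>x. m + sqrt v * x)"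
    by (simp cong: distr_cong)
  show "real_distribution (normal_law m v)"
    unfolding eq by (rule N.real_distribution_distr) simp
  have "char (normal_law m v) t =
      (CLINT x|std_normal_distribution. iexp (t * (m + sqrt v * x)))"
    unfolding eq by (rule N.char_distr_eq) simp
  also have "\<dots> = (CLINT x|std_normal_distribution. iexp (t * m) * iexp ((t * sqrt v) * x))"
    by (simp add: exp_add[symmetric] algebra_simps)
  also have "\<dots> = iexp (t * m) * char std_normal_distribution (t * sqrt v)"
    unfolding char_def by simp
  also have "\<dots> = iexp (t * m) * exp (- (t\<^sup>2 * v) / 2)"
    using v unfolding char_std_normal_distribution
    by (simp add: power_mult_distrib exp_of_real[symmetric])
  finally show "char (normal_law m v) t = iexp (t * m) * exp (- (t\<^sup>2 * v) / 2)" .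
qed

text \<open>Levy's continuity theorem combined with Slutsky. The limit law of \<open>W\<close> is
  given through characteristic functions only, the form in which the central limit theorem below
  delivers it.\<close>

lemma (in prob_space) weak_conv_affine_normal:
  assumes [measurable]: "\<And>n. X n \<in> borel_measurable M" "\<And>n. W n \<in> borel_measurable M"
    and W: "\<And>t. (\<lambda>n. char (distr M borel (W n)) t) \<longlonglongrightarrow> exp (- (t\<^sup>2 * v) / 2)"
    and diff: "conv_prob M (\<lambda>n \<omega>. X n \<omega> - (a + b * W n \<omega>)) 0"
    and v: "v > 0" and b: "b \<noteq> 0"
  shows "weak_conv_m (\<lambda>n. distr M borel (X n)) (normal_law a (b\<^sup>2 * v))"
proof (rule levy_continuity)
  have v': "b\<^sup>2 * v > 0" using v b by simp
  show "real_distribution (distr M borel (X n))" for n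
    by (rule real_distribution_distr) simp
  show "real_distribution (normal_law a (b\<^sup>2 * v))"
    by (rule real_distribution_normal_law[OF v'])
  fix t
  have "char (distr M borel (\<lambda>\<omega>. a + b * W n \<omega>)) t =
      iexp (t * a) * char (distr M borel (W n)) (t * b)" for n
  proof -
    have "char (distr M borel (\<lambda>\<omega>. a + b * W n \<omega>)) t =
        expectation (\<lambda>\<omega>. iexp (t * a) * iexp ((t * b) * W n \<omega>))"
      by (subst char_distr_eq) (auto simp: exp_add[symmetric] algebra_simps)
    then show ?thesis by (simp add: char_distr_eq)
  qed
  moreover have "(\<lambda>n. iexp (t * a) * char (distr M borel (W n)) (t * b)) \<longlonglongrightarrow>
      iexp (t * a) * exp (- ((t * b)\<^sup>2 * v) / 2)"
    by (intro tendsto_mult tendsto_const W)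
  ultimately have "(\<lambda>n. char (distr M borel (\<lambda>\<omega>. a + b * W n \<omega>)) t) \<longlonglongrightarrow>
      char (normal_law a (b\<^sup>2 * v)) t"
    unfolding char_normal_law[OF v'] by (simp add: power_mult_distrib mult_ac)
  then show "(\<lambda>n. char (distr M borel (X n)) t) \<longlonglongrightarrow> char (normal_law a (b\<^sup>2 * v)) t"
    by (rule char_tendsto_conv_prob_diff[OF _ _ _ diff, rotated 2]) auto
qed

section \<open>The weak law of large numbers\<close>

context prob_space
begin

lemma
  assumes "X \<in> borel_measurable M" "Y \<in> borel_measurable M"
    and eq: "distr M borel X = distr M borel Y"
    and [measurable]: "g \<in> borel_measurable borel"
  shows expectation_eq_distr: "expectation (\<lambda>\<omega>. g (X \<omega>)) = (expectation (\<lambda>\<omega>. g (Y \<omega>)) :: real)"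
    and integrable_eq_distr: "integrable M (\<lambda>\<omega>. g (X \<omega>)) \<longleftrightarrow> integrable M (\<lambda>\<omega>. g (Y \<omega>) :: real)"
proof -
  have "expectation (\<lambda>\<omega>. g (X \<omega>)) = integral\<^sup>L (distr M borel X) g"
    by (rule integral_distr[symmetric]) (use assms in auto)
  also have "\<dots> = expectation (\<lambda>\<omega>. g (Y \<omega>))"
    unfolding eq by (rule integral_distr) (use assms in auto)
  finally show "expectation (\<lambda>\<omega>. g (X \<omega>)) = expectation (\<lambda>\<omega>. g (Y \<omega>))" .
  have "integrable M (\<lambda>\<omega>. g (X \<omega>)) \<longleftrightarrow> integrable (distr M borel X) g"
    by (rule integrable_distr_eq[symmetric]) (use assms in auto)
  also have "\<dots> \<longleftrightarrow> integrable M (\<lambda>\<omega>. g (Y \<omega>))"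
    unfolding eq by (rule integrable_distr_eq) (use assms in auto)
  finally show "integrable M (\<lambda>\<omega>. g (X \<omega>)) \<longleftrightarrow> integrable M (\<lambda>\<omega>. g (Y \<omega>))" .
qed

text \<open>Expanding the square leaves the diagonal. Pairwise orthogonality is the right
  hypothesis: the later summands are errors weighted by functions of the covariates and assignments,
  which are orthogonal but in general dependent.\<close>

lemma
  fixes g :: "nat \<Rightarrow> 'a \<Rightarrow> real"
  assumes int: "\<And>i k. i < n \<Longrightarrow> k < n \<Longrightarrow> integrable M (\<lambda>\<omega>. g i \<omega> * g k \<omega>)"
    and orth: "\<And>i k. i < n \<Longrightarrow> k < n \<Longrightarrow> i \<noteq> k \<Longrightarrow> expectation (\<lambda>\<omega>. g i \<omega> * g k \<omega>) = 0"
  shows integrable_sum_orthogonal: "integrable M (\<lambda>\<omega>. (\<Sum>i<n. g i \<omega>)\<^sup>2)"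
    and expectation_sum_orthogonal:
      "expectation (\<lambda>\<omega>. (\<Sum>i<n. g i \<omega>)\<^sup>2) = (\<Sum>i<n. expectation (\<lambda>\<omega>. (g i \<omega>)\<^sup>2))"
proof -
  have eq: "(\<Sum>i<n. g i \<omega>)\<^sup>2 = (\<Sum>i<n. \<Sum>k<n. g i \<omega> * g k \<omega>)" for \<omega>
    by (simp add: power2_eq_square sum_product)
  show "integrable M (\<lambda>\<omega>. (\<Sum>i<n. g i \<omega>)\<^sup>2)"
    unfolding eq by (intro Bochner_Integration.integrable_sum int) auto
  have "expectation (\<lambda>\<omega>. (\<Sum>i<n. g i \<omega>)\<^sup>2) =
      (\<Sum>i<n. expectation (\<lambda>\<omega>. \<Sum>k<n. g i \<omega> * g k \<omega>))"
    unfolding eq using int by (intro Bochner_Integration.integral_sum) auto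
  also have "\<dots> = (\<Sum>i<n. \<Sum>k<n. expectation (\<lambda>\<omega>. g i \<omega> * g k \<omega>))"
    using int by (intro sum.cong refl Bochner_Integration.integral_sum) auto
  also have "\<dots> = (\<Sum>i<n. \<Sum>k<n. if k = i then expectation (\<lambda>\<omega>. (g i \<omega>)\<^sup>2) else 0)"
    using orth by (intro sum.cong refl) (auto simp: power2_eq_square)
  also have "\<dots> = (\<Sum>i<n. expectation (\<lambda>\<omega>. (g i \<omega>)\<^sup>2))"
    by simp
  finally show "expectation (\<lambda>\<omega>. (\<Sum>i<n. g i \<omega>)\<^sup>2) = (\<Sum>i<n. expectation (\<lambda>\<omega>. (g i \<omega>)\<^sup>2))" .
qed

lemma
  assumes "indep_vars (\<lambda>_. borel) Y UNIV" and int: "\<And>i. integrable M (Y i :: 'a \<Rightarrow> real)"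
    and ik: "i \<noteq> k"
  shows integrable_mult_indep_vars: "integrable M (\<lambda>\<omega>. Y i \<omega> * Y k \<omega>)"
    and expectation_mult_indep_vars:
      "expectation (\<lambda>\<omega>. Y i \<omega> * Y k \<omega>) = expectation (Y i) * expectation (Y k)"
proof -
  have "indep_vars (\<lambda>_. borel) Y {i, k}"
    using assms(1) by (rule indep_vars_subset) simp
  then show "integrable M (\<lambda>\<omega>. Y i \<omega> * Y k \<omega>)"
    "expectation (\<lambda>\<omega>. Y i \<omega> * Y k \<omega>) = expectation (Y i) * expectation (Y k)"
    using indep_vars_integrable[of "{i, k}" Y] indep_vars_lebesgue_integral[of "{i, k}" Y] int ik
    by auto
qed

lemma
  assumes ind: "indep_vars (\<lambda>_. borel) Y UNIV"
    and law: "\<And>i. distr M borel (Y i) = distr M borel (Y 0)"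
    and sq: "integrable M (\<lambda>\<omega>. (Y 0 \<omega>)\<^sup>2)"
    and mean: "expectation (Y 0) = (0::real)"
  shows integrable_sum_iid_sq: "integrable M (\<lambda>\<omega>. (\<Sum>i<n. Y i \<omega>)\<^sup>2)"
    and expectation_sum_iid_sq:
      "expectation (\<lambda>\<omega>. (\<Sum>i<n. Y i \<omega>)\<^sup>2) = real n * expectation (\<lambda>\<omega>. (Y 0 \<omega>)\<^sup>2)"
proof -
  have rv [measurable]: "Y i \<in> borel_measurable M" for i
    using ind by (simp add: indep_vars_def)
  have sq': "integrable M (\<lambda>\<omega>. (Y i \<omega>)\<^sup>2)"
      "expectation (\<lambda>\<omega>. (Y i \<omega>)\<^sup>2) = expectation (\<lambda>\<omega>. (Y 0 \<omega>)\<^sup>2)" for i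
    using integrable_eq_distr[OF rv rv law[of i], of "\<lambda>x. x\<^sup>2"] sq
      expectation_eq_distr[OF rv rv law[of i], of "\<lambda>x. x\<^sup>2"] by auto
  have int: "integrable M (Y i)" for i
    by (rule square_integrable_imp_integrable[OF rv sq'(1)])
  have mean': "expectation (Y i) = 0" for i
    using expectation_eq_distr[OF rv rv law[of i], of "\<lambda>x. x"] mean by auto
  have 1: "integrable M (\<lambda>\<omega>. Y i \<omega> * Y k \<omega>)" for i k
    using integrable_mult_indep_vars[OF ind int, of i k] sq'(1)[of i]
    by (cases "i = k") (auto simp: power2_eq_square)
  have 2: "expectation (\<lambda>\<omega>. Y i \<omega> * Y k \<omega>) = 0" if "i \<noteq> k" for i k
    using expectation_mult_indep_vars[OF ind int that] mean' by simp
  show "integrable M (\<lambda>\<omega>. (\<Sum>i<n. Y i \<omega>)\<^sup>2)"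
    by (rule integrable_sum_orthogonal[OF 1 2])
  show "expectation (\<lambda>\<omega>. (\<Sum>i<n. Y i \<omega>)\<^sup>2) = real n * expectation (\<lambda>\<omega>. (Y 0 \<omega>)\<^sup>2)"
  proof -
    have "expectation (\<lambda>\<omega>. (\<Sum>i<n. Y i \<omega>)\<^sup>2) = (\<Sum>i<n. expectation (\<lambda>\<omega>. (Y i \<omega>)\<^sup>2))"
      by (rule expectation_sum_orthogonal[OF 1 2])
    also have "\<dots> = (\<Sum>i<n. expectation (\<lambda>\<omega>. (Y 0 \<omega>)\<^sup>2))"
      by (intro sum.cong refl sq'(2))
    finally show ?thesis by simp
  qed
qed

text \<open>Only a first moment is available for the squares and products of the covariates, so the
  summands are truncated at a level chosen before the sample size.\<close>

theorem weak_law_of_large_numbers: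
  fixes Y :: "nat \<Rightarrow> 'a \<Rightarrow> real"
  assumes ind: "indep_vars (\<lambda>_. borel) Y UNIV"
    and law: "\<And>i. distr M borel (Y i) = distr M borel (Y 0)"
    and int: "integrable M (Y 0)"
  shows "conv_prob M (\<lambda>n \<omega>. (\<Sum>i<n. Y i \<omega>) / real n) (expectation (Y 0))"
  unfolding conv_prob_def
proof (intro conjI allI impI)
  have rv [measurable]: "Y i \<in> borel_measurable M" for i
    using ind by (simp add: indep_vars_def)
  show "(\<lambda>\<omega>. (\<Sum>i<n. Y i \<omega>) / real n) \<in> borel_measurable M" for n
    by measurable
  let ?m = "expectation (Y 0)"
  define tr where "tr K y = (if \<bar>y\<bar> \<le> K then y else 0)" for K y :: real
  have tr_rv [measurable]: "tr K \<in> borel_measurable borel" for K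
    unfolding tr_def by measurable
  have tr_le: "\<bar>tr K y\<bar> \<le> K" if "K \<ge> 0" for K y
    using that by (auto simp: tr_def)
  \<comment> \<open>Dominated convergence with majorant |Y 0|: for each outcome the truncation is
    eventually inactive.\<close>
  have tail: "(\<lambda>k. expectation (\<lambda>\<omega>. \<bar>Y 0 \<omega> - tr (real k) (Y 0 \<omega>)\<bar>)) \<longlonglongrightarrow> expectation (\<lambda>\<omega>. 0)"
  proof (rule integral_dominated_convergence[where w = "\<lambda>\<omega>. \<bar>Y 0 \<omega>\<bar>"])
    show "AE \<omega> in M. (\<lambda>k. \<bar>Y 0 \<omega> - tr (real k) (Y 0 \<omega>)\<bar>) \<longlonglongrightarrow> 0"
    proof (rule AE_I2, rule tendsto_eventually)
      fix \<omega>
      obtain k0 where "\<bar>Y 0 \<omega>\<bar> \<le> real k0" using real_arch_simple by blast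
      then show "\<forall>\<^sub>F k in sequentially. \<bar>Y 0 \<omega> - tr (real k) (Y 0 \<omega>)\<bar> = 0"
        by (intro eventually_sequentiallyI[of k0]) (auto simp: tr_def)
    qed
  qed (use int in \<open>auto simp: tr_def\<close>)
  fix e :: real assume e: "e > 0"
  show "(\<lambda>n. prob {\<omega> \<in> space M. \<bar>(\<Sum>i<n. Y i \<omega>) / real n - ?m\<bar> > e}) \<longlonglongrightarrow> 0"
  proof (rule order_tendstoI)
    fix a :: real assume "a < 0"
    then show "\<forall>\<^sub>F n in sequentially. a < prob {\<omega> \<in> space M. \<bar>(\<Sum>i<n. Y i \<omega>) / real n - ?m\<bar> > e}"
      by (auto intro!: always_eventually simp: less_le_trans)
  next
    fix a :: real assume a: "0 < a"
    \<comment> \<open>The bound e/3 controls the shift of the mean caused by truncation; a e / 6 is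
      what Markov's inequality at level e/3 turns into probability a/2.\<close>
    have "\<forall>\<^sub>F k in sequentially. expectation (\<lambda>\<omega>. \<bar>Y 0 \<omega> - tr (real k) (Y 0 \<omega>)\<bar>) < min (e / 3) (a * e / 6)"
      using tail a e by (intro order_tendstoD(2)) auto
    then obtain k where k: "expectation (\<lambda>\<omega>. \<bar>Y 0 \<omega> - tr (real k) (Y 0 \<omega>)\<bar>) < min (e / 3) (a * e / 6)"
      by (auto simp: eventually_sequentially)
    define K where "K = real k"
    define A where "A i \<omega> = tr K (Y i \<omega>)" for i \<omega>
    define B where "B i \<omega> = Y i \<omega> - A i \<omega>" for i \<omega>
    define \<alpha> where "\<alpha> = expectation (A 0)"
    define b where "b = expectation (\<lambda>\<omega>. \<bar>B 0 \<omega>\<bar>)"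
    have K: "K \<ge> 0" by (simp add: K_def)
    have [measurable]: "A i \<in> borel_measurable M" "B i \<in> borel_measurable M" for i
      unfolding A_def B_def by measurable
    have b: "b \<le> e / 3" "b < a * e / 6"
      using k by (auto simp: b_def B_def A_def K_def)
    have intY: "integrable M (Y i)" for i
      using integrable_eq_distr[OF rv rv law[of i], of "\<lambda>x. x"] int by simp
    have Ab: "\<bar>A i \<omega>\<bar> \<le> K" for i \<omega>
      by (simp add: A_def tr_le K)
    have intA: "integrable M (A i)" for i
      by (rule integrable_const_bound[of _ K]) (auto simp: Ab)
    have intB: "integrable M (B i)" for i
      unfolding B_def by (intro Bochner_Integration.integrable_diff intY intA)
    have EB: "expectation (\<lambda>\<omega>. \<bar>B i \<omega>\<bar>) = b" for i
      using expectation_eq_distr[OF rv rv law[of i], of "\<lambda>x. \<bar>x - tr K x\<bar>"]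
      by (simp add: b_def B_def A_def)
    have shift: "\<bar>\<alpha> - ?m\<bar> \<le> e / 3"
    proof -
      have "?m - \<alpha> = expectation (B 0)"
        unfolding \<alpha>_def B_def by (rule Bochner_Integration.integral_diff[symmetric, OF intY intA])
      moreover have "\<bar>expectation (B 0)\<bar> \<le> b"
        unfolding b_def by (rule integral_abs_bound)
      ultimately show ?thesis using b by linarith
    qed
    define C where "C i \<omega> = A i \<omega> - \<alpha>" for i \<omega>
    have [measurable]: "C i \<in> borel_measurable M" for i
      unfolding C_def by measurable
    have \<alpha>: "\<bar>\<alpha>\<bar> \<le> K"
    proof -
      have "\<bar>\<alpha>\<bar> \<le> expectation (\<lambda>\<omega>. \<bar>A 0 \<omega>\<bar>)"
        unfolding \<alpha>_def by (rule integral_abs_bound)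
      also have "\<dots> \<le> expectation (\<lambda>\<omega>. K)"
        by (rule integral_mono) (auto simp: Ab intA)
      finally show ?thesis by (simp add: prob_space)
    qed
    have Cb: "\<bar>C i \<omega>\<bar> \<le> 2 * K" for i \<omega>
      using Ab[of i \<omega>] \<alpha> by (simp add: C_def)
    have C2: "(C i \<omega>)\<^sup>2 \<le> (2 * K)\<^sup>2" for i \<omega>
      using power_mono[OF Cb[of i \<omega>], of 2] by simp
    have C_sq: "integrable M (\<lambda>\<omega>. (C 0 \<omega>)\<^sup>2)"
      by (rule integrable_const_bound[of _ "(2 * K)\<^sup>2"]) (use C2 in auto)
    have EC2: "expectation (\<lambda>\<omega>. (C 0 \<omega>)\<^sup>2) \<le> (2 * K)\<^sup>2"
    proof -
      have "expectation (\<lambda>\<omega>. (C 0 \<omega>)\<^sup>2) \<le> expectation (\<lambda>\<omega>. (2 * K)\<^sup>2)"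
        by (rule integral_mono) (use C_sq C2 in auto)
      then show ?thesis by (simp add: prob_space)
    qed
    have EC: "expectation (C 0) = 0"
      unfolding C_def \<alpha>_def using intA by (simp add: prob_space)
    have C_ind: "indep_vars (\<lambda>_. borel) C UNIV"
      unfolding C_def[abs_def] A_def by (rule indep_vars_compose2[OF ind]) simp
    have C_law: "distr M borel (C i) = distr M borel (C 0)" for i
    proof -
      have *: "distr M borel (C j) = distr (distr M borel (Y j)) borel (\<lambda>y. tr K y - \<alpha>)" for j
        by (subst distr_distr) (auto simp: C_def[abs_def] A_def comp_def)
      show ?thesis unfolding * law[of i] ..
    qed
    note C_sum = integrable_sum_iid_sq[OF C_ind C_law C_sq EC]
      expectation_sum_iid_sq[OF C_ind C_law C_sq EC]
    \<comment> \<open>Chebyshev bound for the average of the centred truncations, which are bounded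
      by 2K; it vanishes because K was fixed before n.\<close>
    define u where "u n = (2 * K)\<^sup>2 / real n / (e / 3)\<^sup>2" for n
    have "u \<longlonglongrightarrow> 0" unfolding u_def by (intro tendsto_divide_zero lim_const_over_n)
    then have "\<forall>\<^sub>F n in sequentially. u n < a / 2"
      using a by (intro order_tendstoD(2)) auto
    moreover have "\<forall>\<^sub>F n in sequentially. n > 0"
      by (rule eventually_gt_at_top)
    ultimately show "\<forall>\<^sub>F n in sequentially.
        prob {\<omega> \<in> space M. \<bar>(\<Sum>i<n. Y i \<omega>) / real n - ?m\<bar> > e} < a"
    proof eventually_elim
      case (elim n)
      let ?P = "{\<omega> \<in> space M. \<bar>(\<Sum>i<n. C i \<omega>) / real n\<bar> > e / 3}"
      let ?Q = "{\<omega> \<in> space M. (\<Sum>i<n. \<bar>B i \<omega>\<bar>) / real n \<ge> e / 3}"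
      \<comment> \<open>A deviation beyond e needs more than e/3 from the centred truncations, the
        remainders or the shift of the mean, and the shift never exceeds e/3. \<open>?Q\<close> has
        a weak inequality to fit Markov's inequality.\<close>
      have "{\<omega> \<in> space M. \<bar>(\<Sum>i<n. Y i \<omega>) / real n - ?m\<bar> > e} \<subseteq> ?P \<union> ?Q"
      proof (rule ccontr)
        assume "\<not> ?thesis"
        then obtain \<omega> where w: "\<bar>(\<Sum>i<n. Y i \<omega>) / real n - ?m\<bar> > e"
            "\<bar>(\<Sum>i<n. C i \<omega>) / real n\<bar> \<le> e / 3" "(\<Sum>i<n. \<bar>B i \<omega>\<bar>) / real n < e / 3"
          by (auto simp: subset_iff not_less not_le)
        have "(\<Sum>i<n. Y i \<omega>) = (\<Sum>i<n. C i \<omega>) + (\<Sum>i<n. B i \<omega>) + real n * \<alpha>"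
          by (simp add: C_def B_def sum_subtractf)
        then have "(\<Sum>i<n. Y i \<omega>) / real n - ?m =
            (\<Sum>i<n. C i \<omega>) / real n + (\<Sum>i<n. B i \<omega>) / real n + (\<alpha> - ?m)"
          using elim by (simp add: add_divide_distrib)
        moreover have "\<bar>(\<Sum>i<n. B i \<omega>) / real n\<bar> \<le> (\<Sum>i<n. \<bar>B i \<omega>\<bar>) / real n"
          by (simp add: divide_right_mono)
        ultimately show False using w shift by linarith
      qed
      then have "prob {\<omega> \<in> space M. \<bar>(\<Sum>i<n. Y i \<omega>) / real n - ?m\<bar> > e} \<le> prob ?P + prob ?Q"
        by (intro order_trans[OF finite_measure_mono measure_Un_le]) auto
      moreover have "prob ?P \<le> u n"
        unfolding u_def
      proof (rule prob_abs_gt_le_second_moment)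
        show "integrable M (\<lambda>\<omega>. ((\<Sum>i<n. C i \<omega>) / real n)\<^sup>2)"
          using C_sum(1) by (simp add: power_divide)
        have "expectation (\<lambda>\<omega>. ((\<Sum>i<n. C i \<omega>) / real n)\<^sup>2) =
            expectation (\<lambda>\<omega>. (C 0 \<omega>)\<^sup>2) / real n"
          using C_sum(2) elim by (simp add: power_divide power2_eq_square)
        also have "\<dots> \<le> (2 * K)\<^sup>2 / real n"
          using EC2 by (rule divide_right_mono) simp
        finally show "expectation (\<lambda>\<omega>. ((\<Sum>i<n. C i \<omega>) / real n)\<^sup>2) \<le> (2 * K)\<^sup>2 / real n" .
      qed (use e in auto)
      moreover have "prob ?Q \<le> a / 2"
      proof -
        have "prob ?Q \<le> expectation (\<lambda>\<omega>. (\<Sum>i<n. \<bar>B i \<omega>\<bar>) / real n) / (e / 3)"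
          using e intB by (intro integral_Markov_inequality_measure[where A = "{}"])
            (auto intro!: divide_nonneg_nonneg sum_nonneg)
        also have "expectation (\<lambda>\<omega>. (\<Sum>i<n. \<bar>B i \<omega>\<bar>) / real n) = b"
          using intB EB elim by simp
        also have "b / (e / 3) \<le> a / 2"
          using b e by (simp add: field_simps)
        finally show ?thesis .
      qed
      ultimately show ?case using elim by linarith
    qed
  qed
qed

end

section \<open>The central limit theorem with random signs\<close>

context prob_space
begin

text \<open>Measurable images generate smaller sigma-algebras, so independence is inherited. Once
  both images lie in one type, \<open>indep_var\<close> and its product rule for expectations
  apply.\<close>

lemma indep_elements_indep_var:
  assumes ie: "indep_elements M A f B g"
    and F [measurable]: "F \<in> measurable A N" and G [measurable]: "G \<in> measurable B L"
  shows "indep_var N (\<lambda>\<omega>. F (f \<omega>)) L (\<lambda>\<omega>. G (g \<omega>))"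
proof -
  have [measurable]: "f \<in> measurable M A" "g \<in> measurable M B"
    and ind: "indep_set (sets (vimage_algebra (space M) f A)) (sets (vimage_algebra (space M) g B))"
    using ie by (auto simp: indep_elements_def)
  have "sets (vimage_algebra (space M) (\<lambda>\<omega>. F (f \<omega>)) N) \<subseteq> sets (vimage_algebra (space M) f A)"
    using measurable_space[OF \<open>f \<in> measurable M A\<close>]
    by (intro sets_image_in_sets measurable_compose[OF measurable_vimage_algebra1 F]) auto
  moreover have "sets (vimage_algebra (space M) (\<lambda>\<omega>. G (g \<omega>)) L) \<subseteq> sets (vimage_algebra (space M) g B)"
    using measurable_space[OF \<open>g \<in> measurable M B\<close>]
    by (intro sets_image_in_sets measurable_compose[OF measurable_vimage_algebra1 G]) auto
  ultimately have "indep_set (sets (vimage_algebra (space M) (\<lambda>\<omega>. F (f \<omega>)) N))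
      (sets (vimage_algebra (space M) (\<lambda>\<omega>. G (g \<omega>)) L))"
    using ind unfolding indep_set_def
    by (elim indep_sets_mono_sets) (auto split: bool.split)
  then show ?thesis
    unfolding indep_var_eq by (simp add: sets_vimage_algebra)
qed

text \<open>Kept generic in the value field: complex values serve the characteristic functions, real
  values the second moments.\<close>

lemma
  assumes ie: "indep_elements M A f B g"
    and F: "F \<in> borel_measurable A" "integrable M (\<lambda>\<omega>. F (f \<omega>))"
    and G: "G \<in> borel_measurable B" "integrable M (\<lambda>\<omega>. G (g \<omega>))"
  shows indep_elements_integrable: "integrable M (\<lambda>\<omega>. F (f \<omega>) * G (g \<omega>) ::
      _ :: {real_normed_field, banach, second_countable_topology})"
    and indep_elements_expectation: "expectation (\<lambda>\<omega>. F (f \<omega>) * G (g \<omega>)) =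
      (expectation (\<lambda>\<omega>. F (f \<omega>)) * expectation (\<lambda>\<omega>. G (g \<omega>)))"
  using indep_var_integrable indep_var_lebesgue_integral indep_elements_indep_var[OF ie F(1) G(1)] F(2) G(2)
  by blast+

lemma
  assumes [measurable]: "A \<in> events"
  shows integrable_indicator_complex: "integrable M (indicator A :: 'a \<Rightarrow> complex)"
    and expectation_indicator_complex: "expectation (indicator A) = complex_of_real (prob A)"
proof -
  show "integrable M (indicator A :: 'a \<Rightarrow> complex)"
  proof (rule integrable_const_bound[of _ 1])
    show "AE \<omega> in M. cmod (indicator A \<omega>) \<le> 1"
      by (rule AE_I2) (simp add: indicator_def)
  qed measurable
  have "expectation (indicator A) = expectation (\<lambda>\<omega>. complex_of_real (indicator A \<omega>))"
    by (intro Bochner_Integration.integral_cong) (auto simp: indicator_def)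
  also have "\<dots> = complex_of_real (prob A)"
    unfolding integral_complex_of_real using assms by simp
  finally show "expectation (indicator A) = complex_of_real (prob A)" .
qed

text \<open>The characteristic functions of \<open>eps\<close> and \<open>- eps\<close> have the same quadratic approximation at 0,
  so the one for a fixed vector of signs is close to the Gaussian one, uniformly in the signs.\<close>

lemma char_signed_sum_le:
  fixes eps :: "nat \<Rightarrow> 'a \<Rightarrow> real"
  assumes ind: "indep_vars (\<lambda>_. borel) eps UNIV"
    and law: "\<And>i. distr M borel (eps i) = distr M borel (eps 0)"
    and sq: "integrable M (\<lambda>\<omega>. (eps 0 \<omega>)\<^sup>2)"
    and mean: "expectation (eps 0) = 0"
    and var: "variance (eps 0) = v"
    and v: "v \<ge> 0"
    and n: "n > 0" "t\<^sup>2 * v / 4 \<le> real n"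
    and d: "\<And>i. i < n \<Longrightarrow> d i \<in> {-1, 1}"
  shows "cmod (expectation (\<lambda>\<omega>. iexp (t * ((\<Sum>i<n. d i * eps i \<omega>) / sqrt (real n)))) -
      of_real ((1 + (- (t\<^sup>2 * v) / 2) / real n) ^ n)) \<le>
    t\<^sup>2 / 6 * expectation (\<lambda>\<omega>. min (6 * (eps 0 \<omega>)\<^sup>2) (\<bar>t / sqrt (real n)\<bar> * \<bar>eps 0 \<omega>\<bar> ^ 3))"
proof -
  let ?\<mu> = "distr M borel (eps 0)"
  let ?R = "expectation (\<lambda>\<omega>. min (6 * (eps 0 \<omega>)\<^sup>2) (\<bar>t / sqrt (real n)\<bar> * \<bar>eps 0 \<omega>\<bar> ^ 3))"
  let ?w = "1 + (- (t\<^sup>2 * v) / 2) / real n"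
  let ?s = "\<lambda>i. t * d i / sqrt (real n)"
  have rv [measurable]: "eps i \<in> borel_measurable M" for i
    using ind by (simp add: indep_vars_def)
  have int: "integrable M (eps 0)"
    by (rule square_integrable_imp_integrable[OF rv sq])
  interpret \<mu>: real_distribution ?\<mu>
    by (rule real_distribution_distr) simp
  have "expectation (\<lambda>\<omega>. iexp (t * ((\<Sum>i<n. d i * eps i \<omega>) / sqrt (real n)))) =
      char (distr M borel (\<lambda>\<omega>. \<Sum>i<n. d i / sqrt (real n) * eps i \<omega>)) t"
    by (subst char_distr_eq) (auto simp: sum_divide_distrib)
  also have "\<dots> = (\<Prod>i<n. char (distr M borel (\<lambda>\<omega>. d i / sqrt (real n) * eps i \<omega>)) t)"
    by (intro char_distr_sum indep_vars_compose2[OF indep_vars_subset[OF ind subset_UNIV]]) auto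
  also have "\<dots> = (\<Prod>i<n. char ?\<mu> (?s i))"
  proof (intro prod.cong refl)
    fix i
    have "char (distr M borel (\<lambda>\<omega>. d i / sqrt (real n) * eps i \<omega>)) t =
        expectation (\<lambda>\<omega>. iexp (?s i * eps i \<omega>))"
      by (subst char_distr_eq) (auto simp: mult_ac)
    also have "\<dots> = char (distr M borel (eps i)) (?s i)"
      by (subst char_distr_eq) auto
    finally show "char (distr M borel (\<lambda>\<omega>. d i / sqrt (real n) * eps i \<omega>)) t = char ?\<mu> (?s i)"
      unfolding law[of i] .
  qed
  finally have eq: "expectation (\<lambda>\<omega>. iexp (t * ((\<Sum>i<n. d i * eps i \<omega>) / sqrt (real n)))) =
    (\<Prod>i<n. char ?\<mu> (?s i))" .
  \<comment> \<open>The second-order expansion at \<open>?s i\<close> involves only its square and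
    its absolute value, from which the sign \<open>d i\<close> disappears.\<close>
  have approx: "cmod (char ?\<mu> (?s i) - of_real ?w) \<le> (t\<^sup>2 / real n / 6) * ?R" if "i < n" for i
  proof -
    have s: "(?s i)\<^sup>2 = t\<^sup>2 / real n" "\<bar>?s i\<bar> = \<bar>t / sqrt (real n)\<bar>"
      using d[OF that] n by (auto simp: power_divide power_mult_distrib)
    have "cmod (char ?\<mu> (?s i) - (1 - (?s i)\<^sup>2 * v / 2)) \<le>
        (?s i)\<^sup>2 / 6 * expectation (\<lambda>\<omega>. min (6 * (eps 0 \<omega>)\<^sup>2) (\<bar>?s i\<bar> * \<bar>eps 0 \<omega>\<bar> ^ 3))"
      by (rule char_approx3'[OF rv int sq mean var refl])
    then show ?thesis unfolding s by (simp add: mult_ac)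
  qed
  \<comment> \<open>The comparison of products needs factors in the closed unit disc; the lower
    bound on n keeps t^2 v / (2 n) at most 2, so \<open>?w\<close> lies between -1 and 1.\<close>
  have w: "norm (complex_of_real ?w) \<le> 1"
  proof -
    have "0 \<le> t\<^sup>2 * v / real n" using v by simp
    moreover have "t\<^sup>2 * v / real n \<le> 4" using n by (simp add: field_simps)
    ultimately have "\<bar>?w\<bar> \<le> 1" by (simp add: abs_le_iff)
    then show ?thesis by (simp only: norm_of_real)
  qed
  have "cmod ((\<Prod>i<n. char ?\<mu> (?s i)) - (\<Prod>i<n. of_real ?w)) \<le>
      (\<Sum>i<n. cmod (char ?\<mu> (?s i) - of_real ?w))"
    by (rule norm_prod_diff) (use \<mu>.cmod_char_le_1 w in auto)
  also have "\<dots> \<le> (\<Sum>i<n. (t\<^sup>2 / real n / 6) * ?R)"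
    by (rule sum_mono) (use approx in auto)
  also have "\<dots> = t\<^sup>2 / 6 * ?R"
    using n by simp
  finally show ?thesis unfolding eq by simp
qed

text \<open>The events \<open>E d\<close> of the possible sign vectors form a finite partition,
  determined by \<open>f n\<close> and so independent of the errors. The characteristic function is
  therefore a mixture, with weights \<open>prob (E d)\<close>, of those for fixed signs, and a bound
  common to all signs passes to the mixture.\<close>

theorem char_signed_sum_tendsto:
  fixes eps :: "nat \<Rightarrow> 'a \<Rightarrow> real"
  assumes ind: "indep_vars (\<lambda>_. borel) eps UNIV"
    and law: "\<And>i. distr M borel (eps i) = distr M borel (eps 0)"
    and sq: "integrable M (\<lambda>\<omega>. (eps 0 \<omega>)\<^sup>2)"
    and mean: "expectation (eps 0) = 0"
    and var: "variance (eps 0) = v"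
    and v: "v \<ge> 0"
    and ie: "\<And>n. indep_elements M (A n) (f n) (vec_space n) (cov_vec n eps)"
    and D [measurable]: "\<And>n i. i < n \<Longrightarrow> D n i \<in> borel_measurable (A n)"
    and D_sign: "\<And>n i \<omega>. i < n \<Longrightarrow> \<omega> \<in> space M \<Longrightarrow> D n i (f n \<omega>) \<in> {-1, 1}"
  shows "(\<lambda>n. char (distr M borel (\<lambda>\<omega>. (\<Sum>i<n. D n i (f n \<omega>) * eps i \<omega>) / sqrt (real n))) t)
    \<longlonglongrightarrow> exp (- (t\<^sup>2 * v) / 2)"
proof -
  let ?W = "\<lambda>n \<omega>. (\<Sum>i<n. D n i (f n \<omega>) * eps i \<omega>) / sqrt (real n)"
  let ?c = "\<lambda>n. complex_of_real ((1 + (- (t\<^sup>2 * v) / 2) / real n) ^ n)"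
  let ?R = "\<lambda>n. t\<^sup>2 / 6 * expectation (\<lambda>\<omega>. min (6 * (eps 0 \<omega>)\<^sup>2) (\<bar>t / sqrt (real n)\<bar> * \<bar>eps 0 \<omega>\<bar> ^ 3))"
  have rv [measurable]: "eps i \<in> borel_measurable M" for i
    using ind by (simp add: indep_vars_def)
  have [measurable]: "f n \<in> measurable M (A n)" for n
    using ie by (simp add: indep_elements_def)
  have [measurable]: "?W n \<in> borel_measurable M" for n
    by measurable
  have bound: "cmod (char (distr M borel (?W n)) t - ?c n) \<le> ?R n"
    if n: "n > 0" "t\<^sup>2 * v / 4 \<le> real n" for n
  proof -
    define P where "P = ({..<n} \<rightarrow>\<^sub>E {-1, 1 :: real})"
    define E where "E d = {\<omega> \<in> space M. \<forall>i<n. D n i (f n \<omega>) = d i}" for d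
    define h where "h d \<omega> = iexp (t * ((\<Sum>i<n. d i * eps i \<omega>) / sqrt (real n)))" for d \<omega>
    have finP: "finite P" unfolding P_def by (intro finite_PiE) auto
    have [measurable]: "E d \<in> sets M" for d unfolding E_def by measurable
    \<comment> \<open>Each outcome lies in exactly one \<open>E d\<close>, that of its own sign
      vector; restricting that vector to the first n indices makes it an element of
      \<open>P\<close>.\<close>
    have split: "(\<Sum>d\<in>P. indicator (E d) \<omega> * g d) = g (\<lambda>i\<in>{..<n}. D n i (f n \<omega>))"
      if "\<omega> \<in> space M" for \<omega> and g :: "(nat \<Rightarrow> real) \<Rightarrow> complex"
    proof -
      let ?d = "\<lambda>i\<in>{..<n}. D n i (f n \<omega>)"
      have dP: "?d \<in> P" using D_sign that by (auto simp: P_def)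
      have "(\<Sum>d\<in>P. indicator (E d) \<omega> * g d) = (\<Sum>d\<in>P. if d = ?d then g d else 0)"
      proof (intro sum.cong refl)
        fix d assume "d \<in> P"
        then have "\<omega> \<in> E d \<longleftrightarrow> d = ?d"
          using that by (auto simp: E_def P_def fun_eq_iff PiE_def extensional_def restrict_def)
        then show "indicator (E d) \<omega> * g d = (if d = ?d then g d else 0)"
          by (auto simp: indicator_def)
      qed
      then show ?thesis using finP dP by simp
    qed
    have prod: "integrable M (\<lambda>\<omega>. indicator (E d) \<omega> * h d \<omega>)"
      "expectation (\<lambda>\<omega>. indicator (E d) \<omega> * h d \<omega>) = of_real (prob (E d)) * expectation (h d)" for d
    proof -
      let ?F = "\<lambda>a. indicator {a \<in> space (A n). \<forall>i<n. D n i a = d i} a :: complex"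
      let ?G = "\<lambda>e :: nat \<Rightarrow> real. iexp (t * ((\<Sum>i<n. d i * e i) / sqrt (real n)))"
      have F: "?F \<in> borel_measurable (A n)" by measurable
      have G: "?G \<in> borel_measurable (vec_space n)" by measurable
      have Ff: "?F (f n \<omega>) = indicator (E d) \<omega>" if "\<omega> \<in> space M" for \<omega>
        using that measurable_space[of "f n" M "A n" \<omega>] by (auto simp: E_def indicator_def)
      have Gg: "?G (cov_vec n eps \<omega>) = h d \<omega>" for \<omega>
        by (simp add: h_def)
      have iF: "integrable M (\<lambda>\<omega>. ?F (f n \<omega>))"
        by (rule integrable_const_bound[of _ 1]) (auto simp: indicator_def)
      have iG: "integrable M (\<lambda>\<omega>. ?G (cov_vec n eps \<omega>))"
        unfolding Gg h_def by (rule integrable_iexp_rv) measurable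
      have "integrable M (\<lambda>\<omega>. ?F (f n \<omega>) * ?G (cov_vec n eps \<omega>))"
        by (rule indep_elements_integrable[where F = ?F and G = ?G, OF ie F iF G iG])
      then show "integrable M (\<lambda>\<omega>. indicator (E d) \<omega> * h d \<omega>)"
        unfolding Gg by (rule Bochner_Integration.integrable_cong[THEN iffD1, rotated 2]) (simp_all add: Ff)
      have "expectation (\<lambda>\<omega>. indicator (E d) \<omega> * h d \<omega>) =
          expectation (\<lambda>\<omega>. ?F (f n \<omega>) * ?G (cov_vec n eps \<omega>))"
        unfolding Gg by (rule Bochner_Integration.integral_cong) (simp_all add: Ff)
      also have "\<dots> = expectation (\<lambda>\<omega>. ?F (f n \<omega>)) * expectation (h d)"
        unfolding Gg[symmetric] by (rule indep_elements_expectation[where F = ?F and G = ?G, OF ie F iF G iG])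
      also have "expectation (\<lambda>\<omega>. ?F (f n \<omega>)) = expectation (indicator (E d))"
        by (rule Bochner_Integration.integral_cong) (simp_all add: Ff)
      also have "\<dots> = of_real (prob (E d))"
        by (rule expectation_indicator_complex) measurable
      finally show "expectation (\<lambda>\<omega>. indicator (E d) \<omega> * h d \<omega>) =
          of_real (prob (E d)) * expectation (h d)" .
    qed
    have "char (distr M borel (?W n)) t = expectation (\<lambda>\<omega>. iexp (t * ?W n \<omega>))"
      by (rule char_distr_eq) measurable
    also have "\<dots> = expectation (\<lambda>\<omega>. \<Sum>d\<in>P. indicator (E d) \<omega> * h d \<omega>)"
    proof (rule Bochner_Integration.integral_cong[OF refl])
      fix \<omega> assume w: "\<omega> \<in> space M"
      show "iexp (t * ?W n \<omega>) = (\<Sum>d\<in>P. indicator (E d) \<omega> * h d \<omega>)"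
        unfolding split[OF w, of "\<lambda>d. h d \<omega>"] by (simp add: h_def)
    qed
    also have "\<dots> = (\<Sum>d\<in>P. of_real (prob (E d)) * expectation (h d))"
      using prod by (subst Bochner_Integration.integral_sum) auto
    finally have char: "char (distr M borel (?W n)) t =
      (\<Sum>d\<in>P. of_real (prob (E d)) * expectation (h d))" .
    have "(\<Sum>d\<in>P. of_real (prob (E d))) = (\<Sum>d\<in>P. expectation (indicator (E d)) :: complex)"
      by (intro sum.cong refl expectation_indicator_complex[symmetric]) measurable
    also have "\<dots> = expectation (\<lambda>\<omega>. \<Sum>d\<in>P. indicator (E d) \<omega> * (1 :: complex))"
      unfolding mult_1_right
      by (intro Bochner_Integration.integral_sum[symmetric] integrable_indicator_complex) measurable
    also have "\<dots> = expectation (\<lambda>\<omega>. 1)"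
      by (rule Bochner_Integration.integral_cong[OF refl]) (use split[of _ "\<lambda>_. 1"] in simp)
    finally have one': "(\<Sum>d\<in>P. of_real (prob (E d))) = (1 :: complex)"
      by (simp add: prob_space)
    then have one: "(\<Sum>d\<in>P. prob (E d)) = 1"
      by (simp only: of_real_sum[symmetric] of_real_eq_1_iff)
    have "char (distr M borel (?W n)) t - ?c n =
        (\<Sum>d\<in>P. of_real (prob (E d)) * (expectation (h d) - ?c n))"
    proof -
      have "?c n = (\<Sum>d\<in>P. of_real (prob (E d)) * ?c n)"
        unfolding sum_distrib_right[symmetric] one' by (simp only: mult_1_left)
      then show ?thesis
        unfolding char by (simp only: right_diff_distrib sum_subtractf)
    qed
    also have "cmod \<dots> \<le> (\<Sum>d\<in>P. cmod (of_real (prob (E d)) * (expectation (h d) - ?c n)))"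
      by (rule norm_sum)
    also have "\<dots> \<le> (\<Sum>d\<in>P. prob (E d) * ?R n)"
    proof (rule sum_mono)
      fix d assume "d \<in> P"
      then have d: "d i \<in> {-1, 1}" if "i < n" for i
        using that unfolding P_def by (auto dest: PiE_mem)
      have le: "cmod (expectation (h d) - ?c n) \<le> ?R n"
        unfolding h_def
        by (rule char_signed_sum_le[where d = d, OF ind law sq mean var v n d])
      have "cmod (of_real (prob (E d)) * (expectation (h d) - ?c n)) =
          prob (E d) * cmod (expectation (h d) - ?c n)"
        by (simp only: norm_mult norm_of_real abs_of_nonneg[OF measure_nonneg])
      also have "\<dots> \<le> prob (E d) * ?R n"
        by (rule mult_left_mono[OF le measure_nonneg])
      finally show "cmod (of_real (prob (E d)) * (expectation (h d) - ?c n)) \<le> prob (E d) * ?R n" .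
    qed
    also have "\<dots> = ?R n"
      unfolding sum_distrib_right[symmetric] one by simp
    finally show ?thesis .
  qed
  \<comment> \<open>The minimum is what spares a third moment: it is dominated by 6 eps^2, while the
    cubic term drives it to 0 pointwise.\<close>
  have "(\<lambda>n. expectation (\<lambda>\<omega>. min (6 * (eps 0 \<omega>)\<^sup>2) (\<bar>t / sqrt (real n)\<bar> * \<bar>eps 0 \<omega>\<bar> ^ 3)))
      \<longlonglongrightarrow> expectation (\<lambda>\<omega>. 0)"
  proof (rule integral_dominated_convergence[where w = "\<lambda>\<omega>. 6 * (eps 0 \<omega>)\<^sup>2"])
    show "AE \<omega> in M. (\<lambda>n. min (6 * (eps 0 \<omega>)\<^sup>2) (\<bar>t / sqrt (real n)\<bar> * \<bar>eps 0 \<omega>\<bar> ^ 3)) \<longlonglongrightarrow> 0"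
    proof (rule AE_I2)
      fix \<omega>
      have "(\<lambda>n. t / sqrt (real n)) \<longlonglongrightarrow> 0"
        by real_asymp
      then have "(\<lambda>n. \<bar>t / sqrt (real n)\<bar> * \<bar>eps 0 \<omega>\<bar> ^ 3) \<longlonglongrightarrow> 0"
        by (intro tendsto_mult_left_zero tendsto_rabs_zero)
      then have "(\<lambda>n. min (6 * (eps 0 \<omega>)\<^sup>2) (\<bar>t / sqrt (real n)\<bar> * \<bar>eps 0 \<omega>\<bar> ^ 3))
          \<longlonglongrightarrow> min (6 * (eps 0 \<omega>)\<^sup>2) 0"
        by (intro tendsto_min tendsto_const)
      then show "(\<lambda>n. min (6 * (eps 0 \<omega>)\<^sup>2) (\<bar>t / sqrt (real n)\<bar> * \<bar>eps 0 \<omega>\<bar> ^ 3)) \<longlonglongrightarrow> 0"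
        by simp
    qed
  qed (use sq in auto)
  then have R: "?R \<longlonglongrightarrow> 0"
    using tendsto_mult_right_zero[of _ sequentially "t\<^sup>2 / 6"] by simp
  have "\<forall>\<^sub>F n in sequentially. norm (char (distr M borel (?W n)) t - ?c n) \<le> ?R n"
  proof (rule eventually_sequentiallyI)
    \<comment> \<open>The ceiling supplies the size needed for factors in the unit disc, the
      successor supplies n > 0.\<close>
    fix n :: nat assume "n \<ge> Suc (nat \<lceil>t\<^sup>2 * v / 4\<rceil>)"
    then have "n > 0" "t\<^sup>2 * v / 4 \<le> real n"
      using real_nat_ceiling_ge[of "t\<^sup>2 * v / 4"] by linarith+
    then show "norm (char (distr M borel (?W n)) t - ?c n) \<le> ?R n" by (rule bound)
  qed
  then have "(\<lambda>n. char (distr M borel (?W n)) t - ?c n) \<longlonglongrightarrow> 0"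
    by (rule Lim_null_comparison[OF _ R])
  moreover have "?c \<longlonglongrightarrow> complex_of_real (exp (- (t\<^sup>2 * v) / 2))"
    by (rule isCont_tendsto_compose[OF _ tendsto_exp_limit_sequentially]) auto
  ultimately have "(\<lambda>n. char (distr M borel (?W n)) t) \<longlonglongrightarrow>
      complex_of_real (exp (- (t\<^sup>2 * v) / 2))"
    by (rule Lim_transform[rotated])
  then show ?thesis by (simp add: exp_of_real[symmetric])
qed

end

section \<open>The inverse of a random matrix\<close>

text \<open>A right inverse of a square matrix is two-sided, so A is a unit of the matrix ring and
  \<open>mat_inverse\<close> cannot return \<open>None\<close>; associativity then identifies the
  result with B.\<close>

lemma mat_inv_unique:
  assumes A: "A \<in> carrier_mat m m" and B: "B \<in> carrier_mat m m" and AB: "A * B = 1\<^sub>m m"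
  shows "mat_inv A = B"
proof -
  have BA: "B * A = 1\<^sub>m m"
    by (rule mat_mult_left_right_inverse[OF A B AB])
  have "A \<in> Units (ring_mat TYPE(real) m ())"
    using A B AB BA by (auto simp: Units_def ring_mat_def)
  then obtain C where C: "mat_inverse A = Some C"
    using mat_inverse(1)[OF A, of "()"] by (cases "mat_inverse A") auto
  then have C': "C \<in> carrier_mat m m" "C * A = 1\<^sub>m m"
    using mat_inverse(2)[OF A] by auto
  have "C = C * (A * B)" using C' AB by simp
  also have "\<dots> = (C * A) * B" using C' A B by (intro assoc_mult_mat[symmetric]) auto
  also have "\<dots> = B" using C' B by simp
  finally show ?thesis using C by (simp add: mat_inv_def)
qed

lemma mat_inv_carrier: "A \<in> carrier_mat m m \<Longrightarrow> mat_inv A \<in> carrier_mat m m"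
  using mat_inverse(2)[of A m] by (auto simp: mat_inv_def split: option.splits)

lemma mat_inv_right:
  assumes A: "A \<in> carrier_mat m m" and det: "Determinant.det A \<noteq> 0"
  shows "A * mat_inv A = 1\<^sub>m m"
proof -
  have "A \<in> Units (ring_mat TYPE(real) m ())"
    by (rule det_non_zero_imp_unit[OF A det])
  then obtain C where "mat_inverse A = Some C"
    using mat_inverse(1)[OF A, of "()"] by (cases "mat_inverse A") auto
  then show ?thesis using mat_inverse(2)[OF A] by (auto simp: mat_inv_def)
qed

text \<open>Division by zero makes this hold for singular matrices as well.\<close>

lemma mat_inv_cofactor:
  assumes A: "A \<in> carrier_mat m m" and ij: "i < m" "j < m"
  shows "mat_inv A $$ (i, j) = cofactor A j i / Determinant.det A"
proof (cases "Determinant.det A = 0")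
  case True
  have "mat_inverse A = None"
  proof (cases "mat_inverse A")
    case (Some B)
    then have "A * B = 1\<^sub>m m" "B \<in> carrier_mat m m"
      using mat_inverse(2)[OF A] by auto
    then have "Determinant.det A * Determinant.det B = 1"
      using Determinant.det_mult[OF A, of B] by simp
    then show ?thesis using True by simp
  qed
  then show ?thesis using True A ij by (simp add: mat_inv_def)
next
  case False
  note adj = adj_mat[OF A]
  let ?B = "(1 / Determinant.det A) \<cdot>\<^sub>m adj_mat A"
  have "A * ?B = (1 / Determinant.det A) \<cdot>\<^sub>m (A * adj_mat A)"
    by (rule mult_smult_distrib[OF A adj(1)])
  also have "\<dots> = 1\<^sub>m m"
    unfolding adj(2) using False by (intro eq_matI) auto
  finally have "mat_inv A = ?B"
    by (intro mat_inv_unique[OF A]) (use adj in auto)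
  then show ?thesis
    using A ij by (simp add: adj_mat_def)
qed

lemma mat_inv_smult:
  assumes A: "A \<in> carrier_mat m m" and det: "Determinant.det A \<noteq> 0" and c: "c \<noteq> 0"
  shows "mat_inv (c \<cdot>\<^sub>m A) = (1 / c) \<cdot>\<^sub>m mat_inv A"
proof (rule mat_inv_unique)
  note B = mat_inv_carrier[OF A]
  show "c \<cdot>\<^sub>m A \<in> carrier_mat m m" "(1 / c) \<cdot>\<^sub>m mat_inv A \<in> carrier_mat m m"
    using A B by auto
  have "(c \<cdot>\<^sub>m A) * ((1 / c) \<cdot>\<^sub>m mat_inv A) = (1 / c) \<cdot>\<^sub>m (c \<cdot>\<^sub>m (A * mat_inv A))"
    using A B by (simp add: mult_smult_distrib[of _ m m _ m] mult_smult_assoc_mat[of _ m m _ m])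
  also have "\<dots> = 1\<^sub>m m"
    unfolding mat_inv_right[OF A det] using c by (intro eq_matI) auto
  finally show "(c \<cdot>\<^sub>m A) * ((1 / c) \<cdot>\<^sub>m mat_inv A) = 1\<^sub>m m" .
qed

text \<open>Leibniz's formula for the minor, with indices that jump over row i and column j of A. It
  exhibits the cofactor as a polynomial in the entries of A, so measurability and limits pass
  through entry by entry.\<close>

lemma cofactor_expand:
  assumes A: "A \<in> carrier_mat m m"
  shows "cofactor A i j = (-1) ^ (i + j) * (\<Sum>p | p permutes {0..<m - 1}.
     signof p * (\<Prod>k = 0..<m - 1.
       A $$ (if k < i then k else Suc k, if p k < j then p k else Suc (p k))))"
proof -
  have "Determinant.det (mat_delete A i j) = (\<Sum>p | p permutes {0..<m - 1}.
     signof p * (\<Prod>k = 0..<m - 1. mat_delete A i j $$ (k, p k)))"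
    by (rule det_def'[OF mat_delete_carrier[OF A]])
  also have "\<dots> = (\<Sum>p | p permutes {0..<m - 1}. signof p * (\<Prod>k = 0..<m - 1.
       A $$ (if k < i then k else Suc k, if p k < j then p k else Suc (p k))))"
  proof (intro sum.cong refl arg_cong2[where f = "(*)"] prod.cong)
    fix p k assume "p \<in> {p. p permutes {0..<m - 1}}" "k \<in> {0..<m - 1}"
    then have "k < m - 1" "p k < m - 1"
      by (auto dest: permutes_in_image[of p _ k])
    then show "mat_delete A i j $$ (k, p k) =
        A $$ (if k < i then k else Suc k, if p k < j then p k else Suc (p k))"
      using A by (simp add: mat_delete_def)
  qed
  finally show ?thesis by (simp add: cofactor_def)
qed

section \<open>Measurability and limits of determinants and inverses of random matrices\<close>

context prob_space
begin

context
  fixes A :: "nat \<Rightarrow> 'a \<Rightarrow> real mat" and m :: nat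
  assumes carrier: "\<And>n \<omega>. A n \<omega> \<in> carrier_mat m m"
begin

lemma borel_measurable_det:
  assumes [measurable]: "\<And>i j. i < m \<Longrightarrow> j < m \<Longrightarrow> (\<lambda>\<omega>. A n \<omega> $$ (i, j)) \<in> borel_measurable M"
  shows "(\<lambda>\<omega>. Determinant.det (A n \<omega>)) \<in> borel_measurable M"
proof -
  have "p i < m" if "p permutes {0..<m}" "i < m" for p i
    using permutes_in_image[OF that(1), of i] that(2) by simp
  then show ?thesis
    unfolding det_def'[OF carrier]
    by (intro borel_measurable_sum borel_measurable_times borel_measurable_const
        borel_measurable_prod assms) auto
qed

lemma borel_measurable_mat_inv:
  assumes [measurable]: "\<And>i j. i < m \<Longrightarrow> j < m \<Longrightarrow> (\<lambda>\<omega>. A n \<omega> $$ (i, j)) \<in> borel_measurable M"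
    and ij: "i < m" "j < m"
  shows "(\<lambda>\<omega>. mat_inv (A n \<omega>) $$ (i, j)) \<in> borel_measurable M"
proof -
  have p: "p k < m - Suc 0" if "p permutes {0..<m - Suc 0}" "k < m - Suc 0" for p k
    using permutes_in_image[OF that(1), of k] that(2) by simp
  have "(\<lambda>\<omega>. cofactor (A n \<omega>) j i) \<in> borel_measurable M"
    unfolding cofactor_expand[OF carrier]
    by (intro borel_measurable_sum borel_measurable_times borel_measurable_const
        borel_measurable_prod assms) (auto dest: p)
  then show ?thesis
    unfolding mat_inv_cofactor[OF carrier ij]
    by (intro borel_measurable_divide borel_measurable_det assms)
qed

context
  fixes V :: "real mat"
  assumes V: "V \<in> carrier_mat m m"
    and conv: "\<And>i j. i < m \<Longrightarrow> j < m \<Longrightarrow> conv_prob M (\<lambda>n \<omega>. A n \<omega> $$ (i, j)) (V $$ (i, j))"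
begin

lemma conv_prob_det:
  "conv_prob M (\<lambda>n \<omega>. Determinant.det (A n \<omega>)) (Determinant.det V)"
proof -
  have "p i < m" if "p permutes {0..<m}" "i < m" for p i
    using permutes_in_image[OF that(1), of i] that(2) by simp
  then show ?thesis
    unfolding det_def'[OF carrier] det_def'[OF V]
    by (intro conv_prob_sum conv_prob_mult conv_prob_const conv_prob_prod conv) auto
qed

text \<open>By Cramer's rule the entries of the inverse are quotients of polynomials in the entries
  of the matrix. Only the limit has to be nonsingular, since the cofactor formula also covers
  outcomes at which \<open>A n\<close> is singular.\<close>

lemma conv_prob_mat_inv:
  assumes det: "Determinant.det V \<noteq> 0" and ij: "i < m" "j < m"
  shows "conv_prob M (\<lambda>n \<omega>. mat_inv (A n \<omega>) $$ (i, j)) (mat_inv V $$ (i, j))"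
proof -
  have p: "p k < m - Suc 0" if "p permutes {0..<m - Suc 0}" "k < m - Suc 0" for p k
    using permutes_in_image[OF that(1), of k] that(2) by simp
  have "conv_prob M (\<lambda>n \<omega>. cofactor (A n \<omega>) j i) (cofactor V j i)"
    unfolding cofactor_expand[OF carrier] cofactor_expand[OF V]
    by (intro conv_prob_sum conv_prob_mult conv_prob_const conv_prob_prod conv) (auto dest: p)
  then show ?thesis
    unfolding mat_inv_cofactor[OF carrier ij] mat_inv_cofactor[OF V ij]
    by (intro conv_prob_divide conv_prob_det det)
qed

end

end

end

section \<open>Least squares algebra\<close>

text \<open>The entry of the design matrix as a total function, so that sums over units can be
  rearranged without dimension conditions.\<close>

definition regressor :: "(nat \<Rightarrow> real) \<Rightarrow> (nat \<Rightarrow> nat \<Rightarrow> real) \<Rightarrow> nat \<Rightarrow> nat \<Rightarrow> real" where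
  "regressor t x i k = (if k = 0 then t i else if k = 1 then 1 - t i else x i (k - 2))"

definition gram_mat :: "nat \<Rightarrow> nat \<Rightarrow> (nat \<Rightarrow> real) \<Rightarrow> (nat \<Rightarrow> nat \<Rightarrow> real) \<Rightarrow> real mat" where
  "gram_mat n p t x =
     mat (p + 2) (p + 2) (\<lambda>(k, l). \<Sum>i<n. regressor t x i k * regressor t x i l)"

lemma gram_mat_carrier: "gram_mat n p t x \<in> carrier_mat (p + 2) (p + 2)"
  by (simp add: gram_mat_def)

lemma design_mat_carrier: "design_mat n p t x \<in> carrier_mat n (p + 2)"
  by (simp add: design_mat_def)

lemma design_mat_index:
  "i < n \<Longrightarrow> k < p + 2 \<Longrightarrow> design_mat n p t x $$ (i, k) = regressor t x i k"
  by (simp add: design_mat_def regressor_def)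

lemma gram_mat_eq: "(design_mat n p t x)\<^sup>T * design_mat n p t x = gram_mat n p t x"
  by (rule eq_matI)
     (auto simp: gram_mat_def design_mat_def regressor_def scalar_prod_def lessThan_atLeast0
       intro!: sum.cong)

definition score :: "nat \<Rightarrow> nat \<Rightarrow> (nat \<Rightarrow> real) \<Rightarrow> (nat \<Rightarrow> nat \<Rightarrow> real) \<Rightarrow> (nat \<Rightarrow> real) \<Rightarrow> real vec" where
  "score n p t x z = vec (p + 2) (\<lambda>k. \<Sum>i<n. regressor t x i k * z i)"

lemma score_carrier: "score n p t x z \<in> carrier_vec (p + 2)"
  by (simp add: score_def)

lemma score_eq: "(design_mat n p t x)\<^sup>T *\<^sub>v vec n z = score n p t x z"
  by (rule eq_vecI)
     (auto simp: score_def design_mat_def regressor_def scalar_prod_def lessThan_atLeast0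
       intro!: sum.cong)

lemma ols_estimator_eq:
  "ols_estimator n p t x y = mat_inv (gram_mat n p t x) *\<^sub>v score n p t x y"
  by (simp add: ols_estimator_def gram_mat_eq score_eq Let_def)

lemma scalar_prod_contrast:
  assumes "v \<in> carrier_vec (p + 2)"
  shows "scalar_prod (contrast p) v = v $ 0 - v $ 1"
proof -
  have "scalar_prod (contrast p) v = (\<Sum>j<p + 2. contrast p $ j * v $ j)"
    using assms by (simp add: scalar_prod_def lessThan_atLeast0)
  also have "\<dots> = (\<Sum>j\<in>{0, 1}. contrast p $ j * v $ j)"
    by (rule sum.mono_neutral_right) (auto simp: contrast_def)
  also have "\<dots> = v $ 0 - v $ 1"
    by (simp add: contrast_def)
  finally show ?thesis .
qed

lemma mult_mat_vec_index:
  assumes "B \<in> carrier_mat m m" "v \<in> carrier_vec m" "k < m"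
  shows "(B *\<^sub>v v) $ k = (\<Sum>l<m. B $$ (k, l) * v $ l)"
  using assms by (simp add: scalar_prod_def lessThan_atLeast0)

lemma scalar_prod_contrast_mat_inv:
  fixes p :: nat
  assumes B: "B \<in> carrier_mat (p + 2) (p + 2)"
  shows "scalar_prod (contrast p) (B *\<^sub>v contrast p) =
    B $$ (0, 0) - B $$ (0, 1) - (B $$ (1, 0) - B $$ (1, 1))"
proof -
  have L: "contrast p \<in> carrier_vec (p + 2)"
    by (simp add: contrast_def)
  have row: "(B *\<^sub>v contrast p) $ k = B $$ (k, 0) - B $$ (k, 1)" if "k < p + 2" for k
  proof -
    have "(B *\<^sub>v contrast p) $ k = (\<Sum>l<p + 2. B $$ (k, l) * contrast p $ l)"
      by (rule mult_mat_vec_index[OF B L that])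
    also have "\<dots> = (\<Sum>l\<in>{0, 1}. B $$ (k, l) * contrast p $ l)"
      by (rule sum.mono_neutral_right) (auto simp: contrast_def)
    also have "\<dots> = B $$ (k, 0) - B $$ (k, 1)"
      by (simp add: contrast_def)
    finally show ?thesis .
  qed
  have "scalar_prod (contrast p) (B *\<^sub>v contrast p) =
      (B *\<^sub>v contrast p) $ 0 - (B *\<^sub>v contrast p) $ 1"
    by (rule scalar_prod_contrast) (use B L in auto)
  then show ?thesis using row by simp
qed

text \<open>This entrywise form holds for singular Gram matrices too; it serves to show that the
  statistic is measurable on the whole space.\<close>

lemma resid_var_eq:
  "resid_var n p t x y =
    (\<Sum>i<n. (y i - (\<Sum>k<p + 2. regressor t x i k * ols_estimator n p t x y $ k))\<^sup>2) /
    (real n - real p - 2)"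
proof -
  let ?o = "ols_estimator n p t x y"
  have o: "?o \<in> carrier_vec (p + 2)"
    unfolding ols_estimator_eq
    by (rule mult_mat_vec_carrier[OF mat_inv_carrier[OF gram_mat_carrier] score_carrier])
  let ?r = "vec n y - design_mat n p t x *\<^sub>v ?o"
  have r: "?r $ i = y i - (\<Sum>k<p + 2. regressor t x i k * ?o $ k)" if i: "i < n" for i
  proof -
    have "(design_mat n p t x *\<^sub>v ?o) $ i = (\<Sum>k<p + 2. design_mat n p t x $$ (i, k) * ?o $ k)"
      using i o design_mat_carrier[of n p t x] by (simp add: scalar_prod_def lessThan_atLeast0)
    also have "\<dots> = (\<Sum>k<p + 2. regressor t x i k * ?o $ k)"
      by (intro sum.cong refl) (simp add: design_mat_index i)
    finally show ?thesis
      using i design_mat_carrier[of n p t x] by simp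
  qed
  have dim: "dim_vec ?r = n"
    using design_mat_carrier[of n p t x] by simp
  have "scalar_prod ?r ?r = (\<Sum>i<n. ?r $ i * ?r $ i)"
    unfolding scalar_prod_def dim lessThan_atLeast0 ..
  also have "\<dots> = (\<Sum>i<n. (y i - (\<Sum>k<p + 2. regressor t x i k * ?o $ k))\<^sup>2)"
    by (intro sum.cong refl) (simp only: lessThan_iff r power2_eq_square)
  finally show ?thesis
    unfolding resid_var_def Let_def by (rule arg_cong)
qed

lemma test_stat_expand:
  "test_stat n p t x y =
    (ols_estimator n p t x y $ 0 - ols_estimator n p t x y $ 1) /
    sqrt (resid_var n p t x y *
      (mat_inv (gram_mat n p t x) $$ (0, 0) - mat_inv (gram_mat n p t x) $$ (0, 1) -
       (mat_inv (gram_mat n p t x) $$ (1, 0) - mat_inv (gram_mat n p t x) $$ (1, 1))))"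
proof -
  have "ols_estimator n p t x y \<in> carrier_vec (p + 2)"
    unfolding ols_estimator_eq
    by (rule mult_mat_vec_carrier[OF mat_inv_carrier[OF gram_mat_carrier] score_carrier])
  then show ?thesis
    by (simp add: test_stat_def Let_def gram_mat_eq scalar_prod_contrast
        scalar_prod_contrast_mat_inv[OF mat_inv_carrier[OF gram_mat_carrier]])
qed

text \<open>For a nonsingular Gram matrix the estimation error and the residuals only depend on the
  errors \<open>z\<close> of the working model, not on its coefficients \<open>\<theta>\<close>.\<close>

context
  fixes n p :: nat and t :: "nat \<Rightarrow> real" and x :: "nat \<Rightarrow> nat \<Rightarrow> real" and y z :: "nat \<Rightarrow> real"
    and \<theta> :: "real vec"
  assumes \<theta>: "\<theta> \<in> carrier_vec (p + 2)"
    and y: "\<And>i. i < n \<Longrightarrow> y i = (\<Sum>k<p + 2. regressor t x i k * \<theta> $ k) + z i"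
    and det: "Determinant.det (gram_mat n p t x) \<noteq> 0"
begin

private abbreviation "G \<equiv> design_mat n p t x"
private abbreviation "A \<equiv> gram_mat n p t x"
private abbreviation "B \<equiv> mat_inv (gram_mat n p t x)"
private abbreviation "w \<equiv> score n p t x z"

private lemma G: "G \<in> carrier_mat n (p + 2)" by (rule design_mat_carrier)
private lemma A: "A \<in> carrier_mat (p + 2) (p + 2)" by (rule gram_mat_carrier)
private lemma B: "B \<in> carrier_mat (p + 2) (p + 2)" by (rule mat_inv_carrier[OF A])
private lemma w: "w \<in> carrier_vec (p + 2)" by (rule score_carrier)

private lemma y_vec: "vec n y = G *\<^sub>v \<theta> + vec n z"
proof (rule eq_vecI)
  fix i assume "i < dim_vec (G *\<^sub>v \<theta> + vec n z)"
  then have i: "i < n" by simp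
  have "(G *\<^sub>v \<theta>) $ i = (\<Sum>k<p + 2. G $$ (i, k) * \<theta> $ k)"
    using i \<theta> G by (simp add: scalar_prod_def lessThan_atLeast0)
  also have "\<dots> = (\<Sum>k<p + 2. regressor t x i k * \<theta> $ k)"
    by (intro sum.cong refl) (simp add: design_mat_index i)
  finally show "vec n y $ i = (G *\<^sub>v \<theta> + vec n z) $ i"
    using i y by simp
qed simp

private lemma BA: "B * A = 1\<^sub>m (p + 2)"
  by (rule mat_mult_left_right_inverse[OF A B mat_inv_right[OF A det]])

lemma ols_estimator_error: "ols_estimator n p t x y = \<theta> + B *\<^sub>v w"
proof -
  have "score n p t x y = G\<^sup>T *\<^sub>v (G *\<^sub>v \<theta> + vec n z)"
    using y_vec by (simp add: score_eq[symmetric])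
  also have "\<dots> = G\<^sup>T *\<^sub>v (G *\<^sub>v \<theta>) + G\<^sup>T *\<^sub>v vec n z"
    by (rule mult_add_distrib_mat_vec[of _ "p + 2" n]) (use G \<theta> in auto)
  also have "G\<^sup>T *\<^sub>v (G *\<^sub>v \<theta>) = A *\<^sub>v \<theta>"
    unfolding gram_mat_eq[symmetric] by (rule assoc_mult_mat_vec[symmetric]) (use G \<theta> in auto)
  finally have s: "score n p t x y = A *\<^sub>v \<theta> + w"
    by (simp add: score_eq)
  have "ols_estimator n p t x y = B *\<^sub>v (A *\<^sub>v \<theta>) + B *\<^sub>v w"
    unfolding ols_estimator_eq s
    by (rule mult_add_distrib_mat_vec[OF B]) (use A \<theta> w in auto)
  also have "B *\<^sub>v (A *\<^sub>v \<theta>) = (B * A) *\<^sub>v \<theta>"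
    by (rule assoc_mult_mat_vec[symmetric]) (use A B \<theta> in auto)
  finally show ?thesis using \<theta> by (simp add: BA)
qed

text \<open>Pythagoras: the residual z - G B w is orthogonal to the columns of G, so its squared
  length is |z|^2 minus the squared length of the projection, and the latter is the quadratic form
  of B at the score w.\<close>

lemma resid_var_error:
  "resid_var n p t x y =
    ((\<Sum>i<n. (z i)\<^sup>2) - (\<Sum>k<p + 2. \<Sum>l<p + 2. w $ k * B $$ (k, l) * w $ l)) /
    (real n - real p - 2)"
proof -
  let ?c = "B *\<^sub>v w" and ?z = "vec n z"
  have c: "?c \<in> carrier_vec (p + 2)" using B w by auto
  have Gc: "G *\<^sub>v ?c \<in> carrier_vec n" using G c by auto
  have r: "?z - G *\<^sub>v ?c \<in> carrier_vec n" using Gc by auto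
  have Ac: "A *\<^sub>v ?c = w"
  proof -
    have "A *\<^sub>v ?c = (A * B) *\<^sub>v w"
      by (rule assoc_mult_mat_vec[symmetric]) (use A B w in auto)
    then show ?thesis using w by (simp add: mat_inv_right[OF A det])
  qed
  have "vec n y - G *\<^sub>v ols_estimator n p t x y =
      (G *\<^sub>v \<theta> + ?z) - (G *\<^sub>v \<theta> + G *\<^sub>v ?c)"
    unfolding ols_estimator_error y_vec mult_add_distrib_mat_vec[OF G \<theta> c] ..
  also have "\<dots> = ?z - G *\<^sub>v ?c"
    using G \<theta> c Gc by (intro eq_vecI) auto
  finally have resid: "vec n y - G *\<^sub>v ols_estimator n p t x y = ?z - G *\<^sub>v ?c" .
  \<comment> \<open>The normal equations.\<close>
  have normal: "G\<^sup>T *\<^sub>v (?z - G *\<^sub>v ?c) = 0\<^sub>v (p + 2)"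
  proof -
    have "G\<^sup>T *\<^sub>v (?z - G *\<^sub>v ?c) = G\<^sup>T *\<^sub>v ?z - G\<^sup>T *\<^sub>v (G *\<^sub>v ?c)"
      by (rule mult_minus_distrib_mat_vec[of _ "p + 2" n]) (use G Gc in auto)
    also have "G\<^sup>T *\<^sub>v (G *\<^sub>v ?c) = (G\<^sup>T * G) *\<^sub>v ?c"
      by (rule assoc_mult_mat_vec[symmetric]) (use G c in auto)
    finally show ?thesis using w by (simp add: score_eq gram_mat_eq Ac)
  qed
  have "scalar_prod (?z - G *\<^sub>v ?c) (?z - G *\<^sub>v ?c) =
      scalar_prod (?z - G *\<^sub>v ?c) ?z - scalar_prod (?z - G *\<^sub>v ?c) (G *\<^sub>v ?c)"
    by (rule scalar_prod_minus_distrib[OF r _ Gc]) simp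
  also have "scalar_prod (?z - G *\<^sub>v ?c) (G *\<^sub>v ?c) = scalar_prod (G\<^sup>T *\<^sub>v (?z - G *\<^sub>v ?c)) ?c"
    by (rule transpose_vec_mult_scalar[OF G c r, symmetric])
  also have "\<dots> = 0"
    unfolding normal using c by simp
  also have "scalar_prod (?z - G *\<^sub>v ?c) ?z = scalar_prod ?z ?z - scalar_prod (G *\<^sub>v ?c) ?z"
    by (rule minus_scalar_prod_distrib[OF _ Gc]) auto
  also have "scalar_prod (G *\<^sub>v ?c) ?z = scalar_prod ?z (G *\<^sub>v ?c)"
    by (rule comm_scalar_prod[OF Gc]) auto
  also have "\<dots> = scalar_prod (G\<^sup>T *\<^sub>v ?z) ?c"
    by (rule transpose_vec_mult_scalar[OF G c, symmetric]) auto
  also have "\<dots> = (\<Sum>k<p + 2. w $ k * ?c $ k)"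
    unfolding score_eq scalar_prod_def carrier_vecD[OF c] lessThan_atLeast0 ..
  also have "\<dots> = (\<Sum>k<p + 2. \<Sum>l<p + 2. w $ k * B $$ (k, l) * w $ l)"
    by (intro sum.cong refl, subst mult_mat_vec_index[OF B w])
       (simp_all only: sum_distrib_left mult.assoc lessThan_iff)
  also have "scalar_prod ?z ?z = (\<Sum>i<n. (z i)\<^sup>2)"
    by (simp add: scalar_prod_def power2_eq_square lessThan_atLeast0)
  finally show ?thesis
    by (simp add: resid_var_def Let_def resid)
qed

text \<open>Numerator and denominator are rescaled by \<open>sqrt n\<close> and the Gram matrix by \<open>1 / n\<close>.\<close>

lemma test_stat_error:
  assumes n: "n > 0"
  defines "H \<equiv> mat_inv ((1 / real n) \<cdot>\<^sub>m gram_mat n p t x)"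
    and "g \<equiv> \<lambda>k. w $ k / sqrt (real n)"
  shows "test_stat n p t x y =
    (sqrt (real n) * (\<theta> $ 0 - \<theta> $ 1) + (\<Sum>l<p + 2. (H $$ (0, l) - H $$ (1, l)) * g l)) /
    sqrt (((\<Sum>i<n. (z i)\<^sup>2) / real n - (\<Sum>k<p + 2. \<Sum>l<p + 2. g k * H $$ (k, l) * g l) / real n) *
      (real n / (real n - real p - 2)) *
      (H $$ (0, 0) - H $$ (0, 1) - (H $$ (1, 0) - H $$ (1, 1))))"
proof -
  have sn: "sqrt (real n) > 0" using n by simp
  have H: "H = real n \<cdot>\<^sub>m B"
    unfolding H_def using mat_inv_smult[OF A det, of "1 / real n"] n by simp
  have Bi: "B $$ (k, l) = H $$ (k, l) / real n" if "k < p + 2" "l < p + 2" for k l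
    using that B n by (simp add: H)
  have wi: "w $ k = sqrt (real n) * g k" for k
    using sn by (simp add: g_def)
  have coef: "ols_estimator n p t x y $ 0 - ols_estimator n p t x y $ 1 =
      (sqrt (real n) * (\<theta> $ 0 - \<theta> $ 1) + (\<Sum>l<p + 2. (H $$ (0, l) - H $$ (1, l)) * g l)) / sqrt (real n)"
  proof -
    have k: "ols_estimator n p t x y $ k = \<theta> $ k + (\<Sum>l<p + 2. H $$ (k, l) * g l) / sqrt (real n)"
      if "k < p + 2" for k
    proof -
      have "ols_estimator n p t x y $ k = \<theta> $ k + (\<Sum>l<p + 2. B $$ (k, l) * w $ l)"
        unfolding ols_estimator_error using that B w \<theta> mult_mat_vec_index[OF B w that] by simp
      also have "(\<Sum>l<p + 2. B $$ (k, l) * w $ l) = (\<Sum>l<p + 2. H $$ (k, l) * g l / sqrt (real n))"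
      proof (intro sum.cong refl)
        fix l assume "l \<in> {..<p + 2}"
        then have "B $$ (k, l) * w $ l = H $$ (k, l) * g l * (sqrt (real n) / real n)"
          using Bi[OF that, of l] by (simp add: wi)
        also have "sqrt (real n) / real n = 1 / sqrt (real n)"
          using n by (simp add: field_simps)
        finally show "B $$ (k, l) * w $ l = H $$ (k, l) * g l / sqrt (real n)" by simp
      qed
      finally show ?thesis by (simp only: sum_divide_distrib)
    qed
    have "ols_estimator n p t x y $ 0 - ols_estimator n p t x y $ 1 =
        (\<theta> $ 0 - \<theta> $ 1) + (\<Sum>l<p + 2. (H $$ (0, l) - H $$ (1, l)) * g l) / sqrt (real n)"
      unfolding left_diff_distrib sum_subtractf using k[of 0] k[of 1] by (simp add: diff_divide_distrib)
    then show ?thesis using sn by (simp add: add_divide_distrib)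
  qed
  have quad: "(\<Sum>k<p + 2. \<Sum>l<p + 2. w $ k * B $$ (k, l) * w $ l) =
      (\<Sum>k<p + 2. \<Sum>l<p + 2. g k * H $$ (k, l) * g l)"
  proof (intro sum.cong refl)
    fix k l assume "k \<in> {..<p + 2}" "l \<in> {..<p + 2}"
    moreover have "(s * a) * (h / N) * (s * b) = (a * h * b) * (s * s / N)" for s a h N b :: real
      by simp
    ultimately have "w $ k * B $$ (k, l) * w $ l =
        (g k * H $$ (k, l) * g l) * (sqrt (real n) * sqrt (real n) / real n)"
      using Bi[of k l] by (simp only: wi lessThan_iff)
    then show "w $ k * B $$ (k, l) * w $ l = g k * H $$ (k, l) * g l" using n by simp
  qed
  let ?q = "(\<Sum>k<p + 2. \<Sum>l<p + 2. g k * H $$ (k, l) * g l)" and ?s = "\<Sum>i<n. (z i)\<^sup>2"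
  let ?h = "H $$ (0, 0) - H $$ (0, 1) - (H $$ (1, 0) - H $$ (1, 1))"
  have "B $$ (0, 0) - B $$ (0, 1) - (B $$ (1, 0) - B $$ (1, 1)) = ?h / real n"
    using Bi[of 0 0] Bi[of 0 1] Bi[of 1 0] Bi[of 1 1] by (simp add: diff_divide_distrib)
  \<comment> \<open>The last factor 1/n comes from undoing the rescaling of the Gram matrix; its
    root cancels the division by sqrt n in \<open>coef\<close>.\<close>
  then have var: "resid_var n p t x y * (B $$ (0, 0) - B $$ (0, 1) - (B $$ (1, 0) - B $$ (1, 1))) =
      (?s / real n - ?q / real n) * (real n / (real n - real p - 2)) * ?h / real n"
    unfolding resid_var_error quad using n by (simp add: diff_divide_distrib[symmetric])
  show ?thesis
    unfolding test_stat_expand coef var real_sqrt_divide using sn by simp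
qed

end

section \<open>The linear model with balanced treatments\<close>

text \<open>\<open>T n i\<close> is the assignment of unit i in the sample of size n: the
  assignments form a triangular array, while covariates and errors are single infinite sequences.
  The two balance assumptions record how the randomization enters the limit; \<open>v\<close> is the
  error variance.\<close>

locale balanced_linear_model = prob_space M
  for M :: "'w measure" +
  fixes p d :: nat
    and X :: "nat \<Rightarrow> 'w \<Rightarrow> real"
    and x :: "nat \<Rightarrow> nat \<Rightarrow> 'w \<Rightarrow> real"
    and eps :: "nat \<Rightarrow> 'w \<Rightarrow> real"
    and T :: "nat \<Rightarrow> nat \<Rightarrow> 'w \<Rightarrow> real"
    and beta :: "nat \<Rightarrow> real"
    and v :: real
  assumes p_le: "p \<le> d"
    and X_indep: "indep_vars (\<lambda>_. borel) X {..<d}"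
    and X_sq: "\<And>j. j < d \<Longrightarrow> integrable M (\<lambda>\<omega>. (X j \<omega>)\<^sup>2)"
    and X_mean: "\<And>j. j < d \<Longrightarrow> expectation (X j) = 0"
    and X_var: "\<And>j. j < d \<Longrightarrow> variance (X j) > 0"
    and x_indep: "indep_vars (\<lambda>_. vec_space d) (\<lambda>i. cov_vec d (x i)) UNIV"
    and x_law: "\<And>i. distr M (vec_space d) (cov_vec d (x i)) = distr M (vec_space d) (cov_vec d X)"
    and eps_indep: "indep_vars (\<lambda>_. borel) eps UNIV"
    and eps_law: "\<And>i. distr M borel (eps i) = distr M borel (eps 0)"
    and eps_sq: "integrable M (\<lambda>\<omega>. (eps 0 \<omega>)\<^sup>2)"
    and eps_mean: "expectation (eps 0) = 0"
    and eps_var: "variance (eps 0) = v"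
    and v_pos: "v > 0"
    and T_x_eps: "\<And>n. indep_elements M (vec_space n \<Otimes>\<^sub>M array_space n d)
          (\<lambda>\<omega>. (cov_vec n (T n) \<omega>, cov_array n d x \<omega>)) (vec_space n) (cov_vec n eps)"
    and T_rv: "\<And>n i. i < n \<Longrightarrow> T n i \<in> borel_measurable M"
    and T_01: "\<And>n i \<omega>. i < n \<Longrightarrow> \<omega> \<in> space M \<Longrightarrow> T n i \<omega> \<in> {0, 1}"
    and T_balanced: "\<And>n \<omega>. \<omega> \<in> space M \<Longrightarrow> \<bar>\<Sum>i<n. 2 * T n i \<omega> - 1\<bar> \<le> 1"
    and x_balanced: "bounded_in_prob M
          (\<lambda>n \<omega>. L2_set (\<lambda>j. \<Sum>i<n. (2 * T n i \<omega> - 1) * x i j \<omega>) {..<d})"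
begin

abbreviation D :: "nat \<Rightarrow> nat \<Rightarrow> 'w \<Rightarrow> real" where
  "D n i \<omega> \<equiv> 2 * T n i \<omega> - 1"

subsection \<open>Moments of the covariates\<close>

lemma x_rv: "j < d \<Longrightarrow> x i j \<in> borel_measurable M"
proof -
  assume j: "j < d"
  have "cov_vec d (x i) \<in> measurable M (vec_space d)"
    using x_indep by (simp add: indep_vars_def)
  from measurable_compose[OF this measurable_component_singleton[of j]]
  show ?thesis using j by simp
qed

lemma X_rv: "j < d \<Longrightarrow> X j \<in> borel_measurable M"
  using X_indep by (simp add: indep_vars_def)

lemma eps_rv [measurable]: "eps i \<in> borel_measurable M"
  using eps_indep by (simp add: indep_vars_def)

declare x_rv [measurable] X_rv [measurable] T_rv [measurable]

lemma X_int: "j < d \<Longrightarrow> integrable M (X j)"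
  by (rule square_integrable_imp_integrable[OF X_rv X_sq])

lemma X_var_eq: "j < d \<Longrightarrow> variance (X j) = expectation (\<lambda>\<omega>. (X j \<omega>)\<^sup>2)"
  by (simp add: X_mean)

text \<open>For distinct indices the squares of the factors are independent and integrable, so the
  product is square integrable although the single covariates need not have fourth moments.\<close>

lemma
  assumes jl: "j < d" "l < d"
  shows X_mult_int: "integrable M (\<lambda>\<omega>. X j \<omega> * X l \<omega>)"
    and X_mult_mean: "expectation (\<lambda>\<omega>. X j \<omega> * X l \<omega>) = (if j = l then variance (X j) else 0)"
    and X_mult_sq_int: "j \<noteq> l \<Longrightarrow> integrable M (\<lambda>\<omega>. (X j \<omega> * X l \<omega>)\<^sup>2)"
proof -
  have ind: "indep_vars (\<lambda>_. borel) X {j, l}"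
    using X_indep by (rule indep_vars_subset) (use jl in auto)
  have ne: "integrable M (\<lambda>\<omega>. X j \<omega> * X l \<omega>)" "expectation (\<lambda>\<omega>. X j \<omega> * X l \<omega>) = 0" if "j \<noteq> l"
    using indep_vars_integrable[OF _ ind] indep_vars_lebesgue_integral[OF _ ind] X_int X_mean jl that
    by auto
  show "integrable M (\<lambda>\<omega>. X j \<omega> * X l \<omega>)"
    using ne X_sq[OF jl(1)] by (cases "j = l") (auto simp: power2_eq_square)
  show "expectation (\<lambda>\<omega>. X j \<omega> * X l \<omega>) = (if j = l then variance (X j) else 0)"
    using ne X_var_eq[OF jl(1)] by (auto simp: power2_eq_square)
  assume jl': "j \<noteq> l"
  have ind2: "indep_vars (\<lambda>_. borel) (\<lambda>j \<omega>. (X j \<omega>)\<^sup>2) {j, l}"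
    by (rule indep_vars_compose2[OF ind]) simp
  show "integrable M (\<lambda>\<omega>. (X j \<omega> * X l \<omega>)\<^sup>2)"
    using indep_vars_integrable[OF _ ind2] X_sq jl jl' by (auto simp: power_mult_distrib)
qed

text \<open>A measurable function of one row of covariates is i.i.d. over the rows, and its law can
  be computed from \<open>X\<close>; this is how the independence of different covariates becomes
  available for the rows.\<close>

lemma
  fixes F :: "(nat \<Rightarrow> real) \<Rightarrow> real"
  assumes F [measurable]: "F \<in> borel_measurable (vec_space d)"
  shows x_fun_indep: "indep_vars (\<lambda>_. borel) (\<lambda>i \<omega>. F (cov_vec d (x i) \<omega>)) UNIV"
    and x_fun_law: "distr M borel (\<lambda>\<omega>. F (cov_vec d (x i) \<omega>)) =
      distr M borel (\<lambda>\<omega>. F (cov_vec d (x 0) \<omega>))"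
    and x_fun_law_X: "distr M borel (\<lambda>\<omega>. F (cov_vec d (x 0) \<omega>)) =
      distr M borel (\<lambda>\<omega>. F (cov_vec d X \<omega>))"
proof -
  have [measurable]: "cov_vec d (x i) \<in> measurable M (vec_space d)" for i
    using x_indep by (simp add: indep_vars_def)
  have [measurable]: "cov_vec d X \<in> measurable M (vec_space d)"
    by measurable
  show "indep_vars (\<lambda>_. borel) (\<lambda>i \<omega>. F (cov_vec d (x i) \<omega>)) UNIV"
    by (rule indep_vars_compose2[OF x_indep]) simp
  have x: "distr M borel (\<lambda>\<omega>. F (cov_vec d (x i) \<omega>)) =
      distr (distr M (vec_space d) (cov_vec d (x i))) borel F" for i
    by (subst distr_distr) (auto simp: comp_def)
  have X: "distr M borel (\<lambda>\<omega>. F (cov_vec d X \<omega>)) =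
      distr (distr M (vec_space d) (cov_vec d X)) borel F"
    by (subst distr_distr) (auto simp: comp_def)
  show "distr M borel (\<lambda>\<omega>. F (cov_vec d (x i) \<omega>)) =
      distr M borel (\<lambda>\<omega>. F (cov_vec d (x 0) \<omega>))"
    unfolding x x_law ..
  show "distr M borel (\<lambda>\<omega>. F (cov_vec d (x 0) \<omega>)) =
      distr M borel (\<lambda>\<omega>. F (cov_vec d X \<omega>))"
    unfolding x X x_law ..
qed

lemma
  fixes F :: "(nat \<Rightarrow> real) \<Rightarrow> real" and h :: "real \<Rightarrow> real"
  assumes F [measurable]: "F \<in> borel_measurable (vec_space d)" "h \<in> borel_measurable borel"
  shows x_fun_int: "integrable M (\<lambda>\<omega>. h (F (cov_vec d (x i) \<omega>))) \<longleftrightarrow>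
      integrable M (\<lambda>\<omega>. h (F (cov_vec d X \<omega>)))"
    and x_fun_mean: "expectation (\<lambda>\<omega>. h (F (cov_vec d (x i) \<omega>))) =
      expectation (\<lambda>\<omega>. h (F (cov_vec d X \<omega>)))"
proof -
  have rv: "(\<lambda>\<omega>. F (cov_vec d (x i) \<omega>)) \<in> borel_measurable M"
    using x_fun_indep[OF F(1)] by (simp add: indep_vars_def)
  have rvX: "(\<lambda>\<omega>. F (cov_vec d X \<omega>)) \<in> borel_measurable M"
    by measurable
  have law: "distr M borel (\<lambda>\<omega>. F (cov_vec d (x i) \<omega>)) = distr M borel (\<lambda>\<omega>. F (cov_vec d X \<omega>))"
    using x_fun_law[OF F(1), of i] x_fun_law_X[OF F(1)] by (rule trans)
  show "integrable M (\<lambda>\<omega>. h (F (cov_vec d (x i) \<omega>))) \<longleftrightarrow>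
      integrable M (\<lambda>\<omega>. h (F (cov_vec d X \<omega>)))"
    by (rule integrable_eq_distr[OF rv rvX law F(2)])
  show "expectation (\<lambda>\<omega>. h (F (cov_vec d (x i) \<omega>))) =
      expectation (\<lambda>\<omega>. h (F (cov_vec d X \<omega>)))"
    by (rule expectation_eq_distr[OF rv rvX law F(2)])
qed

text \<open>For j = l the summands may have infinite variance, so the truncated weak law is used
  instead of Chebyshev's inequality.\<close>

lemma conv_prob_x_mult:
  assumes jl: "j < d" "l < d"
  shows "conv_prob M (\<lambda>n \<omega>. (\<Sum>i<n. x i j \<omega> * x i l \<omega>) / real n)
    (if j = l then variance (X j) else 0)"
proof -
  let ?F = "\<lambda>a :: nat \<Rightarrow> real. a j * a l"
  have F: "?F \<in> borel_measurable (vec_space d)"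
    using jl by (intro borel_measurable_times measurable_component_singleton) auto
  have "conv_prob M (\<lambda>n \<omega>. (\<Sum>i<n. ?F (cov_vec d (x i) \<omega>)) / real n)
      (expectation (\<lambda>\<omega>. ?F (cov_vec d (x 0) \<omega>)))"
    by (rule weak_law_of_large_numbers[OF x_fun_indep[OF F] x_fun_law[OF F]])
       (use x_fun_int[OF F, of "\<lambda>y. y" 0] X_mult_int[OF jl] jl in simp)
  also have "expectation (\<lambda>\<omega>. ?F (cov_vec d (x 0) \<omega>)) = (if j = l then variance (X j) else 0)"
    using x_fun_mean[OF F, of "\<lambda>y. y" 0] X_mult_mean[OF jl] jl by simp
  finally show ?thesis using jl by simp
qed

lemma bounded_x_fun:
  fixes F :: "(nat \<Rightarrow> real) \<Rightarrow> real"
  assumes F [measurable]: "F \<in> borel_measurable (vec_space d)"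
    and sq: "integrable M (\<lambda>\<omega>. (F (cov_vec d X \<omega>))\<^sup>2)"
    and mean: "expectation (\<lambda>\<omega>. F (cov_vec d X \<omega>)) = 0"
  shows "bounded_in_prob M (\<lambda>n \<omega>. (\<Sum>i<n. F (cov_vec d (x i) \<omega>)) / sqrt (real n))"
proof -
  let ?Y = "\<lambda>i \<omega>. F (cov_vec d (x i) \<omega>)"
  have rv [measurable]: "?Y i \<in> borel_measurable M" for i
    using x_fun_indep[OF F] by (simp add: indep_vars_def)
  have sq': "integrable M (\<lambda>\<omega>. (?Y 0 \<omega>)\<^sup>2)"
    using x_fun_int[OF F, of "\<lambda>y. y\<^sup>2" 0] sq by simp
  have mean': "expectation (?Y 0) = 0"
    using x_fun_mean[OF F, of "\<lambda>y. y" 0] mean by simp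
  note sum = integrable_sum_iid_sq[OF x_fun_indep[OF F] x_fun_law[OF F] sq' mean']
    expectation_sum_iid_sq[OF x_fun_indep[OF F] x_fun_law[OF F] sq' mean']
  show ?thesis
  proof (rule bounded_in_prob_second_moment)
    show "(\<lambda>\<omega>. (\<Sum>i<n. ?Y i \<omega>) / sqrt (real n)) \<in> borel_measurable M" for n
      by (intro borel_measurable_divide borel_measurable_sum rv) simp
    show "integrable M (\<lambda>\<omega>. ((\<Sum>i<n. ?Y i \<omega>) / sqrt (real n))\<^sup>2)" for n
      unfolding power_divide by (intro integrable_divide_zero sum(1))
    have "expectation (\<lambda>\<omega>. ((\<Sum>i<n. ?Y i \<omega>) / sqrt (real n))\<^sup>2) =
        real n * expectation (\<lambda>\<omega>. (?Y 0 \<omega>)\<^sup>2) / real n" for n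
      unfolding sum(2)[symmetric] by (simp add: power_divide)
    then show "expectation (\<lambda>\<omega>. ((\<Sum>i<n. ?Y i \<omega>) / sqrt (real n))\<^sup>2) \<le>
        expectation (\<lambda>\<omega>. (?Y 0 \<omega>)\<^sup>2)" for n
      by (cases "n = 0") auto
  qed
qed

lemma bounded_x:
  assumes j: "j < d"
  shows "bounded_in_prob M (\<lambda>n \<omega>. (\<Sum>i<n. x i j \<omega>) / sqrt (real n))"
  using bounded_x_fun[of "\<lambda>a. a j"] j X_sq[OF j] X_mean[OF j]
  by (simp add: measurable_component_singleton)

text \<open>Meant for an included and an omitted covariate, whose indices always differ: such
  products are centred and square integrable.\<close>

lemma bounded_x_mult:
  assumes jl: "j < d" "l < d" "j \<noteq> l"
  shows "bounded_in_prob M (\<lambda>n \<omega>. (\<Sum>i<n. x i j \<omega> * x i l \<omega>) / sqrt (real n))"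
proof -
  have F: "(\<lambda>a. a j * a l) \<in> borel_measurable (vec_space d)"
    using jl by (intro borel_measurable_times measurable_component_singleton) auto
  show ?thesis
    using bounded_x_fun[OF F] jl X_mult_sq_int[OF jl] X_mult_mean[OF jl(1,2)] by simp
qed

text \<open>The Euclidean norm of the imbalance vector dominates each of its coordinates.\<close>

lemma bounded_D_x:
  assumes j: "j < d"
  shows "bounded_in_prob M (\<lambda>n \<omega>. \<Sum>i<n. D n i \<omega> * x i j \<omega>)"
proof (rule bounded_in_prob_mono[OF _ x_balanced])
  show "(\<lambda>\<omega>. L2_set (\<lambda>j. \<Sum>i<n. D n i \<omega> * x i j \<omega>) {..<d}) \<in> borel_measurable M" for n
    unfolding L2_set_def by measurable
  show "\<bar>\<Sum>i<n. D n i \<omega> * x i j \<omega>\<bar> \<le> \<bar>L2_set (\<lambda>j. \<Sum>i<n. D n i \<omega> * x i j \<omega>) {..<d}\<bar>" for n \<omega>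
  proof -
    have "\<bar>\<Sum>i<n. D n i \<omega> * x i j \<omega>\<bar> = L2_set (\<lambda>j. \<Sum>i<n. D n i \<omega> * x i j \<omega>) {j}"
      by (simp add: L2_set_def)
    also have "\<dots> \<le> L2_set (\<lambda>j. \<Sum>i<n. D n i \<omega> * x i j \<omega>) {..<d}"
      unfolding L2_set_def using j by (intro real_sqrt_le_mono sum_mono2) auto
    finally show ?thesis by simp
  qed
qed

subsection \<open>Sums involving the errors\<close>

abbreviation history_space :: "nat \<Rightarrow> ((nat \<Rightarrow> real) \<times> (nat \<times> nat \<Rightarrow> real)) measure" where
  "history_space n \<equiv> vec_space n \<Otimes>\<^sub>M array_space n d"

abbreviation history :: "nat \<Rightarrow> 'w \<Rightarrow> (nat \<Rightarrow> real) \<times> (nat \<times> nat \<Rightarrow> real)" where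
  "history n \<omega> \<equiv> (cov_vec n (T n) \<omega>, cov_array n d x \<omega>)"

lemma history_measurable [measurable]: "history n \<in> measurable M (history_space n)"
  using T_x_eps[of n] by (simp add: indep_elements_def)

lemma eps_moment:
  "integrable M (\<lambda>\<omega>. (eps i \<omega>)\<^sup>2)" "integrable M (eps i)" "expectation (eps i) = 0"
  "expectation (\<lambda>\<omega>. (eps i \<omega>)\<^sup>2) = v"
proof -
  show sq: "integrable M (\<lambda>\<omega>. (eps i \<omega>)\<^sup>2)"
    using integrable_eq_distr[OF eps_rv eps_rv eps_law[of i], of "\<lambda>y. y\<^sup>2"] eps_sq by simp
  show "integrable M (eps i)"
    by (rule square_integrable_imp_integrable[OF eps_rv sq])
  show "expectation (eps i) = 0"
    using expectation_eq_distr[OF eps_rv eps_rv eps_law[of i], of "\<lambda>y. y"] eps_mean by simp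
  show "expectation (\<lambda>\<omega>. (eps i \<omega>)\<^sup>2) = v"
    using expectation_eq_distr[OF eps_rv eps_rv eps_law[of i], of "\<lambda>y. y\<^sup>2"] eps_mean eps_var by simp
qed

text \<open>The summands are orthogonal however the weights depend on each other: the product of two
  weights is independent of the product of the two errors, which has mean 0 for distinct units. Used
  with weights 1, a covariate, and the sign D.\<close>

lemma bounded_history_eps:
  assumes h [measurable]: "\<And>n i. i < n \<Longrightarrow> h n i \<in> borel_measurable (history_space n)"
    and sq: "\<And>n i. i < n \<Longrightarrow> integrable M (\<lambda>\<omega>. (h n i (history n \<omega>))\<^sup>2)"
    and le: "\<And>n i. i < n \<Longrightarrow> expectation (\<lambda>\<omega>. (h n i (history n \<omega>))\<^sup>2) \<le> B"
    and B: "B \<ge> 0"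
  shows "bounded_in_prob M (\<lambda>n \<omega>. (\<Sum>i<n. h n i (history n \<omega>) * eps i \<omega>) / sqrt (real n))"
proof (rule bounded_in_prob_second_moment)
  show "(\<lambda>\<omega>. (\<Sum>i<n. h n i (history n \<omega>) * eps i \<omega>) / sqrt (real n)) \<in> borel_measurable M" for n
    by measurable
  fix n
  let ?g = "\<lambda>i \<omega>. h n i (history n \<omega>) * eps i \<omega>"
  have *: "integrable M (\<lambda>\<omega>. ?g i \<omega> * ?g k \<omega>)"
    "expectation (\<lambda>\<omega>. ?g i \<omega> * ?g k \<omega>) =
      expectation (\<lambda>\<omega>. h n i (history n \<omega>) * h n k (history n \<omega>)) *
      expectation (\<lambda>\<omega>. eps i \<omega> * eps k \<omega>)" if ik: "i < n" "k < n" for i k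
  proof -
    let ?F = "\<lambda>a. h n i a * h n k a" and ?G = "\<lambda>e :: nat \<Rightarrow> real. e i * e k"
    have F: "?F \<in> borel_measurable (history_space n)"
      using ik by measurable
    have G: "?G \<in> borel_measurable (vec_space n)"
      using ik by (intro borel_measurable_times measurable_component_singleton) auto
    \<comment> \<open>Two weights need not be independent of each other, so their product is bounded
      by the sum of their squares.\<close>
    have iF: "integrable M (\<lambda>\<omega>. ?F (history n \<omega>))"
    proof (rule Bochner_Integration.integrable_bound)
      show "integrable M (\<lambda>\<omega>. (h n i (history n \<omega>))\<^sup>2 + (h n k (history n \<omega>))\<^sup>2)"
        using sq ik by (intro Bochner_Integration.integrable_add) auto
      show "(\<lambda>\<omega>. ?F (history n \<omega>)) \<in> borel_measurable M"
        by (rule measurable_compose[OF history_measurable F])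
      show "AE \<omega> in M. norm (?F (history n \<omega>)) \<le> norm ((h n i (history n \<omega>))\<^sup>2 + (h n k (history n \<omega>))\<^sup>2)"
      proof (rule AE_I2)
        fix \<omega>
        have "\<bar>a * b\<bar> \<le> a\<^sup>2 + b\<^sup>2" for a b :: real
        proof -
          have "2 * (\<bar>a\<bar> * \<bar>b\<bar>) \<le> a\<^sup>2 + b\<^sup>2"
            using sum_squares_bound[of "\<bar>a\<bar>" "\<bar>b\<bar>"] by (simp add: mult.assoc)
          moreover have "0 \<le> \<bar>a\<bar> * \<bar>b\<bar>" by simp
          ultimately show ?thesis unfolding abs_mult by linarith
        qed
        then show "norm (?F (history n \<omega>)) \<le> norm ((h n i (history n \<omega>))\<^sup>2 + (h n k (history n \<omega>))\<^sup>2)"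
          by simp
      qed
    qed
    have iG: "integrable M (\<lambda>\<omega>. ?G (cov_vec n eps \<omega>))"
      using integrable_mult_indep_vars[OF eps_indep eps_moment(2), of i k] eps_moment(1)[of i] ik
      by (cases "i = k") (auto simp: power2_eq_square)
    have eq: "?g i \<omega> * ?g k \<omega> = ?F (history n \<omega>) * ?G (cov_vec n eps \<omega>)" for \<omega>
      using ik by (simp only: lessThan_iff restrict_apply if_True mult_ac)
    show "integrable M (\<lambda>\<omega>. ?g i \<omega> * ?g k \<omega>)"
      unfolding eq by (rule indep_elements_integrable[where F = ?F and G = ?G, OF T_x_eps F iF G iG])
    show "expectation (\<lambda>\<omega>. ?g i \<omega> * ?g k \<omega>) =
      expectation (\<lambda>\<omega>. h n i (history n \<omega>) * h n k (history n \<omega>)) *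
      expectation (\<lambda>\<omega>. eps i \<omega> * eps k \<omega>)"
      unfolding eq indep_elements_expectation[where F = ?F and G = ?G, OF T_x_eps F iF G iG]
      using ik by simp
  qed
  have orth: "expectation (\<lambda>\<omega>. ?g i \<omega> * ?g k \<omega>) = 0" if "i < n" "k < n" "i \<noteq> k" for i k
    using *(2)[OF that(1,2)] expectation_mult_indep_vars[OF eps_indep eps_moment(2) that(3)]
    by (simp add: eps_moment(3))
  have sq_le: "expectation (\<lambda>\<omega>. (?g i \<omega>)\<^sup>2) \<le> B * v" if "i < n" for i
    using *(2)[OF that that] le[OF that] v_pos eps_moment(4)[of i]
    by (simp add: power2_eq_square)
  show "integrable M (\<lambda>\<omega>. ((\<Sum>i<n. ?g i \<omega>) / sqrt (real n))\<^sup>2)"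
    unfolding power_divide by (intro integrable_divide_zero integrable_sum_orthogonal[OF *(1) orth])
  have "expectation (\<lambda>\<omega>. ((\<Sum>i<n. ?g i \<omega>) / sqrt (real n))\<^sup>2) =
      expectation (\<lambda>\<omega>. (\<Sum>i<n. ?g i \<omega>)\<^sup>2) / real n"
    by (simp add: power_divide)
  also have "\<dots> = (\<Sum>i<n. expectation (\<lambda>\<omega>. (?g i \<omega>)\<^sup>2)) / real n"
    by (subst expectation_sum_orthogonal[OF *(1) orth]) auto
  also have "\<dots> \<le> (\<Sum>i<n. B * v) / real n"
    by (intro divide_right_mono sum_mono) (use sq_le in auto)
  also have "\<dots> \<le> B * v"
    using B v_pos by (cases "n = 0") auto
  finally show "expectation (\<lambda>\<omega>. ((\<Sum>i<n. ?g i \<omega>) / sqrt (real n))\<^sup>2) \<le> B * v" .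
qed

lemma bounded_eps: "bounded_in_prob M (\<lambda>n \<omega>. (\<Sum>i<n. eps i \<omega>) / sqrt (real n))"
  using bounded_history_eps[of "\<lambda>_ _ _. 1" 1] by (simp add: prob_space)

lemma bounded_x_eps:
  assumes j: "j < d"
  shows "bounded_in_prob M (\<lambda>n \<omega>. (\<Sum>i<n. x i j \<omega> * eps i \<omega>) / sqrt (real n))"
proof -
  let ?h = "\<lambda>(n :: nat) (i :: nat) a :: (nat \<Rightarrow> real) \<times> (nat \<times> nat \<Rightarrow> real). snd a (i, j)"
  have F: "(\<lambda>a. a j) \<in> borel_measurable (vec_space d)"
    using j by (intro measurable_component_singleton) auto
  have x: "integrable M (\<lambda>\<omega>. (x i j \<omega>)\<^sup>2)" "expectation (\<lambda>\<omega>. (x i j \<omega>)\<^sup>2) = variance (X j)" for i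
    using x_fun_int[OF F, of "\<lambda>y. y\<^sup>2" i] x_fun_mean[OF F, of "\<lambda>y. y\<^sup>2" i] X_sq[OF j] X_var_eq[OF j] j
    by auto
  have "bounded_in_prob M (\<lambda>n \<omega>. (\<Sum>i<n. ?h n i (history n \<omega>) * eps i \<omega>) / sqrt (real n))"
  proof (rule bounded_history_eps[where B = "variance (X j)"])
    show "?h n i \<in> borel_measurable (history_space n)" if "i < n" for n i
      using that j by (intro measurable_compose[OF measurable_snd measurable_component_singleton]) auto
    show "variance (X j) \<ge> 0" using X_var[OF j] by simp
  qed (use x j in simp_all)
  then show ?thesis using j by simp
qed

abbreviation W :: "nat \<Rightarrow> 'w \<Rightarrow> real" where
  "W n \<omega> \<equiv> (\<Sum>i<n. D n i \<omega> * eps i \<omega>) / sqrt (real n)"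

lemma D_history: "i < n \<Longrightarrow> (\<lambda>a. 2 * fst a i - 1) \<in> borel_measurable (history_space n)"
  by (intro borel_measurable_diff borel_measurable_times borel_measurable_const
      measurable_compose[OF measurable_fst measurable_component_singleton]) auto

lemma D_sign: "i < n \<Longrightarrow> \<omega> \<in> space M \<Longrightarrow> D n i \<omega> \<in> {-1, 1}"
  using T_01[of i n \<omega>] by auto

lemma char_W_tendsto:
  "(\<lambda>n. char (distr M borel (W n)) t) \<longlonglongrightarrow> exp (- (t\<^sup>2 * v) / 2)"
proof -
  have "(\<lambda>n. char (distr M borel (\<lambda>\<omega>. (\<Sum>i<n. (2 * fst (history n \<omega>) i - 1) * eps i \<omega>) / sqrt (real n))) t)
    \<longlonglongrightarrow> exp (- (t\<^sup>2 * v) / 2)"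
    by (rule char_signed_sum_tendsto[OF eps_indep eps_law eps_sq eps_mean eps_var _ T_x_eps,
          where D = "\<lambda>n i a. 2 * fst a i - 1"])
       (use v_pos D_history D_sign in auto)
  then show ?thesis by simp
qed

lemma bounded_W: "bounded_in_prob M W"
proof -
  let ?h = "\<lambda>(n :: nat) i a :: (nat \<Rightarrow> real) \<times> (nat \<times> nat \<Rightarrow> real). 2 * fst a i - 1"
  have one: "(?h n i (history n \<omega>))\<^sup>2 = 1" if "i < n" "\<omega> \<in> space M" for n i \<omega>
    using D_sign[OF that] that(1) by auto
  have "bounded_in_prob M (\<lambda>n \<omega>. (\<Sum>i<n. ?h n i (history n \<omega>) * eps i \<omega>) / sqrt (real n))"
  proof (rule bounded_history_eps[where B = 1])
    fix n i :: nat assume i: "i < n"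
    show "?h n i \<in> borel_measurable (history_space n)" by (rule D_history[OF i])
    show "integrable M (\<lambda>\<omega>. (?h n i (history n \<omega>))\<^sup>2)"
      by (subst Bochner_Integration.integrable_cong[OF refl one[OF i]]) auto
    show "expectation (\<lambda>\<omega>. (?h n i (history n \<omega>))\<^sup>2) \<le> 1"
      by (subst Bochner_Integration.integral_cong[OF refl one[OF i]]) (auto simp: prob_space)
  qed simp
  then show ?thesis by simp
qed

lemma conv_prob_eps_sq: "conv_prob M (\<lambda>n \<omega>. (\<Sum>i<n. (eps i \<omega>)\<^sup>2) / real n) v"
proof -
  have "indep_vars (\<lambda>_. borel) (\<lambda>i \<omega>. (eps i \<omega>)\<^sup>2) UNIV"
    by (rule indep_vars_compose2[OF eps_indep]) simp
  moreover have "distr M borel (\<lambda>\<omega>. (eps i \<omega>)\<^sup>2) = distr M borel (\<lambda>\<omega>. (eps 0 \<omega>)\<^sup>2)" for i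
  proof -
    have *: "distr M borel (\<lambda>\<omega>. (eps j \<omega>)\<^sup>2) = distr (distr M borel (eps j)) borel (\<lambda>y. y\<^sup>2)" for j
      by (subst distr_distr) (auto simp: comp_def)
    show ?thesis unfolding * eps_law[of i] ..
  qed
  ultimately have "conv_prob M (\<lambda>n \<omega>. (\<Sum>i<n. (eps i \<omega>)\<^sup>2) / real n) (expectation (\<lambda>\<omega>. (eps 0 \<omega>)\<^sup>2))"
    by (rule weak_law_of_large_numbers) (rule eps_moment)
  then show ?thesis by (simp add: eps_moment(4))
qed

end

lemma outcome_eq_regression:
  assumes "p \<le> d"
  shows "outcome mu1 mu2 d beta t x e i =
    (\<Sum>k<p + 2. regressor t x i k *
      vec (p + 2) (\<lambda>k. if k = 0 then mu1 else if k = 1 then mu2 else beta (k - 2)) $ k) +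
    ((\<Sum>j\<in>{p..<d}. beta j * x i j) + e i)"
proof -
  have "(\<Sum>k<p + 2. regressor t x i k *
      vec (p + 2) (\<lambda>k. if k = 0 then mu1 else if k = 1 then mu2 else beta (k - 2)) $ k) =
    (\<Sum>k<Suc (Suc p). regressor t x i k * (if k = 0 then mu1 else if k = 1 then mu2 else beta (k - 2)))"
    by (intro sum.cong) auto
  also have "\<dots> = t i * mu1 + (1 - t i) * mu2 + (\<Sum>j<p. beta j * x i j)"
    by (simp only: sum.lessThan_Suc_shift) (simp add: regressor_def mult.commute add.assoc)
  moreover have "(\<Sum>j<d. beta j * x i j) = (\<Sum>j<p. beta j * x i j) + (\<Sum>j\<in>{p..<d}. beta j * x i j)"
    using sum.atLeastLessThan_concat[of 0 p d "\<lambda>j. beta j * x i j"] assms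
    by (simp add: lessThan_atLeast0)
  ultimately show ?thesis by (simp add: outcome_def mult.commute)
qed

lemma (in prob_space) conv_prob_cong:
  assumes "conv_prob M X c" and eq: "\<And>n \<omega>. \<omega> \<in> space M \<Longrightarrow> X n \<omega> = Y n \<omega>"
  shows "conv_prob M Y c"
proof -
  have "Y n \<in> borel_measurable M" for n
    by (rule measurable_cong[THEN iffD1, OF eq conv_prob_measurable[OF assms(1)]])
  then show ?thesis
    using conv_prob_cong_in_prob[OF assms(1), of Y "\<lambda>_. {}"] eq by auto
qed

lemma (in prob_space) conv_prob_div_n:
  assumes "\<And>n. X n \<in> borel_measurable M" "bounded_in_prob M (\<lambda>n \<omega>. X n \<omega> / sqrt (real n))"
  shows "conv_prob M (\<lambda>n \<omega>. X n \<omega> / real n) 0"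
proof -
  have "conv_prob M (\<lambda>n \<omega>. X n \<omega> / sqrt (real n) / sqrt (real n)) 0"
    by (rule conv_prob_bounded_div_sqrt[OF _ assms(2)]) (use assms(1) in auto)
  then show ?thesis by simp
qed

context balanced_linear_model
begin

subsection \<open>The Gram matrix and the score\<close>

abbreviation reg :: "nat \<Rightarrow> 'w \<Rightarrow> nat \<Rightarrow> nat \<Rightarrow> real" where
  "reg n \<omega> \<equiv> regressor (\<lambda>i. T n i \<omega>) (\<lambda>i j. x i j \<omega>)"

abbreviation gram :: "nat \<Rightarrow> 'w \<Rightarrow> real mat" where
  "gram n \<omega> \<equiv> gram_mat n p (\<lambda>i. T n i \<omega>) (\<lambda>i j. x i j \<omega>)"

definition err :: "nat \<Rightarrow> 'w \<Rightarrow> real" where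
  "err i \<omega> = (\<Sum>j\<in>{p..<d}. beta j * x i j \<omega>) + eps i \<omega>"

text \<open>The square of sigma_w, the limit of the mean squared error of the working model.\<close>

definition err_var :: real where
  "err_var = v + (\<Sum>j\<in>{p..<d}. (beta j)\<^sup>2 * variance (X j))"

lemma err_var_pos: "err_var > 0"
  unfolding err_var_def using v_pos X_var
  by (intro add_pos_nonneg sum_nonneg mult_nonneg_nonneg) (auto intro: less_imp_le)

lemma reg_rv: "i < n \<Longrightarrow> k < p + 2 \<Longrightarrow> (\<lambda>\<omega>. reg n \<omega> i k) \<in> borel_measurable M"
  using p_le by (cases "k = 0"; cases "k = 1") (auto simp: regressor_def intro!: borel_measurable_diff T_rv x_rv)

lemma err_rv [measurable]: "err i \<in> borel_measurable M"
  unfolding err_def by measurable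

text \<open>The sign of D in the two treatment regressors: T is (1 + D) / 2 and 1 - T is (1 - D) /
  2, so both columns can be treated at once.\<close>

definition sg :: "nat \<Rightarrow> real" where "sg k = (if k = 0 then 1 else - 1)"

lemma reg_treatment: "k < 2 \<Longrightarrow> reg n \<omega> i k = 1 / 2 + sg k / 2 * D n i \<omega>"
  by (auto simp: regressor_def sg_def less_2_cases_iff field_simps)

lemma reg_covariate: "reg n \<omega> i (k + 2) = x i k \<omega>"
  by (simp add: regressor_def)

lemma conv_prob_x: "j < d \<Longrightarrow> conv_prob M (\<lambda>n \<omega>. (\<Sum>i<n. x i j \<omega>) / real n) 0"
  by (rule conv_prob_div_n[OF _ bounded_x]) auto

text \<open>The gain from covariate balance: the sum stays bounded in probability instead of growing
  like sqrt n.\<close>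

lemma conv_prob_D_x_sqrt:
  "j < d \<Longrightarrow> conv_prob M (\<lambda>n \<omega>. (\<Sum>i<n. D n i \<omega> * x i j \<omega>) / sqrt (real n)) 0"
  by (rule conv_prob_bounded_div_sqrt[OF _ bounded_D_x]) auto

lemma conv_prob_D_x:
  "j < d \<Longrightarrow> conv_prob M (\<lambda>n \<omega>. (\<Sum>i<n. D n i \<omega> * x i j \<omega>) / real n) 0"
  by (rule conv_prob_div_n[OF _ conv_prob_imp_bounded[OF conv_prob_D_x_sqrt]]) auto

lemma conv_prob_D: "conv_prob M (\<lambda>n \<omega>. (\<Sum>i<n. D n i \<omega>) / real n) 0"
proof (rule conv_prob_div_n)
  have "bounded_in_prob M (\<lambda>n \<omega>. \<Sum>i<n. D n i \<omega>)"
    by (rule bounded_in_prob_mono[where Y = "\<lambda>_ _. 1"])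
       (use T_balanced conv_prob_imp_bounded[OF conv_prob_const[of 1]] in auto)
  from conv_prob_bounded_div_sqrt[OF _ this]
  show "bounded_in_prob M (\<lambda>n \<omega>. (\<Sum>i<n. D n i \<omega>) / sqrt (real n))"
    by (intro conv_prob_imp_bounded) auto
qed measurable

definition gram_limit :: "real mat" where
  "gram_limit = mat (p + 2) (p + 2) (\<lambda>(k, l).
     if k = l then (if k < 2 then 1 / 2 else variance (X (k - 2))) else 0)"

definition gram_limit_inv :: "real mat" where
  "gram_limit_inv = mat (p + 2) (p + 2) (\<lambda>(k, l).
     if k = l then (if k < 2 then 2 else 1 / variance (X (k - 2))) else 0)"

lemma gram_limit_carrier: "gram_limit \<in> carrier_mat (p + 2) (p + 2)"
  by (simp add: gram_limit_def)

lemma gram_limit_mult_inv: "gram_limit * gram_limit_inv = 1\<^sub>m (p + 2)"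
proof (rule eq_matI)
  fix k l assume "k < dim_row (1\<^sub>m (p + 2))" "l < dim_col (1\<^sub>m (p + 2))"
  then have kl: "k < p + 2" "l < p + 2" by auto
  have var: "variance (X (k - 2)) \<noteq> 0" if "\<not> k < 2"
    using X_var[of "k - 2"] kl that p_le by force
  have "(gram_limit * gram_limit_inv) $$ (k, l) =
      (\<Sum>m<p + 2. gram_limit $$ (k, m) * gram_limit_inv $$ (m, l))"
    using kl by (simp add: gram_limit_def gram_limit_inv_def scalar_prod_def lessThan_atLeast0
        del: sum.op_ivl_Suc)
  also have "\<dots> = (\<Sum>m<p + 2. if m = k then gram_limit $$ (k, k) * gram_limit_inv $$ (k, l) else 0)"
    using kl by (intro sum.cong refl) (auto simp: gram_limit_def)
  also have "\<dots> = gram_limit $$ (k, k) * gram_limit_inv $$ (k, l)"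
    using kl by (subst sum.delta) auto
  also have "\<dots> = 1\<^sub>m (p + 2) $$ (k, l)"
    using kl var by (cases "k = l") (auto simp: gram_limit_def gram_limit_inv_def)
  finally show "(gram_limit * gram_limit_inv) $$ (k, l) = 1\<^sub>m (p + 2) $$ (k, l)" .
qed (simp_all add: gram_limit_def gram_limit_inv_def)

lemma mat_inv_gram_limit: "mat_inv gram_limit = gram_limit_inv"
  by (rule mat_inv_unique[OF gram_limit_carrier _ gram_limit_mult_inv])
     (simp add: gram_limit_inv_def)

lemma det_gram_limit: "Determinant.det gram_limit \<noteq> 0"
proof
  assume "Determinant.det gram_limit = 0"
  moreover have "Determinant.det gram_limit * Determinant.det gram_limit_inv = 1"
    using Determinant.det_mult[OF gram_limit_carrier, of gram_limit_inv] gram_limit_mult_inv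
    by (simp add: gram_limit_inv_def)
  ultimately show False by simp
qed

lemma conv_prob_gram:
  assumes "k < p + 2" "l < p + 2"
  shows "conv_prob M (\<lambda>n \<omega>. ((1 / real n) \<cdot>\<^sub>m gram n \<omega>) $$ (k, l)) (gram_limit $$ (k, l))"
  using assms
proof (induction k l rule: linorder_wlog)
  case (sym k l)
  have "(\<lambda>n \<omega>. ((1 / real n) \<cdot>\<^sub>m gram n \<omega>) $$ (l, k)) = (\<lambda>n \<omega>. ((1 / real n) \<cdot>\<^sub>m gram n \<omega>) $$ (k, l))"
    using sym.prems by (simp add: gram_mat_def mult.commute)
  moreover have "gram_limit $$ (l, k) = gram_limit $$ (k, l)"
    using sym.prems by (simp add: gram_limit_def)
  ultimately show ?case using sym by metis
next
  case (le k l)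
  have entry: "((1 / real n) \<cdot>\<^sub>m gram n \<omega>) $$ (k, l) = (\<Sum>i<n. reg n \<omega> i k * reg n \<omega> i l) / real n"
    for n \<omega> using le.prems by (simp add: gram_mat_def)
  consider "l < 2" "k = l" | "l < 2" "k < l" | j where "k < 2" "l = j + 2" "j < d"
    | j m where "k = j + 2" "l = m + 2" "j < d" "m < d"
  proof -
    have "l = (l - 2) + 2 \<and> l - 2 < d" if "\<not> l < 2" using that le.prems p_le by auto
    moreover have "k = (k - 2) + 2 \<and> k - 2 < d" if "\<not> k < 2" using that le.prems p_le by auto
    ultimately show ?thesis using that le.hyps by (metis le_neq_implies_less)
  qed
  then show ?case
  proof cases
    case 1
    \<comment> \<open>Kept as a sequence and not simplified to 1/2: at n = 0 the quotient is 0 by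
      convention, and the identity below is required for every n.\<close>
    have half: "(\<lambda>n. real n / 2 / real n) \<longlonglongrightarrow> 1 / 2"
      by real_asymp
    have "conv_prob M (\<lambda>n \<omega>. real n / 2 / real n + sg k / 2 * ((\<Sum>i<n. D n i \<omega>) / real n)) (1 / 2 + sg k / 2 * 0)"
      by (intro conv_prob_add conv_prob_tendsto[OF half] conv_prob_cmult conv_prob_D)
    then have "conv_prob M (\<lambda>n \<omega>. ((1 / real n) \<cdot>\<^sub>m gram n \<omega>) $$ (k, l)) (1 / 2 + sg k / 2 * 0)"
    proof (rule conv_prob_cong)
      fix n \<omega> assume w: "\<omega> \<in> space M"
      \<comment> \<open>Both treatment regressors are 0/1 indicators and equal their own
        squares.\<close>
      have "(\<Sum>i<n. reg n \<omega> i k * reg n \<omega> i l) = (\<Sum>i<n. 1 / 2 + sg k / 2 * D n i \<omega>)"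
      proof (intro sum.cong refl)
        fix i assume "i \<in> {..<n}"
        then have "D n i \<omega> \<in> {-1, 1}" using D_sign w by auto
        moreover have "(1 / 2 + s / 2 * y) * (1 / 2 + s / 2 * y) = 1 / 2 + s / 2 * y"
          if "y \<in> {-1, 1}" "s \<in> {-1, 1}" for s y :: real
          using that by auto
        ultimately show "reg n \<omega> i k * reg n \<omega> i l = 1 / 2 + sg k / 2 * D n i \<omega>"
          using 1 by (simp only: reg_treatment) (simp add: sg_def)
      qed
      also have "\<dots> = real n / 2 + sg k / 2 * (\<Sum>i<n. D n i \<omega>)"
        unfolding sum.distrib sum_distrib_left by simp
      finally show "real n / 2 / real n + sg k / 2 * ((\<Sum>i<n. D n i \<omega>) / real n) =
          ((1 / real n) \<cdot>\<^sub>m gram n \<omega>) $$ (k, l)"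
        unfolding entry by (simp only: add_divide_distrib times_divide_eq_right)
    qed
    then show ?thesis using 1 le.prems by (simp add: gram_limit_def)
  next
    case 2
    then have kl: "k = 0" "l = 1" by auto
    have "conv_prob M (\<lambda>n \<omega>. ((1 / real n) \<cdot>\<^sub>m gram n \<omega>) $$ (k, l)) 0"
    proof (rule conv_prob_cong[OF conv_prob_const])
      fix n \<omega> assume w: "\<omega> \<in> space M"
      \<comment> \<open>No unit receives both treatments, so T (1 - T) = 0.\<close>
      have "(\<Sum>i<n. reg n \<omega> i k * reg n \<omega> i l) = 0"
        by (rule sum.neutral) (use T_01 w kl in \<open>force simp: regressor_def\<close>)
      then show "0 = ((1 / real n) \<cdot>\<^sub>m gram n \<omega>) $$ (k, l)" unfolding entry by simp
    qed
    then show ?thesis using kl by (simp add: gram_limit_def)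
  next
    case 3
    have "conv_prob M (\<lambda>n \<omega>. 1 / 2 * ((\<Sum>i<n. x i j \<omega>) / real n) +
        sg k / 2 * ((\<Sum>i<n. D n i \<omega> * x i j \<omega>) / real n)) (1 / 2 * 0 + sg k / 2 * 0)"
      using 3 by (intro conv_prob_add conv_prob_cmult conv_prob_x conv_prob_D_x)
    then have "conv_prob M (\<lambda>n \<omega>. ((1 / real n) \<cdot>\<^sub>m gram n \<omega>) $$ (k, l)) (1 / 2 * 0 + sg k / 2 * 0)"
    proof (rule conv_prob_cong)
      fix n \<omega>
      have "(\<Sum>i<n. reg n \<omega> i k * reg n \<omega> i l) =
          (\<Sum>i<n. 1 / 2 * x i j \<omega> + sg k / 2 * (D n i \<omega> * x i j \<omega>))"
        using 3 by (intro sum.cong refl) (simp only: reg_treatment reg_covariate distrib_right mult.assoc)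
      then show "1 / 2 * ((\<Sum>i<n. x i j \<omega>) / real n) +
          sg k / 2 * ((\<Sum>i<n. D n i \<omega> * x i j \<omega>) / real n) = ((1 / real n) \<cdot>\<^sub>m gram n \<omega>) $$ (k, l)"
        unfolding entry by (simp only: sum.distrib sum_distrib_left add_divide_distrib times_divide_eq_right)
    qed
    then show ?thesis using 3 le.prems by (simp add: gram_limit_def)
  next
    case 4
    then have "gram_limit $$ (k, l) = (if j = m then variance (X j) else 0)"
      using le.prems by (simp add: gram_limit_def)
    then show ?thesis
      unfolding entry unfolding 4(1,2) reg_covariate by (simp only: conv_prob_x_mult[OF 4(3,4)])
  qed
qed

lemma conv_prob_mat_inv_gram:
  assumes "k < p + 2" "l < p + 2"
  shows "conv_prob M (\<lambda>n \<omega>. mat_inv ((1 / real n) \<cdot>\<^sub>m gram n \<omega>) $$ (k, l)) (gram_limit_inv $$ (k, l))"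
  unfolding mat_inv_gram_limit[symmetric]
  by (rule conv_prob_mat_inv[OF _ gram_limit_carrier conv_prob_gram det_gram_limit assms])
     (intro smult_carrier_mat gram_mat_carrier)

section \<open>The score of the working model and the sums of its errors\<close>

abbreviation scaled_score :: "nat \<Rightarrow> nat \<Rightarrow> 'w \<Rightarrow> real" where
  "scaled_score k n \<omega> \<equiv>
    score n p (\<lambda>i. T n i \<omega>) (\<lambda>i j. x i j \<omega>) (\<lambda>i. err i \<omega>) $ k / sqrt (real n)"

lemma score_index:
  "k < p + 2 \<Longrightarrow> score n p t y z $ k = (\<Sum>i<n. regressor t y i k * z i)"
  by (simp add: score_def)

lemma scaled_score_rv: "k < p + 2 \<Longrightarrow> scaled_score k n \<in> borel_measurable M"
  by (simp only: score_index)
     (intro borel_measurable_divide borel_measurable_sum borel_measurable_times reg_rv err_rv; simp)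

text \<open>Separates the omitted covariates from the noise for arbitrary weights; applied with
  weights D, 1 and an included covariate.\<close>

lemma sum_err:
  "(\<Sum>i<n. c i * err i \<omega>) / s =
    (\<Sum>j\<in>{p..<d}. beta j * ((\<Sum>i<n. c i * x i j \<omega>) / s)) + (\<Sum>i<n. c i * eps i \<omega>) / s"
proof -
  have "(\<Sum>i<n. c i * err i \<omega>) =
      (\<Sum>i<n. \<Sum>j\<in>{p..<d}. beta j * (c i * x i j \<omega>)) + (\<Sum>i<n. c i * eps i \<omega>)"
    unfolding err_def distrib_left sum.distrib sum_distrib_left by (simp only: mult.left_commute)
  also have "(\<Sum>i<n. \<Sum>j\<in>{p..<d}. beta j * (c i * x i j \<omega>)) =
      (\<Sum>j\<in>{p..<d}. beta j * (\<Sum>i<n. c i * x i j \<omega>))"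
    unfolding sum_distrib_left by (rule sum.swap)
  finally show ?thesis
    by (simp only: add_divide_distrib sum_divide_distrib[of _ "{p..<d}"] times_divide_eq_right)
qed

text \<open>The difference consists of finitely many balanced sums of omitted covariates divided by
  sqrt n, each of which vanishes in the limit.\<close>

lemma conv_prob_D_err:
  "conv_prob M (\<lambda>n \<omega>. (\<Sum>i<n. D n i \<omega> * err i \<omega>) / sqrt (real n) - W n \<omega>) 0"
proof -
  have "conv_prob M (\<lambda>n \<omega>. \<Sum>j\<in>{p..<d}. beta j * ((\<Sum>i<n. D n i \<omega> * x i j \<omega>) / sqrt (real n)))
      (\<Sum>j\<in>{p..<d}. beta j * 0)"
    by (intro conv_prob_sum conv_prob_cmult conv_prob_D_x_sqrt) auto
  then show ?thesis unfolding sum_err by simp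
qed

lemma bounded_D_err: "bounded_in_prob M (\<lambda>n \<omega>. (\<Sum>i<n. D n i \<omega> * err i \<omega>) / sqrt (real n))"
proof -
  have "bounded_in_prob M
      (\<lambda>n \<omega>. ((\<Sum>i<n. D n i \<omega> * err i \<omega>) / sqrt (real n) - W n \<omega>) + W n \<omega>)"
    by (rule bounded_in_prob_add[OF _ _ conv_prob_imp_bounded[OF conv_prob_D_err] bounded_W]) auto
  then show ?thesis by simp
qed

text \<open>Here the omitted covariates are not balanced away and boundedness is the most that is
  claimed. It suffices because this sum enters both treatment components of the score
  equally.\<close>

lemma bounded_err: "bounded_in_prob M (\<lambda>n \<omega>. (\<Sum>i<n. err i \<omega>) / sqrt (real n))"
proof -
  have "bounded_in_prob M (\<lambda>n \<omega>.
      (\<Sum>j\<in>{p..<d}. beta j * ((\<Sum>i<n. x i j \<omega>) / sqrt (real n))) + (\<Sum>i<n. eps i \<omega>) / sqrt (real n))"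
    by (intro bounded_in_prob_add bounded_in_prob_sum bounded_in_prob_cmult bounded_x bounded_eps) auto
  then show ?thesis using sum_err[of "\<lambda>_. 1"] by simp
qed

lemma score_treatment:
  assumes "k < 2"
  shows "scaled_score k n \<omega> = 1 / 2 * ((\<Sum>i<n. err i \<omega>) / sqrt (real n)) +
    sg k / 2 * ((\<Sum>i<n. D n i \<omega> * err i \<omega>) / sqrt (real n))"
proof -
  have k: "k < p + 2" using assms by simp
  show ?thesis
    by (simp only: score_index[OF k] reg_treatment[OF assms] distrib_right mult.assoc sum.distrib
        sum_distrib_left[symmetric] add_divide_distrib times_divide_eq_right)
qed

lemma bounded_scaled_score:
  assumes k: "k < p + 2"
  shows "bounded_in_prob M (scaled_score k)"
proof (cases "k < 2")
  case True
  have "bounded_in_prob M (\<lambda>n \<omega>. 1 / 2 * ((\<Sum>i<n. err i \<omega>) / sqrt (real n)) +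
      sg k / 2 * ((\<Sum>i<n. D n i \<omega> * err i \<omega>) / sqrt (real n)))"
    by (intro bounded_in_prob_add bounded_in_prob_cmult bounded_err bounded_D_err) auto
  then show ?thesis unfolding score_treatment[OF True] .
next
  case False
  define j where "j = k - 2"
  have j: "k = j + 2" "j < p" "j < d" using False k p_le by (auto simp: j_def)
  have "bounded_in_prob M (\<lambda>n \<omega>.
      (\<Sum>l\<in>{p..<d}. beta l * ((\<Sum>i<n. x i j \<omega> * x i l \<omega>) / sqrt (real n))) +
      (\<Sum>i<n. x i j \<omega> * eps i \<omega>) / sqrt (real n))"
    using j
    by (intro bounded_in_prob_add bounded_in_prob_sum bounded_in_prob_cmult bounded_x_mult bounded_x_eps) auto
  then show ?thesis
    unfolding score_index[OF k] unfolding j(1) reg_covariate sum_err .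
qed

text \<open>In the expanded square, products of different omitted covariates and products with the
  noise average out to 0; what remains is the variance of each omitted covariate with weight
  beta_j^2, and the noise variance.\<close>

lemma conv_prob_err_sq: "conv_prob M (\<lambda>n \<omega>. (\<Sum>i<n. (err i \<omega>)\<^sup>2) / real n) err_var"
proof -
  let ?J = "{p..<d}"
  have "conv_prob M (\<lambda>n \<omega>.
      (\<Sum>j\<in>?J. \<Sum>l\<in>?J. beta j * (beta l * ((\<Sum>i<n. x i j \<omega> * x i l \<omega>) / real n))) +
      2 * (\<Sum>j\<in>?J. beta j * ((\<Sum>i<n. x i j \<omega> * eps i \<omega>) / real n)) +
      (\<Sum>i<n. (eps i \<omega>)\<^sup>2) / real n)
    ((\<Sum>j\<in>?J. \<Sum>l\<in>?J. beta j * (beta l * (if j = l then variance (X j) else 0))) +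
      2 * (\<Sum>j\<in>?J. beta j * 0) + v)"
    by (intro conv_prob_add conv_prob_sum conv_prob_cmult conv_prob_x_mult conv_prob_eps_sq
        conv_prob_div_n[OF _ bounded_x_eps]) auto
  also have "(\<Sum>j\<in>?J. \<Sum>l\<in>?J. beta j * (beta l * (if j = l then variance (X j) else 0))) =
      (\<Sum>j\<in>?J. (beta j)\<^sup>2 * variance (X j))"
  proof (intro sum.cong refl)
    fix j assume j: "j \<in> ?J"
    have "(\<Sum>l\<in>?J. beta j * (beta l * (if j = l then variance (X j) else 0))) =
        (\<Sum>l\<in>?J. if j = l then (beta j)\<^sup>2 * variance (X j) else 0)"
      by (intro sum.cong refl) (auto simp: power2_eq_square)
    then show "(\<Sum>l\<in>?J. beta j * (beta l * (if j = l then variance (X j) else 0))) =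
        (beta j)\<^sup>2 * variance (X j)"
      using j by simp
  qed
  finally have "conv_prob M (\<lambda>n \<omega>.
      (\<Sum>j\<in>?J. \<Sum>l\<in>?J. beta j * (beta l * ((\<Sum>i<n. x i j \<omega> * x i l \<omega>) / real n))) +
      2 * (\<Sum>j\<in>?J. beta j * ((\<Sum>i<n. x i j \<omega> * eps i \<omega>) / real n)) +
      (\<Sum>i<n. (eps i \<omega>)\<^sup>2) / real n) err_var"
    by (simp add: err_var_def add.commute)
  then show ?thesis
  proof (rule conv_prob_cong)
    fix n \<omega>
    let ?u = "\<lambda>i. \<Sum>j\<in>?J. beta j * x i j \<omega>"
    have "(\<Sum>i<n. (err i \<omega>)\<^sup>2) =
        (\<Sum>i<n. ?u i * ?u i) + 2 * (\<Sum>i<n. ?u i * eps i \<omega>) + (\<Sum>i<n. (eps i \<omega>)\<^sup>2)"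
    proof -
      have "(err i \<omega>)\<^sup>2 = ?u i * ?u i + 2 * (?u i * eps i \<omega>) + (eps i \<omega>)\<^sup>2" for i
        unfolding err_def by (simp only: power2_eq_square) (simp only: algebra_simps mult_2)
      then show ?thesis
        by (simp only: sum.distrib sum_distrib_left[symmetric])
    qed
    also have "(\<Sum>i<n. ?u i * ?u i) = (\<Sum>j\<in>?J. \<Sum>l\<in>?J. beta j * (beta l * (\<Sum>i<n. x i j \<omega> * x i l \<omega>)))"
    proof -
      have "(\<Sum>i<n. ?u i * ?u i) = (\<Sum>i<n. \<Sum>j\<in>?J. \<Sum>l\<in>?J. beta j * (beta l * (x i j \<omega> * x i l \<omega>)))"
        unfolding sum_product by (simp only: mult_ac)
      also have "\<dots> = (\<Sum>j\<in>?J. \<Sum>i<n. \<Sum>l\<in>?J. beta j * (beta l * (x i j \<omega> * x i l \<omega>)))"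
        by (rule sum.swap)
      also have "\<dots> = (\<Sum>j\<in>?J. \<Sum>l\<in>?J. \<Sum>i<n. beta j * (beta l * (x i j \<omega> * x i l \<omega>)))"
        by (rule sum.cong[OF refl], rule sum.swap)
      finally show ?thesis by (simp only: sum_distrib_left)
    qed
    also have "(\<Sum>i<n. ?u i * eps i \<omega>) = (\<Sum>j\<in>?J. beta j * (\<Sum>i<n. x i j \<omega> * eps i \<omega>))"
      unfolding sum_distrib_left sum_distrib_right mult.assoc by (rule sum.swap)
    finally show "(\<Sum>j\<in>?J. \<Sum>l\<in>?J. beta j * (beta l * ((\<Sum>i<n. x i j \<omega> * x i l \<omega>) / real n))) +
      2 * (\<Sum>j\<in>?J. beta j * ((\<Sum>i<n. x i j \<omega> * eps i \<omega>) / real n)) +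
      (\<Sum>i<n. (eps i \<omega>)\<^sup>2) / real n = (\<Sum>i<n. (err i \<omega>)\<^sup>2) / real n"
      by (simp only: add_divide_distrib sum_divide_distrib[of _ "{p..<d}"] times_divide_eq_right[symmetric])
  qed
qed

subsection \<open>The test statistic\<close>

definition stat :: "real \<Rightarrow> real \<Rightarrow> nat \<Rightarrow> 'w \<Rightarrow> real" where
  "stat mu1 mu2 n \<omega> = test_stat n p (\<lambda>i. T n i \<omega>) (\<lambda>i j. x i j \<omega>)
     (outcome mu1 mu2 d beta (\<lambda>i. T n i \<omega>) (\<lambda>i j. x i j \<omega>) (\<lambda>i. eps i \<omega>))"

lemma gram_rv:
  assumes "k < p + 2" "l < p + 2"
  shows "(\<lambda>\<omega>. gram n \<omega> $$ (k, l)) \<in> borel_measurable M"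
proof -
  have "(\<lambda>\<omega>. \<Sum>i<n. reg n \<omega> i k * reg n \<omega> i l) \<in> borel_measurable M"
    by (intro borel_measurable_sum borel_measurable_times reg_rv) (use assms in auto)
  then show ?thesis using assms by (simp add: gram_mat_def)
qed

lemma mat_inv_gram_rv:
  assumes "k < p + 2" "l < p + 2"
  shows "(\<lambda>\<omega>. mat_inv (gram n \<omega>) $$ (k, l)) \<in> borel_measurable M"
  by (rule borel_measurable_mat_inv[OF gram_mat_carrier gram_rv assms])

text \<open>Measurability is needed on the whole space, singular outcomes included, so it is read
  off from the entrywise formulas for the estimator and the residual variance, not from the formula
  valid for nonsingular Gram matrices.\<close>

lemma stat_rv [measurable]: "stat mu1 mu2 n \<in> borel_measurable M"
proof -
  define y where "y i \<omega> = outcome mu1 mu2 d beta (\<lambda>i. T n i \<omega>) (\<lambda>i j. x i j \<omega>) (\<lambda>i. eps i \<omega>) i" for i \<omega>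
  let ?ols = "\<lambda>\<omega>. ols_estimator n p (\<lambda>i. T n i \<omega>) (\<lambda>i j. x i j \<omega>) (\<lambda>i. y i \<omega>)"
  have y_rv: "y i \<in> borel_measurable M" if "i < n" for i
    unfolding y_def outcome_def using that by measurable
  have ols_rv: "(\<lambda>\<omega>. ?ols \<omega> $ k) \<in> borel_measurable M" if k: "k < p + 2" for k
  proof -
    have "?ols \<omega> $ k = (\<Sum>l<p + 2. mat_inv (gram n \<omega>) $$ (k, l) * (\<Sum>i<n. reg n \<omega> i l * y i \<omega>))" for \<omega>
      unfolding ols_estimator_eq mult_mat_vec_index[OF mat_inv_carrier[OF gram_mat_carrier] score_carrier k]
      by (intro sum.cong refl) (simp add: score_def)
    then show ?thesis
      by (simp only:) (intro borel_measurable_sum borel_measurable_times mat_inv_gram_rv reg_rv y_rv;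
        use k in simp)
  qed
  have resid_rv: "(\<lambda>\<omega>. resid_var n p (\<lambda>i. T n i \<omega>) (\<lambda>i j. x i j \<omega>) (\<lambda>i. y i \<omega>)) \<in> borel_measurable M"
    unfolding resid_var_eq
    by (intro borel_measurable_divide borel_measurable_sum borel_measurable_power borel_measurable_diff
        borel_measurable_times borel_measurable_const ols_rv reg_rv y_rv) auto
  have "stat mu1 mu2 n \<omega> = test_stat n p (\<lambda>i. T n i \<omega>) (\<lambda>i j. x i j \<omega>) (\<lambda>i. y i \<omega>)" for \<omega>
    by (simp add: stat_def y_def)
  then have eq: "stat mu1 mu2 n = (\<lambda>\<omega>. test_stat n p (\<lambda>i. T n i \<omega>) (\<lambda>i j. x i j \<omega>) (\<lambda>i. y i \<omega>))"
    by (rule ext)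
  show ?thesis
    unfolding eq test_stat_expand
    by (intro borel_measurable_divide borel_measurable_diff borel_measurable_times
        measurable_compose[OF _ borel_measurable_sqrt] ols_rv resid_rv mat_inv_gram_rv) simp_all
qed

abbreviation H :: "nat \<Rightarrow> 'w \<Rightarrow> real mat" where
  "H n \<omega> \<equiv> mat_inv ((1 / real n) \<cdot>\<^sub>m gram n \<omega>)"

text \<open>The random part of the rescaled contrast; the deterministic drift sqrt n (mu1 - mu2) is
  kept apart.\<close>

definition numerator :: "nat \<Rightarrow> 'w \<Rightarrow> real" where
  "numerator n \<omega> = (\<Sum>l<p + 2. (H n \<omega> $$ (0, l) - H n \<omega> $$ (1, l)) * scaled_score l n \<omega>)"

definition denominator :: "nat \<Rightarrow> 'w \<Rightarrow> real" where
  "denominator n \<omega> = sqrt (((\<Sum>i<n. (err i \<omega>)\<^sup>2) / real n -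
      (\<Sum>k<p + 2. \<Sum>l<p + 2. scaled_score k n \<omega> * H n \<omega> $$ (k, l) * scaled_score l n \<omega>) / real n) *
    (real n / (real n - real p - 2)) *
    (H n \<omega> $$ (0, 0) - H n \<omega> $$ (0, 1) - (H n \<omega> $$ (1, 0) - H n \<omega> $$ (1, 1))))"

lemma stat_eq:
  assumes n: "n > 0" and det: "Determinant.det (gram n \<omega>) \<noteq> 0"
  shows "stat mu1 mu2 n \<omega> = (sqrt (real n) * (mu1 - mu2) + numerator n \<omega>) / denominator n \<omega>"
proof -
  let ?\<theta> = "vec (p + 2) (\<lambda>k. if k = 0 then mu1 else if k = 1 then mu2 else beta (k - 2))"
  have "outcome mu1 mu2 d beta (\<lambda>i. T n i \<omega>) (\<lambda>i j. x i j \<omega>) (\<lambda>i. eps i \<omega>) i =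
      (\<Sum>k<p + 2. reg n \<omega> i k * ?\<theta> $ k) + err i \<omega>" for i
    unfolding outcome_eq_regression[OF p_le] err_def ..
  from test_stat_error[OF _ this det n]
  show ?thesis
    unfolding stat_def numerator_def denominator_def by simp
qed

lemma conv_prob_denominator: "conv_prob M denominator (2 * sqrt err_var)"
proof -
  have quad: "conv_prob M (\<lambda>n \<omega>. (\<Sum>k<p + 2. \<Sum>l<p + 2.
      scaled_score k n \<omega> * H n \<omega> $$ (k, l) * scaled_score l n \<omega>) / real n) 0"
  proof -
    \<comment> \<open>The division by n is shared as 1 / sqrt n between the two score factors, each
      of which then tends to 0.\<close>
    have "conv_prob M (\<lambda>n \<omega>. \<Sum>k<p + 2. \<Sum>l<p + 2.
        (scaled_score k n \<omega> / sqrt (real n)) * H n \<omega> $$ (k, l) * (scaled_score l n \<omega> / sqrt (real n)))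
        (\<Sum>k<p + 2. \<Sum>l<p + 2. 0 * gram_limit_inv $$ (k, l) * 0)"
      by (intro conv_prob_sum conv_prob_mult conv_prob_bounded_div_sqrt bounded_scaled_score
          scaled_score_rv conv_prob_mat_inv_gram) auto
    moreover have "(a / sqrt (real n)) * b * (c / sqrt (real n)) = a * b * c / real n" for a b c n
      by simp
    ultimately show ?thesis by (simp only: sum_divide_distrib) simp
  qed
  have lim: "(\<lambda>n. real n / (real n - real p - 2)) \<longlonglongrightarrow> 1"
    by real_asymp
  \<comment> \<open>The two diagonal entries 2, one for each treatment group holding half of the
    units.\<close>
  have inv: "gram_limit_inv $$ (0, 0) - gram_limit_inv $$ (0, 1) -
      (gram_limit_inv $$ (1, 0) - gram_limit_inv $$ (1, 1)) = 4"
    by (simp add: gram_limit_inv_def)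
  have "conv_prob M denominator (sqrt ((err_var - 0) * 1 *
      (gram_limit_inv $$ (0, 0) - gram_limit_inv $$ (0, 1) -
      (gram_limit_inv $$ (1, 0) - gram_limit_inv $$ (1, 1)))))"
    unfolding denominator_def[abs_def]
    by (intro conv_prob_sqrt conv_prob_mult conv_prob_diff conv_prob_err_sq quad
        conv_prob_tendsto[OF lim] conv_prob_mat_inv_gram) auto
  then show ?thesis unfolding inv by (simp add: real_sqrt_mult mult.commute)
qed

text \<open>In the limit the contrast picks out \<open>2 * (g\<^sub>0 - g\<^sub>1)\<close> from the score \<open>g\<close>, in which the
  omitted covariates enter only through the balanced sums.\<close>

lemma conv_prob_numerator: "conv_prob M (\<lambda>n \<omega>. numerator n \<omega> - 2 * W n \<omega>) 0"
proof -
  let ?c = "\<lambda>l. gram_limit_inv $$ (0, l) - gram_limit_inv $$ (1, l)"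
  let ?h = "\<lambda>n \<omega> l. H n \<omega> $$ (0, l) - H n \<omega> $$ (1, l)"
  \<comment> \<open>Replacing the inverse Gram matrix by its limit costs a vanishing weight times a
    bounded score.\<close>
  have h: "conv_prob M (\<lambda>n \<omega>. scaled_score l n \<omega> * (?h n \<omega> l - ?c l)) 0" if l: "l < p + 2" for l
  proof (rule conv_prob_bounded_mult_zero[OF scaled_score_rv[OF l] bounded_scaled_score[OF l]])
    have "conv_prob M (\<lambda>n \<omega>. ?h n \<omega> l - ?c l) (?c l - ?c l)"
      by (intro conv_prob_diff conv_prob_mat_inv_gram conv_prob_const) (use l in auto)
    then show "conv_prob M (\<lambda>n \<omega>. ?h n \<omega> l - ?c l) 0" by simp
  qed
  have "conv_prob M (\<lambda>n \<omega>. (\<Sum>l<p + 2. scaled_score l n \<omega> * (?h n \<omega> l - ?c l)) +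
      2 * ((\<Sum>i<n. D n i \<omega> * err i \<omega>) / sqrt (real n) - W n \<omega>)) ((\<Sum>l<p + 2. 0) + 2 * 0)"
    by (intro conv_prob_add conv_prob_sum conv_prob_cmult h conv_prob_D_err) auto
  then have "conv_prob M (\<lambda>n \<omega>. numerator n \<omega> - 2 * W n \<omega>) ((\<Sum>l<p + 2. 0) + 2 * 0)"
  proof (rule conv_prob_cong)
    fix n \<omega>
    \<comment> \<open>The limiting inverse is diagonal, so its first two rows ignore the included
      covariates.\<close>
    have "(\<Sum>l<p + 2. ?c l * scaled_score l n \<omega>) = (\<Sum>l\<in>{0, 1}. ?c l * scaled_score l n \<omega>)"
      by (rule sum.mono_neutral_right) (auto simp: gram_limit_inv_def)
    also have "\<dots> = 2 * (scaled_score 0 n \<omega> - scaled_score 1 n \<omega>)"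
      by (simp add: gram_limit_inv_def)
    \<comment> \<open>The half-sums of all errors cancel in the difference; the two halves of the
      signed sum add up.\<close>
    also have "\<dots> = 2 * ((\<Sum>i<n. D n i \<omega> * err i \<omega>) / sqrt (real n))"
      using score_treatment[of 0 n \<omega>] score_treatment[of 1 n \<omega>] by (simp add: sg_def)
    finally have "numerator n \<omega> = (\<Sum>l<p + 2. scaled_score l n \<omega> * (?h n \<omega> l - ?c l)) +
        2 * ((\<Sum>i<n. D n i \<omega> * err i \<omega>) / sqrt (real n))"
      unfolding numerator_def right_diff_distrib sum_subtractf left_diff_distrib
      by (simp only: mult.commute)
    then show "(\<Sum>l<p + 2. scaled_score l n \<omega> * (?h n \<omega> l - ?c l)) +
        2 * ((\<Sum>i<n. D n i \<omega> * err i \<omega>) / sqrt (real n) - W n \<omega>) = numerator n \<omega> - 2 * W n \<omega>"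
      by (simp only: right_diff_distrib)
  qed
  then show ?thesis by simp
qed

text \<open>The determinant converges in probability to a nonzero number, and a singular outcome is
  off by more than half of that number.\<close>

lemma prob_singular_tendsto: "(\<lambda>n. prob {\<omega> \<in> space M. Determinant.det ((1 / real n) \<cdot>\<^sub>m gram n \<omega>) = 0}) \<longlonglongrightarrow> 0"
proof -
  let ?A = "\<lambda>n \<omega>. (1 / real n) \<cdot>\<^sub>m gram n \<omega>" and ?D = "Determinant.det gram_limit"
  have conv: "conv_prob M (\<lambda>n \<omega>. Determinant.det (?A n \<omega>)) ?D"
    by (rule conv_prob_det[OF _ gram_limit_carrier conv_prob_gram]) (intro smult_carrier_mat gram_mat_carrier)
  have [measurable]: "(\<lambda>\<omega>. Determinant.det (?A n \<omega>)) \<in> borel_measurable M" for n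
    using conv by (rule conv_prob_measurable)
  have lim: "(\<lambda>n. prob {\<omega> \<in> space M. \<bar>Determinant.det (?A n \<omega>) - ?D\<bar> > \<bar>?D\<bar> / 2}) \<longlonglongrightarrow> 0"
    using det_gram_limit by (intro conv_probD[OF conv]) simp
  have le: "prob {\<omega> \<in> space M. Determinant.det (?A n \<omega>) = 0} \<le>
      prob {\<omega> \<in> space M. \<bar>Determinant.det (?A n \<omega>) - ?D\<bar> > \<bar>?D\<bar> / 2}" for n
  proof (rule finite_measure_mono)
    show "{\<omega> \<in> space M. Determinant.det (?A n \<omega>) = 0} \<subseteq>
        {\<omega> \<in> space M. \<bar>Determinant.det (?A n \<omega>) - ?D\<bar> > \<bar>?D\<bar> / 2}"
    proof
      fix \<omega> assume "\<omega> \<in> {\<omega> \<in> space M. Determinant.det (?A n \<omega>) = 0}"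
      then have "\<omega> \<in> space M" and 0: "Determinant.det (?A n \<omega>) = 0" by blast+
      then show "\<omega> \<in> {\<omega> \<in> space M. \<bar>Determinant.det (?A n \<omega>) - ?D\<bar> > \<bar>?D\<bar> / 2}"
        unfolding mem_Collect_eq 0 using det_gram_limit by simp
    qed
  qed measurable
  show ?thesis
    by (rule tendsto_sandwich[OF _ _ tendsto_const lim])
       (intro always_eventually allI measure_nonneg le)+
qed

text \<open>\<open>W\<close> has no limit in probability, so limits cannot simply be divided. The
  quotient 2 W / denominator is written as W / sigma_w plus 2 W (1 / denominator - 1 / (2 sigma_w)),
  a bounded sequence times one tending to 0.\<close>

theorem conv_prob_stat:
  assumes delta: "(\<lambda>n. sqrt (real n) * (mu1 n - mu2 n)) \<longlonglongrightarrow> \<delta>"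
  shows "conv_prob M (\<lambda>n \<omega>. stat (mu1 n) (mu2 n) n \<omega> -
    (\<delta> / (2 * sqrt err_var) + 1 / sqrt err_var * W n \<omega>)) 0"
proof -
  let ?s = "sqrt err_var" and ?d = "\<lambda>n. sqrt (real n) * (mu1 n - mu2 n)"
  have s: "?s > 0" using err_var_pos by simp
  have W_rv: "W n \<in> borel_measurable M" for n by measurable
  have num: "conv_prob M (\<lambda>n \<omega>. ?d n + (numerator n \<omega> - 2 * W n \<omega>)) (\<delta> + 0)"
    by (intro conv_prob_add conv_prob_tendsto delta conv_prob_numerator)
  have num_W: "bounded_in_prob M (\<lambda>n \<omega>. 2 * W n \<omega>)"
    by (rule bounded_in_prob_cmult[OF bounded_W])
  have inv: "conv_prob M (\<lambda>n \<omega>. 1 / denominator n \<omega>) (1 / (2 * ?s))"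
    by (intro conv_prob_divide conv_prob_const conv_prob_denominator) (use s in simp)
  have inv0: "conv_prob M (\<lambda>n \<omega>. 1 / denominator n \<omega> - 1 / (2 * ?s)) 0"
    using conv_prob_diff[OF inv conv_prob_const[of "1 / (2 * ?s)"]] by simp
  have W_inv: "conv_prob M (\<lambda>n \<omega>. 2 * W n \<omega> * (1 / denominator n \<omega> - 1 / (2 * ?s))) 0"
    by (rule conv_prob_bounded_mult_zero[OF _ num_W inv0]) (use W_rv in measurable)
  have "conv_prob M (\<lambda>n \<omega>. (?d n + (numerator n \<omega> - 2 * W n \<omega>)) * (1 / denominator n \<omega>) +
      2 * W n \<omega> * (1 / denominator n \<omega> - 1 / (2 * ?s)) - \<delta> / (2 * ?s))
    ((\<delta> + 0) * (1 / (2 * ?s)) + 0 - \<delta> / (2 * ?s))"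
    by (intro conv_prob_diff conv_prob_add conv_prob_mult conv_prob_const num inv W_inv)
  then have main: "conv_prob M (\<lambda>n \<omega>. (?d n + (numerator n \<omega> - 2 * W n \<omega>)) * (1 / denominator n \<omega>) +
      2 * W n \<omega> * (1 / denominator n \<omega> - 1 / (2 * ?s)) - \<delta> / (2 * ?s)) 0"
    by simp
  let ?N = "\<lambda>n. {\<omega> \<in> space M. Determinant.det ((1 / real n) \<cdot>\<^sub>m gram n \<omega>) = 0}"
  show ?thesis
  proof (rule conv_prob_cong_in_prob[OF main _ _ prob_singular_tendsto])
    show "(\<lambda>\<omega>. stat (mu1 n) (mu2 n) n \<omega> - (\<delta> / (2 * ?s) + 1 / ?s * W n \<omega>)) \<in> borel_measurable M" for n
      by measurable
    show "?N n \<in> events" for n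
    proof -
      have [measurable]: "(\<lambda>\<omega>. Determinant.det ((1 / real n) \<cdot>\<^sub>m gram n \<omega>)) \<in> borel_measurable M"
        by (rule borel_measurable_det[OF smult_carrier_mat[OF gram_mat_carrier]
              conv_prob_measurable[OF conv_prob_gram]])
      show ?thesis by measurable
    qed
    show "\<forall>\<^sub>F n in sequentially. \<forall>\<omega>\<in>space M - ?N n.
      (?d n + (numerator n \<omega> - 2 * W n \<omega>)) * (1 / denominator n \<omega>) +
        2 * W n \<omega> * (1 / denominator n \<omega> - 1 / (2 * ?s)) - \<delta> / (2 * ?s) =
      stat (mu1 n) (mu2 n) n \<omega> - (\<delta> / (2 * ?s) + 1 / ?s * W n \<omega>)"
      using eventually_gt_at_top[of 0]
    proof eventually_elim
      case (elim n)
      show ?case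
      proof
        fix \<omega> assume "\<omega> \<in> space M - ?N n"
        \<comment> \<open>Rescaling the matrix only multiplies its determinant by a power of
          1/n.\<close>
        then have "Determinant.det (gram n \<omega>) \<noteq> 0" by auto
        then have "stat (mu1 n) (mu2 n) n \<omega> = (?d n + numerator n \<omega>) * (1 / denominator n \<omega>)"
          using stat_eq[OF elim] by simp
        moreover have "(D + (N - 2 * V)) * E + 2 * V * (E - 1 / (2 * s)) - q =
            (D + N) * E - (q + 1 / s * V)" for D N V E s q :: real
          by (simp add: algebra_simps)
        ultimately show "(?d n + (numerator n \<omega> - 2 * W n \<omega>)) * (1 / denominator n \<omega>) +
            2 * W n \<omega> * (1 / denominator n \<omega> - 1 / (2 * ?s)) - \<delta> / (2 * ?s) =
          stat (mu1 n) (mu2 n) n \<omega> - (\<delta> / (2 * ?s) + 1 / ?s * W n \<omega>)"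
          by (simp only:)
      qed
    qed
  qed
qed

text \<open>The null hypothesis and the local alternatives are one statement here: only the limit of
  the drift sqrt n (mu1 - mu2) distinguishes them.\<close>

theorem weak_conv_stat:
  assumes "(\<lambda>n. sqrt (real n) * (mu1 n - mu2 n)) \<longlonglongrightarrow> \<delta>"
  shows "weak_conv_m (\<lambda>n. distr M borel (stat (mu1 n) (mu2 n) n))
    (normal_law (\<delta> / (2 * sqrt err_var)) (v / err_var))"
proof -
  have "weak_conv_m (\<lambda>n. distr M borel (stat (mu1 n) (mu2 n) n))
      (normal_law (\<delta> / (2 * sqrt err_var)) ((1 / sqrt err_var)\<^sup>2 * v))"
    by (rule weak_conv_affine_normal[OF stat_rv _ char_W_tendsto conv_prob_stat[OF assms] v_pos])
       (use err_var_pos in auto)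
  then show ?thesis using err_var_pos by (simp add: power_divide)
qed

end

section \<open>Specialization to pairwise sequential randomization\<close>

theorem theorem4p2:
  fixes M :: "'w measure"
    and p q :: nat
    and X :: "nat \<Rightarrow> 'w \<Rightarrow> real"
    and x :: "nat \<Rightarrow> nat \<Rightarrow> 'w \<Rightarrow> real"
    and eps :: "nat \<Rightarrow> 'w \<Rightarrow> real"
    and T :: "nat \<Rightarrow> nat \<Rightarrow> 'w \<Rightarrow> real"
    and C :: "nat \<Rightarrow> nat \<Rightarrow> 'w \<Rightarrow> real mat"
    and beta :: "nat \<Rightarrow> real"
    and r sigma_eps sigma_w lambda2 :: real
    and S :: "real \<Rightarrow> real \<Rightarrow> nat \<Rightarrow> 'w \<Rightarrow> real"
  assumes prob: "prob_space M"
    and X_indep: "prob_space.indep_vars M (\<lambda>_. borel) X {..<p + q}"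
    and X_sq: "\<And>j. j < p + q \<Longrightarrow> integrable M (\<lambda>\<omega>. (X j \<omega>)\<^sup>2)"
    and X_mean: "\<And>j. j < p + q \<Longrightarrow> prob_space.expectation M (X j) = 0"
    and X_var: "\<And>j. j < p + q \<Longrightarrow> prob_space.variance M (X j) > 0"
    and x_indep: "prob_space.indep_vars M (\<lambda>_. vec_space (p + q))
                    (\<lambda>i. cov_vec (p + q) (x i)) UNIV"
    and x_law: "\<And>i. distr M (vec_space (p + q)) (cov_vec (p + q) (x i)) =
                    distr M (vec_space (p + q)) (cov_vec (p + q) X)"
    and eps_indep: "prob_space.indep_vars M (\<lambda>_. borel) eps UNIV"
    and eps_law: "\<And>i. distr M borel (eps i) = distr M borel (eps 0)"
    and eps_sq: "integrable M (\<lambda>\<omega>. (eps 0 \<omega>)\<^sup>2)"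
    and eps_mean: "prob_space.expectation M (eps 0) = 0"
    and eps_var: "prob_space.variance M (eps 0) = sigma_eps\<^sup>2"
    and sigma_eps: "sigma_eps > 0"
    and T_x_eps: "\<And>n. indep_elements M
          (vec_space n \<Otimes>\<^sub>M array_space n (p + q))
          (\<lambda>\<omega>. (cov_vec n (T n) \<omega>, cov_array n (p + q) x \<omega>))
          (vec_space n) (cov_vec n eps)"
    and coin: "1 / 2 < r" "r \<le> 1"
    and psr: "\<And>n. PSR M r n (p + q) (C n) x (T n)"
    and balance: "bounded_in_prob M
          (\<lambda>n \<omega>. L2_set (\<lambda>j. \<Sum>i<n. (2 * T n i \<omega> - 1) * x i j \<omega>) {..<p + q})"
    and S_def: "\<And>mu1 mu2 n \<omega>. S mu1 mu2 n \<omega> =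
          test_stat n p (\<lambda>i. T n i \<omega>) (\<lambda>i j. x i j \<omega>)
            (outcome mu1 mu2 (p + q) beta (\<lambda>i. T n i \<omega>) (\<lambda>i j. x i j \<omega>) (\<lambda>i. eps i \<omega>))"
    and sigma_w_def: "sigma_w =
          sqrt (sigma_eps\<^sup>2 + (\<Sum>j<q. (beta (p + j))\<^sup>2 * prob_space.variance M (X (p + j))))"
    and lambda2_def: "lambda2 = 1 / sigma_w"
  shows "(\<forall>mu1 mu2 :: real. mu1 - mu2 = 0 \<longrightarrow>
            weak_conv_m (\<lambda>n. distr M borel (S mu1 mu2 n))
              (normal_law 0 (sigma_eps\<^sup>2 /
                 (sigma_eps\<^sup>2 + (\<Sum>j<q. (beta (p + j))\<^sup>2 * prob_space.variance M (X (p + j)))))))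
       \<and> (\<forall>(mu1 :: nat \<Rightarrow> real) (mu2 :: nat \<Rightarrow> real) (delta :: real).
            delta \<noteq> 0 \<longrightarrow> (\<forall>n>0. mu1 n - mu2 n = delta / sqrt (real n)) \<longrightarrow>
            weak_conv_m (\<lambda>n. distr M borel (S (mu1 n) (mu2 n) n))
              (normal_law (1 / 2 * lambda2 * delta) (sigma_eps\<^sup>2 /
                 (sigma_eps\<^sup>2 + (\<Sum>j<q. (beta (p + j))\<^sup>2 * prob_space.variance M (X (p + j)))))))"
proof -
  interpret prob_space M by (rule prob)
  interpret balanced_linear_model M p "p + q" X x eps T beta "sigma_eps\<^sup>2"
  proof unfold_locales
    show "0 < sigma_eps\<^sup>2" using sigma_eps by simp
    show "T n i \<in> borel_measurable M" if "i < n" for n i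
      using psr[of n] that by (simp add: PSR_def)
    show "T n i \<omega> \<in> {0, 1}" if "i < n" "\<omega> \<in> space M" for n i \<omega>
      using psr[of n] that by (simp add: PSR_def)
    show "\<bar>\<Sum>i<n. 2 * T n i \<omega> - 1\<bar> \<le> 1" if "\<omega> \<in> space M" for n \<omega>
      by (rule PSR_balanced[OF psr that])
  qed (fact X_indep X_sq X_mean X_var x_indep x_law eps_indep eps_law eps_sq eps_mean eps_var
      T_x_eps balance | simp)+
  \<comment> \<open>Reindexes the omitted covariates from positions p, ..., p + q - 1 to 0, ..., q -
    1.\<close>
  have omitted: "(\<Sum>j\<in>{p..<p + q}. (beta j)\<^sup>2 * variance (X j)) =
      (\<Sum>j<q. (beta (p + j))\<^sup>2 * variance (X (p + j)))"
    using sum.shift_bounds_nat_ivl[of "\<lambda>j. (beta j)\<^sup>2 * variance (X j)" 0 p q]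
    by (simp add: lessThan_atLeast0 add.commute)
  have err_var: "err_var = sigma_eps\<^sup>2 + (\<Sum>j<q. (beta (p + j))\<^sup>2 * variance (X (p + j)))"
    unfolding err_var_def omitted ..
  have S: "S mu1 mu2 n = stat mu1 mu2 n" for mu1 mu2 n
    by (rule ext) (simp add: S_def stat_def)
  show ?thesis
    unfolding S err_var[symmetric]
  proof (intro conjI allI impI)
    fix mu1 mu2 :: real assume "mu1 - mu2 = 0"
    then show "weak_conv_m (\<lambda>n. distr M borel (stat mu1 mu2 n)) (normal_law 0 (sigma_eps\<^sup>2 / err_var))"
      using weak_conv_stat[of "\<lambda>_. mu1" "\<lambda>_. mu2" 0] by simp
  next
    fix mu1 mu2 :: "nat \<Rightarrow> real" and delta :: real
    assume mu: "\<forall>n>0. mu1 n - mu2 n = delta / sqrt (real n)"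
    \<comment> \<open>The local alternative is scaled so that the drift is constant; the relation is
      given for positive n only, hence eventually.\<close>
    have "\<forall>\<^sub>F n in sequentially. sqrt (real n) * (mu1 n - mu2 n) = delta"
      using eventually_gt_at_top[of 0] by eventually_elim (use mu in simp)
    then have "(\<lambda>n. sqrt (real n) * (mu1 n - mu2 n)) \<longlonglongrightarrow> delta"
      by (rule tendsto_eventually)
    from weak_conv_stat[OF this]
    show "weak_conv_m (\<lambda>n. distr M borel (stat (mu1 n) (mu2 n) n))
        (normal_law (1 / 2 * lambda2 * delta) (sigma_eps\<^sup>2 / err_var))"
      by (simp add: lambda2_def sigma_w_def err_var mult.commute)
  qed
qed

end
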